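(* Let $p$ be an odd prime and let $G$ be an $\mathcal{M}_1$ $p$-group. Then $G$ has a regular power structure, unless $G$ is (isomorphic to) the unique, up to isomorphism, $\mathcal{M}_1$ group of order $81$ and maximal class (that is, of nilpotency class $3$), in which case the condition "$|G:\mho_i(G)|=|\Omega_i(G)|$ for all positive integers $i$" fails to hold.
   Context: For a finite $p$-group $G$ and $k\ge 0$, $\mho_k(G)=\langle g^{p^k} \mid g\in G\rangle$ and $\Omega_k(G)=\langle g\in G \mid g^{p^k}=1\rangle$. For $p$ odd, a finite $p$-group $G$ is powerful if $[G,G]\leq \mho_1(G)$. An $\mathcal{M}_1$ group (or $\mathcal{M}_1$ $p$-group) is a finite $p$-group all of whose maximal subgroups (i.e. subgroups of index $p$) are powerful. A finite $p$-group $G$ has a regular power structure if the following three conditions hold for all positive integers $i$: (1) $\mho_i(G)=\{g^{p^i}\mid g\in G\}$; (2) $\Omega_i(G)=\{g\in G\mid o(g)\leq p^i\}$; (3) $|G:\mho_i(G)|=|\Omega_i(G)|$. The exceptional group is the group $J$ of order $81$ given in GAP by SmallGroup(81,10), with power-commutator presentation $J=\langle a_1,a_2,a_3,a_4\mid a_1^3=a_4,\ a_2^3=a_4^2,\ a_3^3=1,\ a_4^3=1,\ [a_2,a_1]=a_3,\ [a_3,a_1]=a_4\rangle$, where the four remaining commutators $[a_j,a_i]$ with $j>i$ are trivial. *)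

theory Defs
  imports "HOL-Algebra.Algebra"
begin

definition mho :: "nat \<Rightarrow> nat \<Rightarrow> ('a, 'b) monoid_scheme \<Rightarrow> 'a set" where
  "mho p k G = generate G {g [^]\<^bsub>G\<^esub> (p ^ k) | g. g \<in> carrier G}"

definition Omega :: "nat \<Rightarrow> nat \<Rightarrow> ('a, 'b) monoid_scheme \<Rightarrow> 'a set" where
  "Omega p k G = generate G {g \<in> carrier G. g [^]\<^bsub>G\<^esub> (p ^ k) = \<one>\<^bsub>G\<^esub>}"

text \<open>The order \<open>p ^ n\<close> is nonzero for prime \<open>p\<close>, so the carrier is automatically finite;
  the trivial group is allowed.\<close>

definition finite_p_group :: "nat \<Rightarrow> ('a, 'b) monoid_scheme \<Rightarrow> bool" where
  "finite_p_group p G \<longleftrightarrow> Factorial_Ring.prime p \<and> group G \<and> (\<exists>n. order G = p ^ n)"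

text \<open>This is the notion of a powerful \<open>p\<close>-group for odd \<open>p\<close> only.\<close>

definition powerful :: "nat \<Rightarrow> ('a, 'b) monoid_scheme \<Rightarrow> bool" where
  "powerful p G \<longleftrightarrow> finite_p_group p G \<and> derived G (carrier G) \<subseteq> mho p 1 G"

definition maximal_subgroup :: "'a set \<Rightarrow> ('a, 'b) monoid_scheme \<Rightarrow> bool" where
  "maximal_subgroup M G \<longleftrightarrow> subgroup M G \<and> M \<noteq> carrier G \<and>
     (\<forall>K. subgroup K G \<and> M \<subseteq> K \<longrightarrow> K = M \<or> K = carrier G)"

definition M1_group :: "nat \<Rightarrow> ('a, 'b) monoid_scheme \<Rightarrow> bool" where
  "M1_group p G \<longleftrightarrow> finite_p_group p G \<and>
     (\<forall>M. maximal_subgroup M G \<longrightarrow> powerful p (G\<lparr>carrier := M\<rparr>))"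

definition mho_index_eq_card_Omega :: "nat \<Rightarrow> nat \<Rightarrow> ('a, 'b) monoid_scheme \<Rightarrow> bool" where
  "mho_index_eq_card_Omega p i G \<longleftrightarrow> card (rcosets\<^bsub>G\<^esub> (mho p i G)) = card (Omega p i G)"

definition regular_power_structure :: "nat \<Rightarrow> ('a, 'b) monoid_scheme \<Rightarrow> bool" where
  "regular_power_structure p G \<longleftrightarrow> (\<forall>i\<ge>1.
     mho p i G = {g [^]\<^bsub>G\<^esub> (p ^ i) | g. g \<in> carrier G} \<and>
     Omega p i G = {g \<in> carrier G. group.ord G g \<le> p ^ i} \<and>
     mho_index_eq_card_Omega p i G)"

text \<open>Lower central series, with index shifted so that \<open>lower_central G 0\<close> is the whole group
  (usually written as the first term).\<close>

primrec lower_central :: "('a, 'b) monoid_scheme \<Rightarrow> nat \<Rightarrow> 'a set" where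
  "lower_central G 0 = carrier G"
| "lower_central G (Suc n) = generate G
     {x \<otimes>\<^bsub>G\<^esub> y \<otimes>\<^bsub>G\<^esub> inv\<^bsub>G\<^esub> x \<otimes>\<^bsub>G\<^esub> inv\<^bsub>G\<^esub> y | x y. x \<in> lower_central G n \<and> y \<in> carrier G}"

definition has_nilpotency_class :: "('a, 'b) monoid_scheme \<Rightarrow> nat \<Rightarrow> bool" where
  "has_nilpotency_class G c \<longleftrightarrow>
     lower_central G c = {\<one>\<^bsub>G\<^esub>} \<and> (\<forall>k<c. lower_central G k \<noteq> {\<one>\<^bsub>G\<^esub>})"


section \<open>Groups given by generators and relations\<close>

text \<open>A word is a list of letters; \<open>(x, True)\<close> stands for the generator \<open>x\<close> and
  \<open>(x, False)\<close> for its formal inverse. A relation \<open>l = r\<close> is the pair \<open>(l, r)\<close>.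
  The presented group consists of all words modulo the least congruence containing free
  cancellation and the relations, i.e. it is the free group modulo the normal closure of the
  relators.\<close>

type_synonym 'g word = "('g \<times> bool) list"

inductive word_eq :: "('g word \<times> 'g word) set \<Rightarrow> 'g word \<Rightarrow> 'g word \<Rightarrow> bool"
  for R where
  refl: "word_eq R u u"
| sym: "word_eq R u v \<Longrightarrow> word_eq R v u"
| trans: "word_eq R u v \<Longrightarrow> word_eq R v w \<Longrightarrow> word_eq R u w"
| cancel: "word_eq R (u @ [(x, b), (x, \<not> b)] @ v) (u @ v)"
| rel: "(l, r) \<in> R \<Longrightarrow> word_eq R (u @ l @ v) (u @ r @ v)"

definition word_rel :: "('g word \<times> 'g word) set \<Rightarrow> ('g word \<times> 'g word) set" where
  "word_rel R = {(u, v). word_eq R u v}"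

definition presented_group :: "('g word \<times> 'g word) set \<Rightarrow> 'g word set monoid" where
  "presented_group R =
     \<lparr>carrier = UNIV // word_rel R,
      monoid.mult = (\<lambda>A B. \<Union>u\<in>A. \<Union>v\<in>B. word_rel R `` {u @ v}),
      monoid.one = word_rel R `` {[]}\<rparr>"

definition inv_word :: "'g word \<Rightarrow> 'g word" where
  "inv_word w = rev (map (\<lambda>(x, b). (x, \<not> b)) w)"

lemma equiv_word_rel: "equiv UNIV (word_rel R)"
  by (auto simp: word_rel_def intro!: equivI refl_onI symI transI
      intro: word_eq.refl word_eq.sym word_eq.trans)

lemma word_eq_append_left: "word_eq R u u' \<Longrightarrow> word_eq R (w @ u) (w @ u')"
proof (induction rule: word_eq.induct)
  case (cancel u x b v)
  show ?case using word_eq.cancel[of R "w @ u" x b v] by simp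
next
  case (rel l r u v)
  then show ?case using word_eq.rel[of l r R "w @ u" v] by simp
qed (auto intro: word_eq.refl word_eq.sym word_eq.trans)

lemma word_eq_append_right: "word_eq R u u' \<Longrightarrow> word_eq R (u @ w) (u' @ w)"
proof (induction rule: word_eq.induct)
  case (cancel u x b v)
  show ?case using word_eq.cancel[of R u x b "v @ w"] by simp
next
  case (rel l r u v)
  then show ?case using word_eq.rel[of l r R u "v @ w"] by simp
qed (auto intro: word_eq.refl word_eq.sym word_eq.trans)

lemma word_eq_append:
  "word_eq R u u' \<Longrightarrow> word_eq R v v' \<Longrightarrow> word_eq R (u @ v) (u' @ v')"
  by (meson word_eq.trans word_eq_append_left word_eq_append_right)

lemma presented_group_mult:
  "word_rel R `` {u} \<otimes>\<^bsub>presented_group R\<^esub> word_rel R `` {v} = word_rel R `` {u @ v}"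
  unfolding presented_group_def
  by (auto simp: word_rel_def)
    (meson word_eq.refl word_eq.sym word_eq.trans word_eq_append)+

lemma word_eq_inv_word_append: "word_eq R (inv_word w @ w) []"
proof (induction w)
  case Nil
  then show ?case by (simp add: inv_word_def word_eq.refl)
next
  case (Cons a w)
  obtain x b where a: "a = (x, b)" by fastforce
  have "word_eq R (inv_word w @ [(x, \<not> b), (x, \<not> \<not> b)] @ w) (inv_word w @ w)"
    by (rule word_eq.cancel)
  then show ?case
    using Cons word_eq.trans by (fastforce simp: a inv_word_def)
qed

lemma group_presented_group: "group (presented_group R)"
proof (rule groupI)
  have carr: "\<exists>u. A = word_rel R `` {u}" if "A \<in> carrier (presented_group R)" for A
    using that by (auto simp: presented_group_def quotient_def)
  have in_carr: "word_rel R `` {u} \<in> carrier (presented_group R)" for u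
    by (auto simp: presented_group_def quotient_def)
  have one: "\<one>\<^bsub>presented_group R\<^esub> = word_rel R `` {[]}"
    by (simp add: presented_group_def)
  note m = presented_group_mult
  show "\<one>\<^bsub>presented_group R\<^esub> \<in> carrier (presented_group R)"
    using in_carr one by simp
  show "x \<otimes>\<^bsub>presented_group R\<^esub> y \<in> carrier (presented_group R)"
    if "x \<in> carrier (presented_group R)" "y \<in> carrier (presented_group R)" for x y
    using carr[OF that(1)] carr[OF that(2)] by (auto simp: m in_carr)
  show "x \<otimes>\<^bsub>presented_group R\<^esub> y \<otimes>\<^bsub>presented_group R\<^esub> z =
      x \<otimes>\<^bsub>presented_group R\<^esub> (y \<otimes>\<^bsub>presented_group R\<^esub> z)"
    if "x \<in> carrier (presented_group R)" "y \<in> carrier (presented_group R)"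
      "z \<in> carrier (presented_group R)" for x y z
    using carr[OF that(1)] carr[OF that(2)] carr[OF that(3)] by (auto simp: m)
  show "\<one>\<^bsub>presented_group R\<^esub> \<otimes>\<^bsub>presented_group R\<^esub> x = x"
    if "x \<in> carrier (presented_group R)" for x
    using carr[OF that] by (auto simp: m one)
  show "\<exists>y\<in>carrier (presented_group R). y \<otimes>\<^bsub>presented_group R\<^esub> x = \<one>\<^bsub>presented_group R\<^esub>"
    if x: "x \<in> carrier (presented_group R)" for x
  proof -
    obtain u where u: "x = word_rel R `` {u}" using carr[OF x] by blast
    have "word_rel R `` {inv_word u} \<otimes>\<^bsub>presented_group R\<^esub> x = \<one>\<^bsub>presented_group R\<^esub>"
      unfolding u m one
      by (rule equiv_class_eq[OF equiv_word_rel])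
        (simp add: word_rel_def word_eq_inv_word_append)
    then show ?thesis using in_carr by blast
  qed
qed


section \<open>The exceptional group of order 81\<close>

datatype J_gen = A1 | A2 | A3 | A4

definition gen_word :: "'g \<Rightarrow> 'g word" where
  "gen_word x = [(x, True)]"

text \<open>Commutator convention of GAP: \<open>[x, y] = x\<^sup>-\<^sup>1 y\<^sup>-\<^sup>1 x y\<close>.\<close>

definition comm_word :: "'g \<Rightarrow> 'g \<Rightarrow> 'g word" where
  "comm_word x y = [(x, False), (y, False), (x, True), (y, True)]"

definition J_relations :: "(J_gen word \<times> J_gen word) set" where
  "J_relations =
    {(gen_word A1 @ gen_word A1 @ gen_word A1, gen_word A4),
     (gen_word A2 @ gen_word A2 @ gen_word A2, gen_word A4 @ gen_word A4),
     (gen_word A3 @ gen_word A3 @ gen_word A3, []),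
     (gen_word A4 @ gen_word A4 @ gen_word A4, []),
     (comm_word A2 A1, gen_word A3),
     (comm_word A3 A1, gen_word A4),
     (comm_word A4 A1, []),
     (comm_word A3 A2, []),
     (comm_word A4 A2, []),
     (comm_word A4 A3, [])}"

definition exceptional_J :: "J_gen word set monoid" where
  "exceptional_J = presented_group J_relations"

definition M1_81_maximal_class :: "('a, 'b) monoid_scheme \<Rightarrow> bool" where
  "M1_81_maximal_class H \<longleftrightarrow>
     (\<exists>q. M1_group q H) \<and> order H = 81 \<and> has_nilpotency_class H 3"

end

theory Submission imports Defs Complex_Main begin

text \<open>Everything takes place inside one finite \<open>p\<close>-group \<open>G\<close> with \<open>p\<close> odd. For a subgroup \<open>H\<close>
  write \<open>pw H\<close> for the subgroup generated by its \<open>p\<close>-th powers, and \<open>H_k\<close> for the \<open>k\<close>-fold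
  iterate of \<open>pw\<close> at \<open>H\<close>. The idea is that a regular power structure follows as soon as the
  map that raises to the power \<open>p\<close> is nearly multiplicative, and that maximal subgroups that
  are powerful force this unless \<open>p = 3\<close> and certain linear equations over the field with
  three elements have a common solution, which pins down a single group.

  Powerful groups. If \<open>H\<close> is powerful, then commutators of \<open>H_k\<close> with \<open>H\<close> lie in \<open>H_(k+1)\<close>,
  so the collection formula gives \<open>(x c)^p = x^p c^p\<close> modulo \<open>H_(k+2)\<close> for \<open>c\<close> in \<open>H_k\<close>.
  Hence the translation by \<open>c\<close> shifts the \<open>p\<close>-th powers by \<open>c^p\<close> up to an error that lies
  one step further down the chain. Working up the chain from the trivial group, all elements
  of \<open>H_1\<close> have the same number of \<open>p\<close>-th roots (\<open>powerful_uniform\<close>). Counting roots of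
  roots then yields that \<open>p^i\<close>-th powers form a subgroup and that its index is the number of
  solutions of \<open>g^(p^i) = 1\<close> (\<open>uniform_power_structure\<close>). That these solutions form a
  subgroup is a separate induction over the order of the group (\<open>powerful_om_subgroup\<close>).

  Groups with powerful maximal subgroups that are not powerful. Two elements whose
  commutator is not in \<open>pw G\<close> generate \<open>G\<close>; the Frattini subgroup \<open>Phi\<close> is powerful, and
  \<open>[pw G, G]\<close> lies in \<open>pw Phi\<close>. Each coset of \<open>Phi\<close> lies in a powerful maximal subgroup, so
  the translation argument works there and shows that factors from \<open>pw Phi\<close> do not change
  the number of \<open>p\<close>-th roots. What remains is the behaviour modulo \<open>pw Phi\<close>: if the power
  map is multiplicative there, the group has a regular power structure (\<open>uniform_carrier\<close>,
  \<open>om_carrier_subgroup\<close>). The collection formula gives this multiplicativity when \<open>p\<close>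
  exceeds \<open>3\<close>, and also for \<open>p = 3\<close> when \<open>[Phi, G]\<close> lies in \<open>pw Phi\<close>.

  The exceptional case. Let \<open>p = 3\<close> and suppose that \<open>[Phi, G]\<close> is not contained in \<open>pw
  Phi\<close>. Because maximal subgroups are powerful, \<open>[f, x]\<close> is modulo \<open>pw Phi\<close> a power of \<open>x^3\<close>
  for \<open>f\<close> in \<open>Phi\<close> and every member \<open>x\<close> of a generating pair. Comparing this for \<open>a\<close>, \<open>b\<close>,
  \<open>a b\<close> and \<open>a b^-1\<close> over the field with three elements leaves a pair with \<open>[b,a,a] = a^3\<close>,
  \<open>[b,a,b] = 1\<close> and \<open>b^3 = a^-3\<close> modulo \<open>pw Phi\<close> (\<open>exceptional_pair\<close>). A descent shows that
  \<open>pw Phi\<close> is trivial, so the relations hold exactly (\<open>exceptional_structure\<close>). They imply a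
  normal form \<open>a^i b^j c^k\<close> with \<open>81\<close> different values, so they determine the group up to
  isomorphism; and since all cubes lie in a group of order \<open>3\<close> while at most \<open>9\<close> elements
  have trivial cubes, the index of \<open>mho 3 1\<close> exceeds the order of \<open>Omega 3 1\<close>.

  Uniqueness. A group of order \<open>81\<close> and class \<open>3\<close> with powerful maximal subgroups can
  neither be powerful (\<open>powerful_81_class\<close>) nor satisfy \<open>[Phi, G] \<subseteq> pw Phi\<close>
  (\<open>Phi_central_81_class\<close>), so it falls under the exceptional case.\<close>

section \<open>Commutators and relative normality\<close>

lemma subgroup_pow_closed:
  assumes "group G" "subgroup H G" "h \<in> H"
  shows "h [^]\<^bsub>G\<^esub> (n::nat) \<in> H"
  using assms by (metis group.subgroup_int_pow_closed int_pow_int)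

context group
begin

text \<open>The inverses stand on the left, as in the presentation of the exceptional group, so that
  conjugation reads \<open>inv y \<otimes> x \<otimes> y = x \<otimes> comm x y\<close>. Derived subgroups and lower central
  series are built from the opposite arrangement, which is \<open>comm (inv x) (inv y)\<close> in this
  notation.\<close>

definition comm :: "'a \<Rightarrow> 'a \<Rightarrow> 'a" where
  "comm x y = inv x \<otimes> inv y \<otimes> x \<otimes> y"

text \<open>Normality of one subgroup in another. The proofs pass constantly between many subgroups of
  one finite group; treating them as subsets of a single carrier avoids changing the ambient
  group.\<close>

definition normal_in :: "'a set \<Rightarrow> 'a set \<Rightarrow> bool" where
  "normal_in N H \<longleftrightarrow> subgroup N G \<and> subgroup H G \<and> N \<subseteq> H \<and> (\<forall>n\<in>N. \<forall>h\<in>H. comm n h \<in> N)"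

lemma inv_cancel [simp]:
  assumes "x \<in> carrier G" "y \<in> carrier G"
  shows "inv x \<otimes> (x \<otimes> y) = y" "x \<otimes> (inv x \<otimes> y) = y"
  using assms by (simp_all flip: m_assoc)

lemma comm_closed [simp]: "x \<in> carrier G \<Longrightarrow> y \<in> carrier G \<Longrightarrow> comm x y \<in> carrier G"
  by (simp add: comm_def)

lemma comm_in_subgroup: "subgroup H G \<Longrightarrow> x \<in> H \<Longrightarrow> y \<in> H \<Longrightarrow> comm x y \<in> H"
  by (simp add: comm_def subgroup.m_closed subgroup.m_inv_closed)

lemma mult_comm_swap:
  assumes "x \<in> carrier G" "y \<in> carrier G"
  shows "x \<otimes> y = y \<otimes> x \<otimes> comm x y"
  using assms by (simp add: comm_def m_assoc)

lemma conj_eq_mult_comm: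
  assumes "x \<in> carrier G" "y \<in> carrier G"
  shows "inv y \<otimes> x \<otimes> y = x \<otimes> comm x y"
  using assms by (simp add: comm_def m_assoc)

lemma inv_commutator:
  assumes "x \<in> carrier G" "y \<in> carrier G"
  shows "inv (comm x y) = comm y x"
  using assms by (simp add: comm_def m_assoc inv_mult_group)

lemma comm_eq_one_iff:
  assumes "x \<in> carrier G" "y \<in> carrier G"
  shows "comm x y = \<one> \<longleftrightarrow> x \<otimes> y = y \<otimes> x"
proof
  assume "comm x y = \<one>"
  then show "x \<otimes> y = y \<otimes> x" using mult_comm_swap[OF assms] assms by simp
next
  assume "x \<otimes> y = y \<otimes> x"
  then have "comm x y = inv x \<otimes> (inv y \<otimes> (y \<otimes> x))" using assms by (simp add: comm_def m_assoc)
  then show "comm x y = \<one>" using assms by simp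
qed

lemma conj_pow:
  assumes "x \<in> carrier G" "y \<in> carrier G"
  shows "inv y \<otimes> x [^] (n::nat) \<otimes> y = (inv y \<otimes> x \<otimes> y) [^] n"
proof (induction n)
  case (Suc n)
  have "inv y \<otimes> x [^] Suc n \<otimes> y = (inv y \<otimes> x [^] n \<otimes> y) \<otimes> (inv y \<otimes> x \<otimes> y)"
    using assms by (simp add: m_assoc)
  then show ?case using Suc assms by simp
qed (use assms in simp)

lemma normal_inD:
  assumes "normal_in N H"
  shows "subgroup N G" "subgroup H G" "N \<subseteq> H" "n \<in> N \<Longrightarrow> h \<in> H \<Longrightarrow> comm n h \<in> N"
    "n \<in> N \<Longrightarrow> h \<in> H \<Longrightarrow> comm h n \<in> N"
    "n \<in> N \<Longrightarrow> h \<in> H \<Longrightarrow> inv h \<otimes> n \<otimes> h \<in> N"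
    "n \<in> N \<Longrightarrow> h \<in> H \<Longrightarrow> h \<otimes> n \<otimes> inv h \<in> N"
proof -
  show N: "subgroup N G" and H: "subgroup H G" and NH: "N \<subseteq> H"
    using assms by (auto simp: normal_in_def)
  show 1: "comm n h \<in> N" if "n \<in> N" "h \<in> H" for n h
    using assms that by (auto simp: normal_in_def)
  show "comm h n \<in> N" if "n \<in> N" "h \<in> H"
    using 1[OF that] inv_commutator[of n h] subgroup.m_inv_closed[OF N]
      subgroup.mem_carrier[OF N] subgroup.mem_carrier[OF H] that by metis
  show 2: "inv h \<otimes> n \<otimes> h \<in> N" if "n \<in> N" "h \<in> H" for n h
    using 1[OF that] conj_eq_mult_comm[of n h] subgroup.m_closed[OF N]
      subgroup.mem_carrier[OF N] subgroup.mem_carrier[OF H] that by metis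
  show "h \<otimes> n \<otimes> inv h \<in> N" if "n \<in> N" "h \<in> H"
    using 2[of n "inv h"] that subgroup.m_inv_closed[OF H] subgroup.mem_carrier[OF H] by simp
qed

lemma normal_in_iff_normal: "subgroup H G \<Longrightarrow> normal_in N H \<Longrightarrow> N \<lhd> G\<lparr>carrier := H\<rparr>"
proof -
  assume H: "subgroup H G" and N: "normal_in N H"
  interpret K: group "G\<lparr>carrier := H\<rparr>" using H by (rule subgroup_imp_group)
  have "subgroup N (G\<lparr>carrier := H\<rparr>)"
    using normal_inD(1-3)[OF N] by (simp add: subgroup_incl)
  then show "N \<lhd> G\<lparr>carrier := H\<rparr>"
    using normal_inD(7)[OF N] H by (auto simp: K.normal_inv_iff)
qed

text \<open>A surjection of \<open>H\<close> onto some group with kernel \<open>N\<close>. Congruences modulo \<open>N\<close> become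
  equations in \<open>Q\<close>, where ordinary commutator calculus applies.\<close>

definition quotient_map :: "'a set \<Rightarrow> 'a set \<Rightarrow> 'q monoid \<Rightarrow> ('a \<Rightarrow> 'q) \<Rightarrow> bool" where
  "quotient_map N H Q q \<longleftrightarrow>
     group Q \<and> subgroup H G \<and> q \<in> hom (G\<lparr>carrier := H\<rparr>) Q \<and>
     q ` H = carrier Q \<and> (\<forall>x\<in>H. q x = \<one>\<^bsub>Q\<^esub> \<longleftrightarrow> x \<in> N)"

lemma quotient_map_exists:
  assumes N: "normal_in N H"
  obtains Q :: "'a set monoid" and q where "quotient_map N H Q q" "order Q * card N = card H"
proof -
  note H = normal_inD(2)[OF N]
  let ?H = "G\<lparr>carrier := H\<rparr>" and ?Q = "G\<lparr>carrier := H\<rparr> Mod N" and ?q = "\<lambda>x. N #> x"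
  interpret n: normal N ?H using normal_in_iff_normal[OF H N] .
  have "(\<lambda>a. N #>\<^bsub>?H\<^esub> a) \<in> hom ?H ?Q" by (rule n.r_coset_hom_Mod)
  then have "?q \<in> hom ?H ?Q" by simp
  moreover have "?q x = \<one>\<^bsub>?Q\<^esub> \<longleftrightarrow> x \<in> N" if "x \<in> H" for x
    using that coset_join1[of N x] coset_join2[of x N] normal_inD(1)[OF N]
      subgroup.subset[OF normal_inD(1)[OF N]] subgroup.mem_carrier[OF H] by auto
  ultimately have "quotient_map N H ?Q ?q"
    using n.factorgroup_is_group H by (auto simp: quotient_map_def FactGroup_def RCOSETS_def)
  moreover have "order ?Q * card N = card H"
    using n.lagrange[OF n.subgroup_axioms] by (simp add: order_def FactGroup_def)
  ultimately show thesis by (rule that)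
qed

lemma quotient_mapD:
  assumes "quotient_map N H Q q"
  shows "group Q" "x \<in> H \<Longrightarrow> q x \<in> carrier Q"
    "x \<in> H \<Longrightarrow> y \<in> H \<Longrightarrow> q (x \<otimes> y) = q x \<otimes>\<^bsub>Q\<^esub> q y"
    "x \<in> H \<Longrightarrow> q (inv x) = inv\<^bsub>Q\<^esub> q x"
    "x \<in> H \<Longrightarrow> q (x [^] (n::nat)) = q x [^]\<^bsub>Q\<^esub> n"
    "x \<in> H \<Longrightarrow> y \<in> H \<Longrightarrow> q (comm x y) = group.comm Q (q x) (q y)"
    "x \<in> H \<Longrightarrow> q x = \<one>\<^bsub>Q\<^esub> \<longleftrightarrow> x \<in> N"
    "x \<in> H \<Longrightarrow> y \<in> H \<Longrightarrow> q x = q y \<longleftrightarrow> inv y \<otimes> x \<in> N"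
proof -
  let ?H = "G\<lparr>carrier := H\<rparr>"
  show Q: "group Q" and 6: "\<And>x. x \<in> H \<Longrightarrow> q x = \<one>\<^bsub>Q\<^esub> \<longleftrightarrow> x \<in> N"
    using assms by (auto simp: quotient_map_def)
  have H: "subgroup H G" and hom: "q \<in> hom ?H Q" using assms by (auto simp: quotient_map_def)
  interpret Q: group Q by fact
  interpret K: group ?H using H by (rule subgroup_imp_group)
  interpret q: group_hom ?H Q q by unfold_locales (rule hom)
  have inv_eq: "inv\<^bsub>?H\<^esub> x = inv x" if "x \<in> H" for x using that H m_inv_consistent by simp
  show 1: "q x \<in> carrier Q" if "x \<in> H" for x using q.hom_closed that by simp
  show 2: "q (x \<otimes> y) = q x \<otimes>\<^bsub>Q\<^esub> q y" if "x \<in> H" "y \<in> H" for x y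
    using q.hom_mult[of x y] that by simp
  show 3: "q (inv x) = inv\<^bsub>Q\<^esub> q x" if "x \<in> H" for x
    using q.hom_inv[of x] that inv_eq by simp
  show "q (x [^] (n::nat)) = q x [^]\<^bsub>Q\<^esub> n" if "x \<in> H" for x n
    using q.hom_nat_pow[of x n] that by (simp add: nat_pow_def)
  have ih: "inv x \<in> H" if "x \<in> H" for x using that H by (simp add: subgroup.m_inv_closed)
  have mh: "x \<otimes> y \<in> H" if "x \<in> H" "y \<in> H" for x y using that H by (simp add: subgroup.m_closed)
  show "q (comm x y) = group.comm Q (q x) (q y)" if "x \<in> H" "y \<in> H" for x y
    using that ih mh by (simp add: comm_def Q.comm_def 2 3)
  show "q x = q y \<longleftrightarrow> inv y \<otimes> x \<in> N" if "x \<in> H" "y \<in> H" for x y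
  proof -
    have "inv y \<otimes> x \<in> N \<longleftrightarrow> inv\<^bsub>Q\<^esub> q y \<otimes>\<^bsub>Q\<^esub> q x = \<one>\<^bsub>Q\<^esub>"
      using that 6[of "inv y \<otimes> x"] by (simp add: 2 3 ih mh)
    also have "\<dots> \<longleftrightarrow> q x = q y" using that 1
      by (metis Q.inv_closed Q.inv_equality Q.inv_inv Q.l_inv)
    finally show ?thesis by simp
  qed
qed

text \<open>Modulo \<open>N\<close> the elements that commute with \<open>v\<close> form a subgroup, so it is enough to look at
  generators.\<close>

lemma comm_generate_left:
  assumes N: "normal_in N H" and A: "A \<subseteq> H" and v: "v \<in> H"
    and comm: "\<And>a. a \<in> A \<Longrightarrow> comm a v \<in> N" and u: "u \<in> generate G A"
  shows "comm u v \<in> N"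
proof -
  obtain Q :: "'a set monoid" and q where Q: "quotient_map N H Q q"
    using quotient_map_exists[OF N] by blast
  note q = quotient_mapD[OF Q]
  interpret Q: group Q by (rule q(1))
  note H = normal_inD(2)[OF N]
  have iff: "comm u v \<in> N \<longleftrightarrow> q u \<otimes>\<^bsub>Q\<^esub> q v = q v \<otimes>\<^bsub>Q\<^esub> q u" if "u \<in> H" for u
    using q(6)[OF that v] q(7)[OF comm_in_subgroup[OF H that v]]
      Q.comm_eq_one_iff[OF q(2)[OF that] q(2)[OF v]] by simp
  have "u \<in> H \<and> comm u v \<in> N" using u
  proof (induction rule: generate.induct)
    case one
    then show ?case using H normal_inD(1)[OF N] v subgroup.mem_carrier[OF H v]
      by (simp add: subgroup.one_closed comm_def)
  next
    case (incl h)
    then show ?case using A comm by auto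
  next
    case (inv h)
    then have h: "h \<in> H" "inv h \<in> H" using A H by (auto intro: subgroup.m_inv_closed)
    have "q h \<otimes>\<^bsub>Q\<^esub> q v = q v \<otimes>\<^bsub>Q\<^esub> q h" using iff comm h inv by blast
    then have "inv\<^bsub>Q\<^esub> q h \<otimes>\<^bsub>Q\<^esub> q v = q v \<otimes>\<^bsub>Q\<^esub> inv\<^bsub>Q\<^esub> q h"
      using q(2) h v by (metis Q.inv_closed Q.inv_solve_left' Q.inv_solve_right Q.m_assoc Q.m_closed)
    then show ?case using iff h q(4) by simp
  next
    case (eng h k)
    then have hk: "h \<in> H" "k \<in> H" "h \<otimes> k \<in> H" using H by (auto intro: subgroup.m_closed)
    have "q h \<otimes>\<^bsub>Q\<^esub> q v = q v \<otimes>\<^bsub>Q\<^esub> q h" "q k \<otimes>\<^bsub>Q\<^esub> q v = q v \<otimes>\<^bsub>Q\<^esub> q k"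
      using iff eng hk by blast+
    then have "q (h \<otimes> k) \<otimes>\<^bsub>Q\<^esub> q v = q v \<otimes>\<^bsub>Q\<^esub> q (h \<otimes> k)"
      using q(2,3) hk v by (metis Q.m_assoc)
    then show ?case using iff hk by blast
  qed
  then show ?thesis by simp
qed

lemma comm_generate:
  assumes N: "normal_in N H" and AB: "A \<subseteq> H" "B \<subseteq> H"
    and comm: "\<And>a b. a \<in> A \<Longrightarrow> b \<in> B \<Longrightarrow> comm a b \<in> N"
    and uv: "u \<in> generate G A" "v \<in> generate G B"
  shows "comm u v \<in> N"
proof -
  note H = normal_inD(2)[OF N]
  have car: "x \<in> carrier G" if "x \<in> H" for x using that subgroup.mem_carrier[OF H] by blast
  have gH: "generate G A \<subseteq> H" "generate G B \<subseteq> H" using AB H generate_subgroup_incl by blast+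
  have inN: "comm y x \<in> N" if "comm x y \<in> N" "x \<in> H" "y \<in> H" for x y
    using that inv_commutator[OF car car] subgroup.m_inv_closed[OF normal_inD(1)[OF N]] by metis
  have "comm b u \<in> N" if "b \<in> B" for b
    using comm_generate_left[OF N AB(1) _ _ uv(1)] comm that AB uv gH inN by (meson subsetD)
  then have "comm v u \<in> N"
    using comm_generate_left[OF N AB(2) _ _ uv(2)] gH uv by (meson subsetD)
  then show ?thesis using inN gH uv by (meson subsetD)
qed

text \<open>An element that is central modulo a normal subgroup enlarges it to a normal subgroup. This
  is how maximality of a normal subgroup with some property is contradicted later on.\<close>

lemma normal_in_generate_insert:
  assumes N: "normal_in N H" and c: "c \<in> H" and comm: "\<And>h. h \<in> H \<Longrightarrow> comm c h \<in> N"
  shows "normal_in (generate G (insert c N)) H"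
proof -
  note H = normal_inD(2)[OF N]
  let ?K = "generate G (insert c N)"
  have sub: "insert c N \<subseteq> H" using c normal_inD(3)[OF N] by auto
  have car: "H \<subseteq> carrier G" using H by (rule subgroup.subset)
  have K: "subgroup ?K G" using sub car by (intro generate_is_subgroup) auto
  have "comm k h \<in> N" if "k \<in> ?K" "h \<in> H" for k h
    using comm_generate_left[OF N sub that(2) _ that(1)] comm normal_inD(4)[OF N] that by auto
  moreover have "N \<subseteq> ?K" by (auto intro: generate.incl)
  ultimately show ?thesis
    unfolding normal_in_def using K H generate_subgroup_incl[OF sub H] by blast
qed

lemma normal_in_subset:
  "normal_in N H \<Longrightarrow> subgroup K G \<Longrightarrow> N \<subseteq> K \<Longrightarrow> K \<subseteq> H \<Longrightarrow> normal_in N K"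
  by (auto simp: normal_in_def)

lemma normal_in_self: "subgroup H G \<Longrightarrow> normal_in H H"
  by (auto simp: normal_in_def comm_in_subgroup)

lemma normal_in_one: "subgroup H G \<Longrightarrow> normal_in {\<one>} H"
  by (auto simp: normal_in_def comm_def subgroup.one_closed triv_subgroup dest: subgroup.mem_carrier)

end

context group
begin

lemma commuting_powers:
  assumes "a \<otimes> b = b \<otimes> a" "a \<in> carrier G" "b \<in> carrier G"
  shows "a [^] (i::nat) \<otimes> b [^] (j::nat) = b [^] j \<otimes> a [^] i"
  using assms by (metis group_commutes_pow nat_pow_closed)

section \<open>Collecting powers of products\<close>

text \<open>Hall's collection formula for two elements whose commutators of weight three are central:
  moving all \<open>x\<close> to the left past the \<open>y\<close> creates commutators, which are counted by binomial
  coefficients. Odd primes divide \<open>n choose 2\<close> for \<open>n = p\<close>, and primes above three also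
  divide \<open>n choose 3\<close>; the failure of the latter for \<open>p = 3\<close> is the source of the
  exceptional group.\<close>

lemma power_of_product_class_3:
  fixes x y :: 'a and n :: nat
  defines "c \<equiv> comm y x"
  defines "e \<equiv> comm c x" and "f \<equiv> comm c y"
  assumes x [simp]: "x \<in> carrier G" and y [simp]: "y \<in> carrier G"
    and ex: "e \<otimes> x = x \<otimes> e" and ey: "e \<otimes> y = y \<otimes> e"
    and fx: "f \<otimes> x = x \<otimes> f" and fy: "f \<otimes> y = y \<otimes> f"
  shows "(x \<otimes> y) [^] n = x [^] n \<otimes> y [^] n \<otimes> c [^] (n choose 2) \<otimes> e [^] (n choose 3)
           \<otimes> f [^] ((n choose 2) + 2 * (n choose 3))"
proof -
  have car [simp]: "c \<in> carrier G" "e \<in> carrier G" "f \<in> carrier G" by (simp_all add: c_def e_def f_def)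
  have zc: "z \<otimes> c = c \<otimes> z" if "z \<in> carrier G" "z \<otimes> x = x \<otimes> z" "z \<otimes> y = y \<otimes> z" for z
  proof -
    have "c \<in> generate G {x, y}"
      unfolding c_def by (intro comm_in_subgroup generate_is_subgroup) (auto intro: generate.incl)
    moreover have "comm a z \<in> {\<one>}" if "a \<in> {x, y}" for a
      using that \<open>z \<otimes> x = x \<otimes> z\<close> \<open>z \<otimes> y = y \<otimes> z\<close> \<open>z \<in> carrier G\<close> by (auto simp: comm_eq_one_iff)
    ultimately have "comm c z \<in> {\<one>}"
      using comm_generate_left[OF normal_in_one[OF subgroup_self], of "{x, y}" z] that by auto
    then show ?thesis using that by (simp add: comm_eq_one_iff)
  qed
  have ec: "e \<otimes> c = c \<otimes> e" and fc: "f \<otimes> c = c \<otimes> f" using zc ex ey fx fy by auto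
  have fe: "f \<otimes> e = e \<otimes> f"
  proof -
    have "e \<in> generate G {x, y}"
      unfolding e_def c_def by (intro comm_in_subgroup generate_is_subgroup) (auto intro: generate.incl)
    moreover have "comm a f \<in> {\<one>}" if "a \<in> {x, y}" for a
      using that fx fy by (auto simp: comm_eq_one_iff)
    ultimately have "comm e f \<in> {\<one>}"
      using comm_generate_left[OF normal_in_one[OF subgroup_self], of "{x, y}" f] by auto
    then show ?thesis by (simp add: comm_eq_one_iff)
  qed
  have lc: "u \<otimes> (v \<otimes> w) = v \<otimes> (u \<otimes> w)"
    if "u \<otimes> v = v \<otimes> u" "u \<in> carrier G" "v \<in> carrier G" "w \<in> carrier G" for u v w
    using that by (metis m_assoc)
  have P: "e [^] i \<otimes> x = x \<otimes> e [^] i" "e [^] i \<otimes> y = y \<otimes> e [^] i" "e [^] i \<otimes> c [^] j = c [^] j \<otimes> e [^] i"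
      "f [^] i \<otimes> x = x \<otimes> f [^] i" "f [^] i \<otimes> y = y \<otimes> f [^] i" "f [^] i \<otimes> c [^] j = c [^] j \<otimes> f [^] i"
      "f [^] i \<otimes> e [^] j = e [^] j \<otimes> f [^] i" "e [^] i \<otimes> c = c \<otimes> e [^] i" "f [^] i \<otimes> c = c \<otimes> f [^] i" for i j :: nat
    by (simp_all only: group_commutes_pow[OF ex] group_commutes_pow[OF ey] group_commutes_pow[OF fx]
        group_commutes_pow[OF fy] group_commutes_pow[OF ec] group_commutes_pow[OF fc]
        commuting_powers[OF ec] commuting_powers[OF fc] commuting_powers[OF fe] \<open>x \<in> carrier G\<close> \<open>y \<in> carrier G\<close>
        \<open>c \<in> carrier G\<close> \<open>e \<in> carrier G\<close> \<open>f \<in> carrier G\<close>)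
  note L = P(1)[THEN lc] P(2)[THEN lc] P(3)[THEN lc] P(4)[THEN lc] P(5)[THEN lc] P(6)[THEN lc]
    P(7)[THEN lc] P(8)[THEN lc] P(9)[THEN lc]
  have M: "u [^] (i::nat) \<otimes> (u [^] (j::nat) \<otimes> w) = u [^] (i + j) \<otimes> w"
    if "u \<in> carrier G" "w \<in> carrier G" for u w i j
    using that by (simp add: nat_pow_mult flip: m_assoc)
  have M1: "u [^] (i::nat) \<otimes> (u \<otimes> w) = u [^] Suc i \<otimes> w" if "u \<in> carrier G" "w \<in> carrier G" for u w i
    using that by (simp add: m_assoc)
  have cx: "c \<otimes> x = x \<otimes> c \<otimes> e" "c \<otimes> y = y \<otimes> c \<otimes> f" "y \<otimes> x = x \<otimes> y \<otimes> c"
    using mult_comm_swap[of c x] mult_comm_swap[of c y] mult_comm_swap[of y x]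
    by (auto simp: e_def f_def c_def)
  have ckx: "c [^] k \<otimes> x = x \<otimes> (c [^] k \<otimes> e [^] k)" for k :: nat
  proof (induction k)
    case (Suc k)
    have "c [^] Suc k \<otimes> x = c [^] k \<otimes> x \<otimes> c \<otimes> e" using cx by (simp add: m_assoc)
    also have "\<dots> = x \<otimes> (c [^] Suc k \<otimes> e [^] Suc k)"
      unfolding Suc by (simp add: m_assoc L)
    finally show ?case .
  qed simp
  have cky: "c [^] k \<otimes> y = y \<otimes> (c [^] k \<otimes> f [^] k)" for k :: nat
  proof (induction k)
    case (Suc k)
    have "c [^] Suc k \<otimes> y = c [^] k \<otimes> y \<otimes> c \<otimes> f" using cx by (simp add: m_assoc)
    also have "\<dots> = y \<otimes> (c [^] Suc k \<otimes> f [^] Suc k)"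
      unfolding Suc by (simp add: m_assoc L)
    finally show ?case .
  qed simp
  have ynx: "y [^] n \<otimes> x = x \<otimes> (y [^] n \<otimes> (c [^] n \<otimes> f [^] (n choose 2)))" for n :: nat
  proof (induction n)
    case (Suc n)
    have "y [^] Suc n \<otimes> x = y [^] n \<otimes> x \<otimes> (y \<otimes> c)" using cx by (simp add: m_assoc)
    also have "\<dots> = x \<otimes> y [^] n \<otimes> (c [^] n \<otimes> y) \<otimes> f [^] (n choose 2) \<otimes> c"
      unfolding Suc by (simp add: m_assoc P L)
    also have "\<dots> = x \<otimes> (y [^] Suc n \<otimes> (c [^] Suc n \<otimes> f [^] (n + (n choose 2))))"
      unfolding cky by (simp add: m_assoc P L del: nat_pow_Suc, simp add: M M1 nat_pow_mult algebra_simps del: nat_pow_Suc)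
    finally show ?case by (simp add: numeral_2_eq_2)
  qed (simp add: numeral_2_eq_2)
  show ?thesis
  proof (induction n)
    case (Suc n)
    let ?k = "n choose 2" let ?l = "n choose 3"
    have "(x \<otimes> y) [^] Suc n =
        x [^] n \<otimes> (y [^] n \<otimes> (c [^] ?k \<otimes> x)) \<otimes> y \<otimes> e [^] ?l \<otimes> f [^] (?k + 2 * ?l)"
      by (simp add: Suc) (simp add: m_assoc P L)
    also have "\<dots> = x [^] n \<otimes> (y [^] n \<otimes> x) \<otimes> c [^] ?k \<otimes> y \<otimes> e [^] (?k + ?l) \<otimes> f [^] (?k + 2 * ?l)"
      unfolding ckx by (simp add: m_assoc P L M)
    also have "\<dots> = x [^] Suc n \<otimes> y [^] n \<otimes> (c [^] (n + ?k) \<otimes> y) \<otimes> e [^] (?k + ?l) \<otimes> f [^] (2 * ?k + 2 * ?l)"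
      unfolding ynx by (simp add: m_assoc P L del: nat_pow_Suc, simp add: M M1 nat_pow_mult algebra_simps del: nat_pow_Suc)
    also have "\<dots> = x [^] Suc n \<otimes> y [^] Suc n \<otimes> c [^] (n + ?k) \<otimes> e [^] (?k + ?l) \<otimes> f [^] (n + ?k + 2 * ?k + 2 * ?l)"
      unfolding cky by (simp add: m_assoc P L del: nat_pow_Suc, simp add: M M1 nat_pow_mult algebra_simps del: nat_pow_Suc)
    moreover have "Suc n choose 2 = n + ?k" "Suc n choose 3 = ?k + ?l"
      by (simp_all add: numeral_2_eq_2 numeral_3_eq_3)
    ultimately show ?case by (simp add: algebra_simps)
  qed (simp add: numeral_2_eq_2 numeral_3_eq_3)
qed


text \<open>Equality of the left cosets \<open>x N\<close> and \<open>y N\<close>.\<close>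

definition cgr :: "'a set \<Rightarrow> 'a \<Rightarrow> 'a \<Rightarrow> bool" where
  "cgr N x y \<longleftrightarrow> inv y \<otimes> x \<in> N"

lemma cgr_quotient_map:
  "quotient_map N H Q q \<Longrightarrow> x \<in> H \<Longrightarrow> y \<in> H \<Longrightarrow> cgr N x y \<longleftrightarrow> q x = q y"
  by (simp add: cgr_def quotient_mapD)

lemma cgr_refl: "subgroup N G \<Longrightarrow> x \<in> carrier G \<Longrightarrow> cgr N x x"
  by (simp add: cgr_def subgroup.one_closed)

lemma cgr_sym:
  assumes "subgroup N G" "x \<in> carrier G" "y \<in> carrier G" "cgr N x y"
  shows "cgr N y x"
proof -
  have "inv (inv y \<otimes> x) \<in> N" using assms by (simp add: cgr_def subgroup.m_inv_closed)
  then show ?thesis using assms by (simp add: cgr_def inv_mult_group)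
qed

lemma cgr_trans:
  assumes "subgroup N G" "x \<in> carrier G" "y \<in> carrier G" "z \<in> carrier G" "cgr N x y" "cgr N y z"
  shows "cgr N x z"
proof -
  have "(inv z \<otimes> y) \<otimes> (inv y \<otimes> x) \<in> N" using assms by (simp add: cgr_def subgroup.m_closed)
  then show ?thesis using assms by (simp add: cgr_def m_assoc)
qed

lemma cgr_mono: "N \<subseteq> M \<Longrightarrow> cgr N x y \<Longrightarrow> cgr M x y"
  by (auto simp: cgr_def)

lemma cgr_iff_mult:
  assumes "x \<in> carrier G" "y \<in> carrier G" "subgroup N G"
  shows "cgr N x y \<longleftrightarrow> (\<exists>n\<in>N. x = y \<otimes> n)"
proof
  assume "cgr N x y"
  then have "inv y \<otimes> x \<in> N" "x = y \<otimes> (inv y \<otimes> x)" using assms by (simp_all add: cgr_def)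
  then show "\<exists>n\<in>N. x = y \<otimes> n" by blast
next
  assume "\<exists>n\<in>N. x = y \<otimes> n"
  then show "cgr N x y" using assms by (auto simp: cgr_def dest: subgroup.mem_carrier)
qed

lemma cgr_member:
  assumes "subgroup K G" "N \<subseteq> K" "x \<in> carrier G" "y \<in> carrier G" "cgr N x y" "y \<in> K"
  shows "x \<in> K"
proof -
  have "inv y \<otimes> x \<in> K" using assms by (auto simp: cgr_def)
  then have "y \<otimes> (inv y \<otimes> x) \<in> K" using assms subgroup.m_closed by metis
  then show ?thesis using assms by simp
qed

lemma cgr_mult:
  assumes N: "normal_in N H" and "x \<in> H" "x' \<in> H" "y \<in> H" "y' \<in> H" "cgr N x x'" "cgr N y y'"
  shows "cgr N (x \<otimes> y) (x' \<otimes> y')"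
proof -
  obtain Q :: "'a set monoid" and q where Q: "quotient_map N H Q q"
    using quotient_map_exists[OF N] by blast
  have "x \<otimes> y \<in> H" "x' \<otimes> y' \<in> H" using assms normal_inD(2)[OF N] by (auto intro: subgroup.m_closed)
  then show ?thesis using assms by (simp add: cgr_quotient_map[OF Q] quotient_mapD(3)[OF Q])
qed

lemma power_of_product_mod:
  fixes n :: nat
  assumes N: "normal_in N H" and x: "x \<in> H" and y: "y \<in> H"
    and e: "comm (comm (comm y x) x) x \<in> N" "comm (comm (comm y x) x) y \<in> N"
    and f: "comm (comm (comm y x) y) x \<in> N" "comm (comm (comm y x) y) y \<in> N"
  shows "cgr N ((x \<otimes> y) [^] n) (x [^] n \<otimes> y [^] n \<otimes> comm y x [^] (n choose 2)
    \<otimes> comm (comm y x) x [^] (n choose 3) \<otimes> comm (comm y x) y [^] ((n choose 2) + 2 * (n choose 3)))"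
proof -
  obtain Q :: "'a set monoid" and q where Q: "quotient_map N H Q q"
    using quotient_map_exists[OF N] by blast
  note q = quotient_mapD[OF Q] and H = normal_inD(2)[OF N]
  interpret Q: group Q by (rule q(1))
  have H': "\<And>u v. u \<in> H \<Longrightarrow> v \<in> H \<Longrightarrow> u \<otimes> v \<in> H" "\<And>u (k::nat). u \<in> H \<Longrightarrow> u [^] k \<in> H"
    "\<And>u v. u \<in> H \<Longrightarrow> v \<in> H \<Longrightarrow> comm u v \<in> H"
    using H by (auto intro: subgroup.m_closed subgroup_pow_closed is_group comm_in_subgroup)
  have commute: "q u \<otimes>\<^bsub>Q\<^esub> q v = q v \<otimes>\<^bsub>Q\<^esub> q u" if "comm u v \<in> N" "u \<in> H" "v \<in> H" for u v
    using that q(6)[of u v] q(7)[of "comm u v"] H' Q.comm_eq_one_iff[of "q u" "q v"] q(2) by auto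
  have "(q x \<otimes>\<^bsub>Q\<^esub> q y) [^]\<^bsub>Q\<^esub> n = q x [^]\<^bsub>Q\<^esub> n \<otimes>\<^bsub>Q\<^esub> q y [^]\<^bsub>Q\<^esub> n \<otimes>\<^bsub>Q\<^esub> Q.comm (q y) (q x) [^]\<^bsub>Q\<^esub> (n choose 2)
    \<otimes>\<^bsub>Q\<^esub> Q.comm (Q.comm (q y) (q x)) (q x) [^]\<^bsub>Q\<^esub> (n choose 3)
    \<otimes>\<^bsub>Q\<^esub> Q.comm (Q.comm (q y) (q x)) (q y) [^]\<^bsub>Q\<^esub> ((n choose 2) + 2 * (n choose 3))"
    using commute[OF e(1)] commute[OF e(2)] commute[OF f(1)] commute[OF f(2)] x y
    by (intro Q.power_of_product_class_3) (simp_all add: q(2,6) H')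
  then show ?thesis
    by (simp add: cgr_quotient_map[OF Q] x y H' q(3,5,6))
qed

end

section \<open>Maximal subgroups and powers in finite p-groups\<close>

locale p_group = group G for G (structure) +
  fixes p :: nat
  assumes prime_p: "Factorial_Ring.prime p" and order_p_power: "\<exists>n. order G = p ^ n"
begin

lemma finite_carrier [simp]: "finite (carrier G)"
  using order_p_power prime_p order_gt_0_iff_finite by (metis prime_gt_0_nat zero_less_power)

lemma finite_subgroup: "subgroup H G \<Longrightarrow> finite H"
  by (meson finite_carrier finite_subset subgroup.subset)

lemma card_subgroup:
  assumes "subgroup H G"
  obtains k where "card H = p ^ k"
proof -
  obtain n where n: "order G = p ^ n" using order_p_power by blast
  have "card H dvd p ^ n" using lagrange[OF assms] n by (metis dvd_triv_right)
  then show thesis using that prime_p divides_primepow_nat by blast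
qed

text \<open>The group acts on \<open>D\<close> by conjugation. If only the identity were fixed, all other orbits
  would have a length divisible by \<open>p\<close>, and so \<open>card D\<close> would be congruent to one modulo
  \<open>p\<close>.\<close>

lemma normal_meets_center:
  assumes D: "D \<lhd> G" "D \<noteq> {\<one>}"
  obtains z where "z \<in> D" "z \<noteq> \<one>" "\<And>g. g \<in> carrier G \<Longrightarrow> z \<otimes> g = g \<otimes> z"
proof (rule ccontr)
  note out = that
  assume "\<not> thesis"
  then have nc: "\<exists>g\<in>carrier G. z \<otimes> g \<noteq> g \<otimes> z" if "z \<in> D" "z \<noteq> \<one>" for z using that out by blast
  interpret D: normal D G by fact
  define \<phi> where "\<phi> = (\<lambda>g. \<lambda>h\<in>carrier G. g \<otimes> h \<otimes> inv g)"
  interpret A: group_action G "carrier G" \<phi> unfolding \<phi>_def by (rule action_by_conjugation)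
  let ?O = "\<lambda>x. orbit G \<phi> x"
  have conj: "?O x = {g \<otimes> x \<otimes> inv g | g. g \<in> carrier G}" if "x \<in> D" for x
    using that D.mem_carrier by (auto simp: orbit_def \<phi>_def)
  have OD: "?O x \<subseteq> D" if "x \<in> D" for x
    using that D.inv_op_closed2 conj by auto
  have dvd: "p dvd card (?O x)" if "x \<in> D" "x \<noteq> \<one>" for x
  proof -
    obtain n where n: "order G = p ^ n" using order_p_power by blast
    have "card (?O x) dvd p ^ n"
      using A.orbit_stabilizer_theorem[of x] that D.mem_carrier n by (metis dvd_triv_left)
    then obtain k where k: "card (?O x) = p ^ k" using prime_p divides_primepow_nat by blast
    have "k \<noteq> 0"
    proof
      assume "k = 0"
      then have "card (?O x) = 1" using k by simp
      then obtain w where "?O x = {w}" by (rule card_1_singletonE)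
      moreover have "x \<in> ?O x" using A.orbit_refl that D.mem_carrier by blast
      ultimately have 1: "?O x = {x}" by (metis singletonD)
      have "x \<otimes> g = g \<otimes> x" if g: "g \<in> carrier G" for g
      proof -
        have "g \<otimes> x \<otimes> inv g \<in> ?O x" using conj[OF \<open>x \<in> D\<close>] g by blast
        then have "g \<otimes> x \<otimes> inv g = x" using 1 by blast
        then show ?thesis using g D.mem_carrier[OF \<open>x \<in> D\<close>] by (metis inv_solve_right' m_closed)
      qed
      then show False using nc that by blast
    qed
    then show ?thesis using k by (metis dvd_power gr0I)
  qed
  let ?C = "?O ` (D - {\<one>})"
  have one: "\<one> \<notin> ?O x" if "x \<in> D" "x \<noteq> \<one>" for x
  proof
    assume "\<one> \<in> ?O x"
    then have "x \<in> ?O \<one>" using A.orbit_sym that D.mem_carrier by blast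
    then show False using that conj[OF D.one_closed] by auto
  qed
  have "D - {\<one>} = \<Union> ?C"
  proof (intro equalityI subsetI)
    fix x assume "x \<in> D - {\<one>}"
    moreover from this have "x \<in> ?O x" using A.orbit_refl D.mem_carrier by blast
    ultimately show "x \<in> \<Union> ?C" by blast
  next
    fix x assume "x \<in> \<Union> ?C"
    then obtain y where "y \<in> D" "y \<noteq> \<one>" "x \<in> ?O y" by blast
    then show "x \<in> D - {\<one>}" using OD one by blast
  qed
  moreover have "card (\<Union> ?C) = sum card ?C"
  proof (rule card_Union_disjoint)
    show "pairwise disjnt ?C"
    proof (rule pairwiseI)
      fix U V assume UV: "U \<in> ?C" "V \<in> ?C" "U \<noteq> V"
      have "U \<in> orbits G (carrier G) \<phi>" "V \<in> orbits G (carrier G) \<phi>"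
        using UV D.mem_carrier by (auto simp: orbits_def)
      moreover have part: "partition (carrier G) (orbits G (carrier G) \<phi>)" by (rule A.orbit_partition)
      ultimately show "disjnt U V"
        using UV(3) partition.disjoint_union[OF part] by (metis disjnt_def)
    qed
    show "finite U" if "U \<in> ?C" for U
      using that OD finite_subset[OF _ finite_subgroup[OF D.subgroup_axioms]] by blast
  qed
  moreover have "p dvd sum card ?C" using dvd by (intro dvd_sum) auto
  ultimately have "p dvd card (D - {\<one>})" by simp
  moreover have "card (D - {\<one>}) = card D - 1" using D.one_closed finite_subgroup[OF D.subgroup_axioms] by simp
  moreover obtain k where k: "card D = p ^ k" using card_subgroup[OF D.subgroup_axioms] .
  moreover have "k \<noteq> 0"
    using D(2) D.one_closed k by (metis card_1_singletonE power_0 singletonD)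
  then have "p dvd card D" using k by (metis dvd_power gr0I)
  moreover have "card D \<ge> 1" using k prime_p prime_gt_0_nat by (simp add: Suc_leI)
  ultimately have "p dvd 1" by (metis dvd_diff_nat diff_diff_cancel)
  then show False using prime_p not_prime_unit by blast
qed

text \<open>Relative form of the previous lemma, applied to the image of \<open>D\<close> in the quotient of \<open>H\<close> by
  \<open>K\<close>.\<close>

lemma normal_in_central_element:
  assumes K: "normal_in K H" and D: "normal_in D H" and KD: "K \<subset> D"
  obtains u where "u \<in> D" "u \<notin> K" "\<And>h. h \<in> H \<Longrightarrow> comm u h \<in> K"
proof -
  obtain Q :: "'a set monoid" and q where Q: "quotient_map K H Q q" and card: "order Q * card K = card H"
    using quotient_map_exists[OF K] by blast
  note q = quotient_mapD[OF Q] and H = normal_inD(2)[OF K] and DH = normal_inD(3)[OF D]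
  interpret Q: group Q by (rule q(1))
  obtain n where "card H = p ^ n" using card_subgroup[OF H] .
  then have "order Q dvd p ^ n" using card by (metis dvd_triv_left)
  then have "\<exists>k. order Q = p ^ k" using prime_p divides_primepow_nat by blast
  then interpret Q: p_group Q p using prime_p by unfold_locales
  have surj: "q ` H = carrier Q" using Q by (simp add: quotient_map_def)
  have "q ` D \<lhd> Q"
  proof (subst Q.normal_inv_iff, intro conjI ballI)
    show "subgroup (q ` D) Q"
    proof (rule Q.subgroupI)
      show "q ` D \<subseteq> carrier Q" using q(2) DH by auto
      show "q ` D \<noteq> {}" using KD by auto
      show "inv\<^bsub>Q\<^esub> a \<in> q ` D" if "a \<in> q ` D" for a
        using that q(4) DH subgroup.m_inv_closed[OF normal_inD(1)[OF D]] by (force simp: subset_iff)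
      show "a \<otimes>\<^bsub>Q\<^esub> b \<in> q ` D" if ab: "a \<in> q ` D" "b \<in> q ` D" for a b
      proof -
        obtain x y where xy: "x \<in> D" "a = q x" "y \<in> D" "b = q y" using ab by blast
        then have "a \<otimes>\<^bsub>Q\<^esub> b = q (x \<otimes> y)" using q(3)[of x y] DH by auto
        then show ?thesis using xy subgroup.m_closed[OF normal_inD(1)[OF D]] by blast
      qed
    qed
    show "x \<otimes>\<^bsub>Q\<^esub> h \<otimes>\<^bsub>Q\<^esub> inv\<^bsub>Q\<^esub> x \<in> q ` D" if xh: "x \<in> carrier Q" "h \<in> q ` D" for x h
    proof -
      obtain a where a: "a \<in> H" "x = q a" using xh(1) unfolding surj[symmetric] by blast
      obtain b where b: "b \<in> D" "h = q b" using xh(2) by blast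
      note ab = a b
      have "q (a \<otimes> b \<otimes> inv a) = x \<otimes>\<^bsub>Q\<^esub> h \<otimes>\<^bsub>Q\<^esub> inv\<^bsub>Q\<^esub> x"
        using ab DH H q(3,4) by (simp add: subgroup.m_closed subgroup.m_inv_closed subsetD)
      then show ?thesis using normal_inD(7)[OF D ab(3) ab(1)] by (metis imageI)
    qed
  qed
  moreover have "q ` D \<noteq> {\<one>\<^bsub>Q\<^esub>}"
  proof -
    obtain d where "d \<in> D" "d \<notin> K" using KD by blast
    then have "q d \<noteq> \<one>\<^bsub>Q\<^esub>" using q(7)[of d] DH by auto
    then show ?thesis using \<open>d \<in> D\<close> by blast
  qed
  ultimately obtain z where z: "z \<in> q ` D" "z \<noteq> \<one>\<^bsub>Q\<^esub>"
    "\<And>g. g \<in> carrier Q \<Longrightarrow> z \<otimes>\<^bsub>Q\<^esub> g = g \<otimes>\<^bsub>Q\<^esub> z"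
    using Q.normal_meets_center by blast
  obtain u where u: "u \<in> D" "z = q u" using z(1) by blast
  have uH: "u \<in> H" using u DH by blast
  show thesis
  proof (rule that)
    show "u \<in> D" "u \<notin> K" using u z(2) q(7)[OF uH] by auto
    show "comm u h \<in> K" if "h \<in> H" for h
      using that uH q(6)[OF uH that] q(7)[OF comm_in_subgroup[OF H uH that]] z(3)[of "q h"] u q(2)
        Q.comm_eq_one_iff[of z "q h"] by simp
  qed
qed

lemma maximal_subgroup_between:
  assumes D: "subgroup D G" and H: "subgroup H G" and DH: "D \<subset> H"
  obtains M where "subgroup M G" "D \<subseteq> M" "M \<subset> H"
    "\<And>L. subgroup L G \<Longrightarrow> M \<subseteq> L \<Longrightarrow> L \<subset> H \<Longrightarrow> L = M"
proof -
  let ?P = "\<lambda>M. subgroup M G \<and> D \<subseteq> M \<and> M \<subset> H"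
  have "\<exists>M. ?P M \<and> (\<forall>L. ?P L \<longrightarrow> card L \<le> card M)"
    using D DH finite_subgroup[OF H] by (intro ex_has_greatest_nat[of _ D _ "Suc (card H)"])
      (auto intro!: card_mono simp: less_Suc_eq_le)
  then obtain M where M: "?P M" "\<And>L. ?P L \<Longrightarrow> card L \<le> card M" by blast
  show thesis
  proof (rule that[of M])
    show "subgroup M G" "D \<subseteq> M" "M \<subset> H" using M by auto
    show "L = M" if "subgroup L G" "M \<subseteq> L" "L \<subset> H" for L
    proof -
      have "card L \<le> card M" using M that by auto
      then show ?thesis using that finite_subgroup card_seteq by metis
    qed
  qed
qed

lemma subgroup_normalizer:
  assumes M: "subgroup M G" and H: "subgroup H G"
  shows "subgroup {g \<in> H. (\<forall>m\<in>M. inv g \<otimes> m \<otimes> g \<in> M) \<and> (\<forall>m\<in>M. g \<otimes> m \<otimes> inv g \<in> M)} G" (is "subgroup ?N G")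
proof (rule subgroupI)
  have car: "x \<in> carrier G" if "x \<in> H \<or> x \<in> M" for x
    using that subgroup.mem_carrier[OF M] subgroup.mem_carrier[OF H] by blast
  show "?N \<subseteq> carrier G" using car by auto
  have "\<one> \<in> ?N" using M H car by (auto simp: subgroup.one_closed)
  then show "?N \<noteq> {}" by blast
  show "inv a \<in> ?N" if "a \<in> ?N" for a using that car H by (auto simp: subgroup.m_inv_closed)
  show "a \<otimes> b \<in> ?N" if "a \<in> ?N" "b \<in> ?N" for a b
  proof -
    have ab: "a \<in> carrier G" "b \<in> carrier G" using that car by auto
    have "inv (a \<otimes> b) \<otimes> m \<otimes> (a \<otimes> b) = inv b \<otimes> (inv a \<otimes> m \<otimes> a) \<otimes> b"
      "a \<otimes> b \<otimes> m \<otimes> inv (a \<otimes> b) = a \<otimes> (b \<otimes> m \<otimes> inv b) \<otimes> inv a" if "m \<in> M" for m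
      using ab car[of m] that by (simp_all add: m_assoc inv_mult_group)
    moreover have "a \<otimes> b \<in> H" using that H by (simp add: subgroup.m_closed)
    ultimately show ?thesis using that by simp
  qed
qed

text \<open>A normal subgroup \<open>K\<close> of \<open>H\<close> inside \<open>M\<close>, chosen as large as possible, is proper, so some
  \<open>u\<close> outside \<open>K\<close> is central modulo \<open>K\<close>. Adding \<open>u\<close> to \<open>K\<close> keeps it normal, so \<open>u\<close> is not in
  \<open>M\<close>; but \<open>u\<close> normalises \<open>M\<close>. Hence the normaliser of \<open>M\<close> exceeds \<open>M\<close> and is all of \<open>H\<close>.
  The quotient is generated by any of its nontrivial elements, which forces it to be abelian
  of exponent \<open>p\<close>.\<close>

lemma maximal_imp_normal:
  assumes M: "subgroup M G" and H: "subgroup H G" and MH: "M \<subset> H"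
    and max: "\<And>L. subgroup L G \<Longrightarrow> M \<subseteq> L \<Longrightarrow> L \<subset> H \<Longrightarrow> L = M"
  shows "normal_in M H" "h \<in> H \<Longrightarrow> h [^] p \<in> M" "h \<in> H \<Longrightarrow> k \<in> H \<Longrightarrow> comm h k \<in> M"
proof -
  have car: "x \<in> carrier G" if "x \<in> H" for x using that subgroup.mem_carrier[OF H] by blast
  let ?P = "\<lambda>K. normal_in K H \<and> K \<subseteq> M"
  have "\<exists>K. ?P K \<and> (\<forall>L. ?P L \<longrightarrow> card L \<le> card K)"
    using normal_in_one[OF H] subgroup.one_closed[OF M] finite_subgroup[OF H]
    by (intro ex_has_greatest_nat[of _ "{\<one>}" _ "Suc (card H)"])
      (auto intro!: card_mono dest: normal_inD(3) simp: less_Suc_eq_le)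
  then obtain K where K: "normal_in K H" "K \<subseteq> M"
    and Kmax: "\<And>L. normal_in L H \<Longrightarrow> L \<subseteq> M \<Longrightarrow> card L \<le> card K" by blast
  obtain u where u: "u \<in> H" "u \<notin> K" "\<And>h. h \<in> H \<Longrightarrow> comm u h \<in> K"
    using normal_in_central_element[OF K(1) normal_in_self[OF H]] K MH by blast
  \<comment> \<open>By the choice of \<open>K\<close>, the larger normal subgroup generated by \<open>u\<close> and \<open>K\<close> cannot lie in
    \<open>M\<close>.\<close>
  have uM: "u \<notin> M"
  proof
    assume "u \<in> M"
    let ?L = "generate G (insert u K)"
    have "normal_in ?L H" using normal_in_generate_insert[OF K(1) u(1) u(3)] .
    moreover have "?L \<subseteq> M" using generate_subgroup_incl[OF _ M] K \<open>u \<in> M\<close> by blast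
    ultimately have "card ?L \<le> card K" by (rule Kmax)
    moreover have "K \<subseteq> ?L" "u \<in> ?L" by (auto intro: generate.incl)
    moreover have "finite ?L"
      using \<open>?L \<subseteq> M\<close> finite_subgroup[OF M] finite_subset by blast
    ultimately have "K = ?L" by (intro card_seteq)
    then show False using u(2) \<open>u \<in> ?L\<close> by simp
  qed
  let ?N = "{g \<in> H. (\<forall>m\<in>M. inv g \<otimes> m \<otimes> g \<in> M) \<and> (\<forall>m\<in>M. g \<otimes> m \<otimes> inv g \<in> M)}"
  have N: "subgroup ?N G" by (rule subgroup_normalizer[OF M H])
  have MN: "M \<subseteq> ?N"
  proof
    fix g assume g: "g \<in> M"
    then have "inv g \<in> M" using M by (rule subgroup.m_inv_closed[rotated])
    then show "g \<in> ?N" using g MH M by (auto intro: subgroup.m_closed)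
  qed
  have gu: "comm v m \<in> K" if "v \<in> generate G {u}" "m \<in> M" for v m
    using comm_generate_left[OF K(1), of "{u}" m v] u that MH by auto
  have "u \<in> ?N"
  proof -
    have "comm m v \<in> M" if "v \<in> generate G {u}" "m \<in> M" "v \<in> H" for v m
      using gu[OF that(1,2)] inv_commutator[of v m] K(2) that MH car subgroup.m_inv_closed[OF M] by (metis psubsetD subsetD)
    then have "inv v \<otimes> m \<otimes> v \<in> M" if "v \<in> generate G {u}" "m \<in> M" "v \<in> H" for v m
      using that conj_eq_mult_comm[of m v] MH car subgroup.m_closed[OF M] by (metis psubsetD)
    from this[of u] this[of "inv u"] u(1) car H show ?thesis
      by (auto intro: generate.incl generate.inv subgroup.m_inv_closed)
  qed
  then have "?N \<noteq> M" using uM by blast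
  then have "\<not> ?N \<subset> H" using max[OF N MN] by blast
  then have NH: "?N = H" by blast
  have n: "comm m h \<in> M" if "m \<in> M" "h \<in> H" for m h
  proof -
    have "inv h \<otimes> m \<otimes> h \<in> M" using that NH by blast
    then have "inv m \<otimes> (inv h \<otimes> m \<otimes> h) \<in> M" using that M by (simp add: subgroup.m_closed subgroup.m_inv_closed)
    then show ?thesis using that MH car by (metis conj_eq_mult_comm inv_cancel(1) comm_closed psubsetD)
  qed
  then show nM: "normal_in M H" using M H MH by (auto simp: normal_in_def)
  have gen: "generate G (insert h M) = H" if "h \<in> H" "h \<notin> M" for h
  proof -
    have s: "insert h M \<subseteq> H" using that MH by auto
    then have "subgroup (generate G (insert h M)) G" using car by (intro generate_is_subgroup) auto
    moreover have "M \<subseteq> generate G (insert h M)" "h \<in> generate G (insert h M)" by (auto intro: generate.incl)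
    ultimately show ?thesis
      using max[of "generate G (insert h M)"] generate_subgroup_incl[OF s H] that by blast
  qed
  show "comm h k \<in> M" if "h \<in> H" "k \<in> H" for h k
  proof (cases "h \<in> M")
    case False
    have "comm a b \<in> M" if "a \<in> insert h M" "b \<in> insert h M" for a b
      using that normal_inD(4,5)[OF nM] \<open>h \<in> H\<close> MH car[OF \<open>h \<in> H\<close>] subgroup.one_closed[OF M]
        comm_eq_one_iff[of h h] by auto
    then show ?thesis
      using comm_generate[OF nM, of "insert h M" "insert h M" h k] gen[OF that(1) False] that MH by auto
  qed (use normal_inD(4)[OF nM] that in blast)
  show "h [^] p \<in> M" if h: "h \<in> H" for h
  proof (rule ccontr)
    assume hp: "h [^] p \<notin> M"
    then have hM: "h \<notin> M" using subgroup_pow_closed[OF is_group M] by blast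
    \<comment> \<open>If \<open>h^p\<close> were outside \<open>M\<close>, it would generate \<open>H\<close> modulo \<open>M\<close>. So \<open>h\<close> would be a power
      of \<open>h^p\<close> modulo \<open>M\<close>, although \<open>h\<close> has order a nontrivial power of \<open>p\<close> there.\<close>
    have hpH: "h [^] p \<in> H" using subgroup_pow_closed[OF is_group H] h by blast
    obtain Q :: "'a set monoid" and q where Q: "quotient_map M H Q q" and card: "order Q * card M = card H"
      using quotient_map_exists[OF nM] by blast
    note q = quotient_mapD[OF Q]
    interpret Q: group Q by (rule q(1))
    obtain n where "card H = p ^ n" using card_subgroup[OF H] .
    then have "order Q dvd p ^ n" using card by (metis dvd_triv_left)
    then obtain k where k: "order Q = p ^ k" using prime_p divides_primepow_nat by blast
    have fin: "finite (carrier Q)" using k prime_p Q.order_gt_0_iff_finite by (metis prime_gt_0_nat zero_less_power)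
    have "x \<in> H \<and> q x \<in> generate Q {q h [^]\<^bsub>Q\<^esub> p}" if "x \<in> generate G (insert (h [^] p) M)" for x
      using that
    proof (induction rule: generate.induct)
      case one
      then show ?case using q(7)[of \<one>] H M by (auto simp: subgroup.one_closed intro: generate.one)
    next
      case (incl x)
      then show ?case
      proof (cases "x \<in> M")
        case True
        then have "x \<in> H" using MH by blast
        then show ?thesis using True q(7)[of x] by (simp add: generate.one)
      next
        case False
        then show ?thesis using incl hpH q(5)[OF h] by (auto intro: generate.incl)
      qed
    next
      case (inv x)
      then have x: "x \<in> H" using hpH MH by auto
      then have "q (inv x) = inv\<^bsub>Q\<^esub> q x" "inv x \<in> H" using q(4) H by (auto intro: subgroup.m_inv_closed)
      moreover have "q x = \<one>\<^bsub>Q\<^esub> \<or> q x = q h [^]\<^bsub>Q\<^esub> p" using inv q(5)[OF h] q(7)[OF x] by auto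
      ultimately show ?case by (auto intro: generate.inv generate.one)
    next
      case (eng x y)
      then show ?case using q(3) H by (auto intro: generate.eng subgroup.m_closed)
    qed
    then have "q h \<in> generate Q {q h [^]\<^bsub>Q\<^esub> p}" using gen[OF hpH hp] h by blast
    then obtain j :: int where j: "q h = (q h [^]\<^bsub>Q\<^esub> p) [^]\<^bsub>Q\<^esub> j"
      using Q.generate_pow[of "q h [^]\<^bsub>Q\<^esub> p"] q(2)[OF h] by auto
    then have "q h [^]\<^bsub>Q\<^esub> (1::int) = q h [^]\<^bsub>Q\<^esub> (int p * j)"
      using q(2)[OF h] by (simp add: Q.int_pow_pow flip: int_pow_int)
    then have "q h [^]\<^bsub>Q\<^esub> (int p * j - 1) = \<one>\<^bsub>Q\<^esub>"
      using q(2)[OF h] by (metis Q.int_pow_diff Q.int_pow_closed Q.r_inv)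
    then have "int (Q.ord (q h)) dvd int p * j - 1"
      using q(2)[OF h] Q.int_pow_eq_id by blast
    moreover have "Q.ord (q h) dvd p ^ k"
      using Q.ord_dvd_group_order[OF q(2)[OF h]] k by simp
    then obtain i where i: "Q.ord (q h) = p ^ i" using prime_p divides_primepow_nat by blast
    moreover have "i \<noteq> 0"
    proof
      assume "i = 0"
      then have "q h = \<one>\<^bsub>Q\<^esub>" using i Q.ord_eq_1 q(2)[OF h] by simp
      then show False using q(7)[OF h] hM by blast
    qed
    then have "int p dvd int (Q.ord (q h))" using i by (simp add: dvd_power)
    ultimately have "int p dvd int p * j - 1" by (meson dvd_trans)
    from dvd_diff[OF dvd_triv_left[of "int p" j] this] have "p = 1" by simp
    then show False using prime_p by simp
  qed
qed


text \<open>The subgroup \<open>mho 1\<close>, for a subset of the ambient group. The later arguments descend along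
  the iterates \<open>(pw ^^ k) H\<close>; that these are the subgroups \<open>mho k\<close> is part of what is to be
  shown.\<close>

definition pw :: "'a set \<Rightarrow> 'a set" where
  "pw H = generate G {h [^] p | h. h \<in> H}"

lemma pw_subset:
  assumes "subgroup H G"
  shows "pw H \<subseteq> H"
  unfolding pw_def using subgroup_pow_closed[OF is_group assms]
  by (intro generate_subgroup_incl[OF _ assms]) auto

lemma pw_subgroup [simp]: "H \<subseteq> carrier G \<Longrightarrow> subgroup (pw H) G"
  unfolding pw_def by (intro generate_is_subgroup) auto

lemma pw_mono: "H \<subseteq> K \<Longrightarrow> pw H \<subseteq> pw K"
  unfolding pw_def by (intro mono_generate) auto

lemma pow_in_pw: "h \<in> H \<Longrightarrow> h [^] p \<in> pw H"
  unfolding pw_def by (auto intro: generate.incl)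

lemma pw_one [simp]: "pw {\<one>} = {\<one>}"
  using pw_subset[OF triv_subgroup] subgroup.one_closed[OF pw_subgroup[of "{\<one>}"]] by auto

lemma proper_subgroup_in_maximal:
  assumes D: "subgroup D G" and H: "subgroup H G" and DH: "D \<subset> H"
  obtains M where "subgroup M G" "D \<subseteq> M" "M \<subset> H"
    "\<And>L. subgroup L G \<Longrightarrow> M \<subseteq> L \<Longrightarrow> L \<subset> H \<Longrightarrow> L = M"
    "normal_in M H" "\<And>h. h \<in> H \<Longrightarrow> h [^] p \<in> M" "\<And>h k. h \<in> H \<Longrightarrow> k \<in> H \<Longrightarrow> comm h k \<in> M"
proof -
  obtain M where M: "subgroup M G" "D \<subseteq> M" "M \<subset> H"
    "\<And>L. subgroup L G \<Longrightarrow> M \<subseteq> L \<Longrightarrow> L \<subset> H \<Longrightarrow> L = M"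
    using maximal_subgroup_between[OF assms] by metis
  show thesis
    using that[OF M] maximal_imp_normal[OF M(1) H M(3,4)] by blast
qed

text \<open>The \<open>p\<close>-th powers lie in every maximal subgroup, that is, in the Frattini subgroup, and so
  are superfluous among generators.\<close>

lemma pw_superfluous:
  assumes H: "subgroup H G" and S: "S \<subseteq> H" and gen: "H \<subseteq> generate G (S \<union> pw H)"
  shows "generate G S = H"
proof (rule ccontr)
  assume ne: "generate G S \<noteq> H"
  have "generate G S \<subseteq> H" using generate_subgroup_incl[OF S H] .
  moreover have "subgroup (generate G S) G"
    using S subgroup.subset[OF H] by (intro generate_is_subgroup) auto
  ultimately obtain M where M: "subgroup M G" "generate G S \<subseteq> M" "M \<subset> H" "\<And>h. h \<in> H \<Longrightarrow> h [^] p \<in> M"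
    using proper_subgroup_in_maximal[OF _ H] ne by (metis psubsetI)
  have "pw H \<subseteq> M" unfolding pw_def using M by (intro generate_subgroup_incl) auto
  moreover have "S \<subseteq> M" using M(2) by (auto intro: generate.incl)
  ultimately have "generate G (S \<union> pw H) \<subseteq> M" by (intro generate_subgroup_incl[OF _ M(1)]) auto
  then show False using gen M(3) by blast
qed

lemma pw_eq_self_imp_trivial:
  assumes H: "subgroup H G" and pw: "H \<subseteq> pw H"
  shows "H = {\<one>}"
proof -
  have "H \<subseteq> generate G ({} \<union> pw H)" using pw by (auto intro: generate.incl)
  then have "generate G {} = H" using pw_superfluous[OF H, of "{}"] by simp
  then show ?thesis by (simp add: generate_empty)
qed

lemma pw_psubset:
  assumes "subgroup H G" "H \<noteq> {\<one>}"
  shows "pw H \<subset> H"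
  using assms pw_subset pw_eq_self_imp_trivial by blast

lemma funpow_pw_subgroup: "subgroup H G \<Longrightarrow> subgroup ((pw ^^ k) H) G"
  by (induction k) (simp_all add: subgroup.subset)

lemma funpow_pw_antimono:
  assumes "subgroup H G" "i \<le> j"
  shows "(pw ^^ j) H \<subseteq> (pw ^^ i) H"
  using assms(2)
proof (induction rule: dec_induct)
  case (step n)
  then show ?case using pw_subset[OF funpow_pw_subgroup[OF assms(1)], of n] by auto
qed simp

lemma funpow_pw_trivial:
  assumes "subgroup H G"
  obtains n where "\<And>k. k \<ge> n \<Longrightarrow> (pw ^^ k) H = {\<one>}"
proof -
  have "(pw ^^ k) H = {\<one>} \<or> card ((pw ^^ k) H) + k \<le> card H" for k
  proof (induction k)
    case (Suc k)
    show ?case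
    proof (cases "(pw ^^ k) H = {\<one>}")
      case False
      then have "card ((pw ^^ Suc k) H) < card ((pw ^^ k) H)"
        using pw_psubset[OF funpow_pw_subgroup[OF assms], of k]
          finite_subgroup[OF funpow_pw_subgroup[OF assms], of k] by (simp add: psubset_card_mono)
      then show ?thesis using Suc False by auto
    qed simp
  qed simp
  from this[of "Suc (card H)"] have "(pw ^^ Suc (card H)) H = {\<one>}" by auto
  then have "(pw ^^ k) H = {\<one>}" if "k \<ge> Suc (card H)" for k
    using funpow_pw_antimono[OF assms that] subgroup.one_closed[OF funpow_pw_subgroup[OF assms], of k]
    by auto
  then show thesis by (rule that)
qed

lemma funpow_pw_subset: "H \<subseteq> carrier G \<Longrightarrow> (pw ^^ k) H \<subseteq> carrier G"
  by (induction k) (simp_all add: subgroup.subset)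

lemma pow_in_funpow_pw:
  assumes "H \<subseteq> carrier G" "h \<in> (pw ^^ j) H"
  shows "h [^] (p ^ k) \<in> (pw ^^ (j + k)) H"
proof (induction k)
  case (Suc k)
  have "h \<in> carrier G" using assms(2) funpow_pw_subset[OF assms(1)] by blast
  then have "h [^] (p ^ Suc k) = (h [^] (p ^ k)) [^] p" by (simp add: nat_pow_pow mult.commute)
  then show ?case using pow_in_pw[OF Suc] by simp
next
  case 0
  have "(pw ^^ j) H \<subseteq> carrier G"
    using funpow_pw_subset[OF assms(1)] .
  then show ?case using assms(2) by auto
qed

lemma normal_in_pw:
  assumes N: "normal_in N H"
  shows "normal_in (pw N) H"
proof -
  note nN = normal_inD[OF N]
  have car: "x \<in> carrier G" if "x \<in> H" for x using that subgroup.mem_carrier[OF nN(2)] by blast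
  have NG: "N \<subseteq> carrier G" using subgroup.subset[OF nN(1)] .
  note S = pw_subgroup[OF NG]
  have conj: "inv h \<otimes> x \<otimes> h \<in> pw N" if h: "h \<in> H" and "x \<in> pw N" for h x
    using that(2) unfolding pw_def
  proof (induction rule: generate.induct)
    case one
    then show ?case using car[OF h] by (simp add: generate.one)
  next
    case (incl x)
    then obtain n where n: "n \<in> N" "x = n [^] p" by blast
    then have "inv h \<otimes> x \<otimes> h = (inv h \<otimes> n \<otimes> h) [^] p" using conj_pow car[OF h] NG by (simp add: subsetD)
    then show ?case using nN(6)[OF n(1) h] by (auto intro: generate.incl)
  next
    case (inv x)
    then obtain n where n: "n \<in> N" "x = n [^] p" by blast
    then have nG: "n \<in> carrier G" using NG by blast
    have "inv h \<otimes> inv x \<otimes> h = inv (inv h \<otimes> x \<otimes> h)"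
      using car[OF h] n nG by (simp add: m_assoc inv_mult_group)
    then have "inv h \<otimes> inv x \<otimes> h = inv ((inv h \<otimes> n \<otimes> h) [^] p)"
      using conj_pow[of n h p] car[OF h] nG n by simp
    then show ?case using nN(6)[OF n(1) h] by (auto intro: generate.inv)
  next
    case (eng x y)
    then have "x \<in> pw N" "y \<in> pw N" by (simp_all add: pw_def)
    then have "x \<in> carrier G" "y \<in> carrier G" using subgroup.mem_carrier[OF S] by blast+
    then have "inv h \<otimes> (x \<otimes> y) \<otimes> h = (inv h \<otimes> x \<otimes> h) \<otimes> (inv h \<otimes> y \<otimes> h)"
      using car[OF h] by (simp add: m_assoc)
    then show ?case using eng by (simp add: generate.eng)
  qed
  have "comm n h \<in> pw N" if "n \<in> pw N" "h \<in> H" for n h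
  proof -
    have "n \<in> carrier G" using that(1) subgroup.mem_carrier[OF S] by blast
    then have "comm n h = inv n \<otimes> (inv h \<otimes> n \<otimes> h)" using car[OF that(2)] by (simp add: comm_def m_assoc)
    then show ?thesis using conj[OF that(2,1)] that(1) S by (simp add: subgroup.m_closed subgroup.m_inv_closed)
  qed
  then show ?thesis unfolding normal_in_def using S nN(2,3) pw_subset[OF nN(1)] by blast
qed

end

context group
begin

text \<open>This expresses that conjugation by \<open>h\<close> is compatible with powers, since \<open>x \<otimes> comm x h\<close> is
  the conjugate of \<open>x\<close>. Together with approximate multiplicativity of powers it turns \<open>comm
  (x [^] p) h\<close> into the \<open>p\<close>-th power of \<open>comm x h\<close>.\<close>

lemma pow_mult_comm:
  assumes "x \<in> carrier G" "h \<in> carrier G"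
  shows "(x \<otimes> comm x h) [^] (n::nat) = x [^] n \<otimes> comm (x [^] n) h"
  using conj_pow[OF assms, of n] conj_eq_mult_comm[OF assms] conj_eq_mult_comm[of "x [^] n" h] assms
  by simp

lemma cgr_cancel_left:
  assumes "a \<in> carrier G" "u \<in> carrier G" "v \<in> carrier G"
  shows "cgr N (a \<otimes> u) (a \<otimes> v) \<longleftrightarrow> cgr N u v"
  using assms by (simp add: cgr_def inv_mult_group m_assoc)

lemma cgr_mult_right:
  assumes "a \<in> carrier G" "n \<in> N" "N \<subseteq> carrier G"
  shows "cgr N (a \<otimes> n) a"
  using assms by (auto simp: cgr_def)

lemma cgr_absorb:
  assumes "subgroup N G" "x \<in> carrier G" "r \<in> carrier G" "n \<in> N" "cgr N x (r \<otimes> n)"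
  shows "cgr N x r"
  using assms cgr_trans[OF assms(1), of x "r \<otimes> n" r] cgr_mult_right[OF assms(3,4) subgroup.subset[OF assms(1)]]
    subgroup.mem_carrier[OF assms(1,4)] by simp

lemma pow_dvd_closed:
  assumes "subgroup N G" "c \<in> carrier G" "c [^] (k::nat) \<in> N" "k dvd m"
  shows "c [^] m \<in> N"
proof -
  obtain j where "m = k * j" using assms(4) by blast
  then have "c [^] m = (c [^] k) [^] j" using assms by (simp add: nat_pow_pow)
  then show ?thesis using subgroup_pow_closed[OF is_group assms(1,3)] by simp
qed

section \<open>Fibres of the power map\<close>

text \<open>Multiplication by elements of \<open>S\<close> does not change the number of \<open>q\<close>-th roots in \<open>D\<close>. The
  set \<open>D\<close> will be a subgroup or one of its cosets.\<close>

definition neutral :: "nat \<Rightarrow> 'a set \<Rightarrow> 'a set \<Rightarrow> bool" where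
  "neutral q D S \<longleftrightarrow> (\<forall>b\<in>carrier G. \<forall>s\<in>S. card {z \<in> D. z [^] q = b} = card {z \<in> D. z [^] q = b \<otimes> s})"

lemma card_neutral_fibre:
  assumes D: "finite D" "D \<subseteq> carrier G" and S: "subgroup S G" "finite S" and neutral: "neutral q D S"
    and b: "b \<in> carrier G"
  shows "card {z \<in> D. cgr S (z [^] q) b} = card S * card {z \<in> D. z [^] q = b}"
proof -
  have SG: "S \<subseteq> carrier G" using S(1) by (rule subgroup.subset)
  have "cgr S (z [^] q) b \<longleftrightarrow> (\<exists>s\<in>S. z [^] q = b \<otimes> s)" if "z \<in> D" for z
    using cgr_iff_mult[OF _ b S(1)] that D(2) by blast
  then have "{z \<in> D. cgr S (z [^] q) b} = (\<Union>s\<in>S. {z \<in> D. z [^] q = b \<otimes> s})" by blast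
  moreover have "card (\<Union>s\<in>S. {z \<in> D. z [^] q = b \<otimes> s}) = (\<Sum>s\<in>S. card {z \<in> D. z [^] q = b \<otimes> s})"
    using D(1) S(2) SG b by (intro card_UN_disjoint) (auto simp: subset_iff)
  moreover have "\<dots> = (\<Sum>s\<in>S. card {z \<in> D. z [^] q = b})"
    using neutral b by (intro sum.cong) (auto simp: neutral_def)
  ultimately show ?thesis by simp
qed

text \<open>Translation by \<open>c\<close> maps the roots of \<open>b N\<close> injectively to roots of \<open>b s N\<close>; applying this
  to \<open>s\<close> and to its inverse shows that both sets have the same size. Inside the cosets of
  \<open>N\<close> the roots are equally distributed by assumption, so that the equality descends to
  single elements.\<close>

lemma neutral_step:
  assumes D: "finite D" "D \<subseteq> carrier G" and N: "normal_in N S" "finite N" and neutral: "neutral q D N"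
    and shift: "\<And>s. s \<in> S \<Longrightarrow> \<exists>c\<in>carrier G. \<forall>z\<in>D. z \<otimes> c \<in> D \<and> cgr N ((z \<otimes> c) [^] q) (z [^] q \<otimes> s)"
  shows "neutral q D S"
proof -
  note nN = normal_inD[OF N(1)]
  have SG: "S \<subseteq> carrier G" using subgroup.subset[OF nN(2)] .
  have NG: "N \<subseteq> carrier G" using subgroup.subset[OF nN(1)] .
  let ?F = "\<lambda>b. {z \<in> D. cgr N (z [^] q) b}"
  have le: "card (?F b) \<le> card (?F (b \<otimes> s))" if b: "b \<in> carrier G" and s: "s \<in> S" for b s
  proof -
    obtain c where c: "c \<in> carrier G" "\<And>z. z \<in> D \<Longrightarrow> z \<otimes> c \<in> D"
      "\<And>z. z \<in> D \<Longrightarrow> cgr N ((z \<otimes> c) [^] q) (z [^] q \<otimes> s)"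
      using shift[OF s] by blast
    have sG: "s \<in> carrier G" using s SG by blast
    have "z \<otimes> c \<in> ?F (b \<otimes> s)" if z: "z \<in> ?F b" for z
    proof -
      have zG: "z \<in> carrier G" and zD: "z \<in> D" using z D by auto
      obtain n where n: "n \<in> N" "z [^] q = b \<otimes> n"
        using z b zG nN(1) by (auto simp: cgr_iff_mult)
      have nG: "n \<in> carrier G" using n NG by blast
      have "z [^] q \<otimes> s = b \<otimes> s \<otimes> (inv s \<otimes> n \<otimes> s)"
        using n b sG nG by (simp add: m_assoc)
      then have "cgr N (z [^] q \<otimes> s) (b \<otimes> s)"
        using nN(6)[OF n(1) s] b sG NG by (simp add: cgr_mult_right)
      then have "cgr N ((z \<otimes> c) [^] q) (b \<otimes> s)"
        using cgr_trans[OF nN(1) _ _ _ c(3)[OF zD]] zG c(1) b sG by simp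
      then show ?thesis using c(2)[OF zD] by simp
    qed
    moreover have "inj_on (\<lambda>z. z \<otimes> c) (?F b)"
      using D(2) c(1) by (auto simp: inj_on_def subset_iff)
    ultimately show ?thesis
      using D(1) by (intro card_inj_on_le[of "\<lambda>z. z \<otimes> c"]) auto
  qed
  show ?thesis unfolding neutral_def
  proof (intro ballI)
    fix b s assume b: "b \<in> carrier G" and s: "s \<in> S"
    have sG: "s \<in> carrier G" using s SG by blast
    have "card (?F (b \<otimes> s)) \<le> card (?F (b \<otimes> s \<otimes> inv s))"
      using b s sG subgroup.m_inv_closed[OF nN(2) s] by (intro le) auto
    then have "card (?F b) = card (?F (b \<otimes> s))" using le[OF b s] b sG by (simp add: m_assoc)
    then have "card N * card {z \<in> D. z [^] q = b} = card N * card {z \<in> D. z [^] q = b \<otimes> s}"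
      using card_neutral_fibre[OF D nN(1) N(2) neutral] b sG by simp
    moreover have "card N > 0" using N(2) subgroup.one_closed[OF nN(1)] by (auto simp: card_gt_0_iff)
    ultimately show "card {z \<in> D. z [^] q = b} = card {z \<in> D. z [^] q = b \<otimes> s}" by simp
  qed
qed

text \<open>Iteration of the previous step up a chain that ends in the trivial subgroup. An element
  \<open>c\<close> of \<open>T k\<close> translates \<open>q\<close>-th powers by \<open>c [^] q\<close> only up to \<open>S (Suc k)\<close>, and this
  suffices because \<open>S (Suc k)\<close> has been dealt with before.\<close>

lemma neutral_chain:
  assumes D: "finite D" "D \<subseteq> carrier G"
    and S: "\<And>k. normal_in (S (Suc k)) (S k)" "\<And>k. finite (S k)" "S n = {\<one>}"
    and T: "\<And>k. T k \<subseteq> carrier G"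
    and shift: "\<And>k z c. z \<in> D \<Longrightarrow> c \<in> T k \<Longrightarrow>
      z \<otimes> c \<in> D \<and> cgr (S (Suc k)) ((z \<otimes> c) [^] q) (z [^] q \<otimes> c [^] q)"
    and root: "\<And>k s. s \<in> S k \<Longrightarrow> \<exists>c\<in>T k. cgr (S (Suc k)) (c [^] q) s"
  shows "neutral q D (S 0)"
proof -
  have "neutral q D (S k)" if "k \<le> n" for k
    using that
  proof (induction rule: inc_induct)
    case base
    then show ?case using S(3) by (simp add: neutral_def)
  next
    case (step k)
    note nS = normal_inD[OF S(1)[of k]]
    show ?case
    proof (rule neutral_step[OF D S(1) S(2) step.IH])
      fix s assume s: "s \<in> S k"
      obtain c where c: "c \<in> T k" "cgr (S (Suc k)) (c [^] q) s" using root[OF s] by blast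
      have cG: "c \<in> carrier G" and sG: "s \<in> carrier G"
        using c T s subgroup.mem_carrier[OF nS(2)] by blast+
      have "z \<otimes> c \<in> D \<and> cgr (S (Suc k)) ((z \<otimes> c) [^] q) (z [^] q \<otimes> s)" if z: "z \<in> D" for z
      proof -
        have zG: "z \<in> carrier G" using z D by blast
        have "cgr (S (Suc k)) (z [^] q \<otimes> c [^] q) (z [^] q \<otimes> s)"
          using c(2) zG cG sG by (simp add: cgr_cancel_left)
        then show ?thesis
          using shift[OF z c(1)] cgr_trans[OF nS(1)] zG cG sG by (meson m_closed nat_pow_closed)
      qed
      then show "\<exists>c\<in>carrier G. \<forall>z\<in>D. z \<otimes> c \<in> D \<and> cgr (S (Suc k)) ((z \<otimes> c) [^] q) (z [^] q \<otimes> s)"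
        using cG by blast
    qed
  qed
  then show ?thesis by simp
qed

end

context p_group
begin

text \<open>If taking \<open>p\<close>-th powers is multiplicative on \<open>K\<close> modulo \<open>N\<close>, then the \<open>p\<close>-th powers of
  elements of \<open>K\<close> already form a subgroup modulo \<open>N\<close>.\<close>

lemma root_mod:
  assumes nN: "normal_in N H" and K: "subgroup K G" "K \<subseteq> H"
    and mult: "\<And>c d. c \<in> K \<Longrightarrow> d \<in> K \<Longrightarrow> cgr N ((c \<otimes> d) [^] p) (c [^] p \<otimes> d [^] p)"
    and s: "s \<in> pw K"
  shows "\<exists>c\<in>K. cgr N (c [^] p) s"
proof -
  note N = normal_inD(1)[OF nN] and H = normal_inD(2)[OF nN]
  have HG: "H \<subseteq> carrier G" using H by (rule subgroup.subset)
  have HP: "u [^] (n::nat) \<in> H" if "u \<in> H" for u n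
    using that subgroup_pow_closed[OF is_group H] by blast
  have "s \<in> generate G {h [^] p | h. h \<in> K}" using s by (simp add: pw_def)
  then have "s \<in> H \<and> ?thesis"
  proof (induction rule: generate.induct)
    case one
    then show ?case using subgroup.one_closed[OF K(1)] subgroup.one_closed[OF N] K(2)
      by (auto intro!: bexI[of _ \<one>] simp: cgr_def)
  next
    case (incl s)
    then obtain h where h: "h \<in> K" "s = h [^] p" by blast
    moreover have "h \<in> H" "h \<in> carrier G" using h K HG by auto
    ultimately show ?case using HP cgr_refl[OF N] by (auto intro!: bexI[of _ h])
  next
    case (inv s)
    then obtain h where h: "h \<in> K" "s = h [^] p" by blast
    have hH: "h \<in> H" "h \<in> carrier G" "inv h \<in> H" using h K HG H
      by (auto intro: subgroup.m_inv_closed)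
    have "inv s = (inv h) [^] p" using h hH by (simp add: nat_pow_inv)
    then show ?case using HP[OF hH(3)] cgr_refl[OF N] hH subgroup.m_inv_closed[OF K(1) h(1)]
      by (auto intro!: bexI[of _ "inv h"])
  next
    case (eng s t)
    then obtain c d where c: "c \<in> K" "cgr N (c [^] p) s" and d: "d \<in> K" "cgr N (d [^] p) t"
      and st: "s \<in> H" "t \<in> H" by blast
    have cd: "c \<in> H" "d \<in> H" using c d K by auto
    have cdG: "c \<in> carrier G" "d \<in> carrier G" "s \<in> carrier G" "t \<in> carrier G" using cd st HG by auto
    have "cgr N ((c \<otimes> d) [^] p) (c [^] p \<otimes> d [^] p)" using mult c(1) d(1) .
    moreover have "cgr N (c [^] p \<otimes> d [^] p) (s \<otimes> t)"
      using c d cd st HP by (intro cgr_mult[OF nN]) auto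
    ultimately have "cgr N ((c \<otimes> d) [^] p) (s \<otimes> t)"
      using cgr_trans[OF N] cdG by (meson m_closed nat_pow_closed)
    then show ?case
      using subgroup.m_closed[OF K(1) c(1) d(1)] subgroup.m_closed[OF H st] by blast
  qed
  then show ?thesis by blast
qed

text \<open>All elements of \<open>pw H\<close> have the same number of \<open>p\<close>-th roots in \<open>H\<close>, namely the index of
  \<open>pw H\<close>. In particular each of them is a \<open>p\<close>-th power.\<close>

definition uniform :: "'a set \<Rightarrow> bool" where
  "uniform H \<longleftrightarrow> (\<forall>a\<in>pw H. card {h \<in> H. h [^] p = a} * card (pw H) = card H)"

text \<open>Every \<open>p\<close>-th power lies in the single coset \<open>pw H\<close>, whose fibres are equal and together
  fill \<open>H\<close>.\<close>

lemma neutral_imp_uniform: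
  assumes Hs: "subgroup H G" and ne: "neutral p H (pw H)"
  shows "uniform H"
  unfolding uniform_def
proof
  have HG: "H \<subseteq> carrier G" using Hs by (rule subgroup.subset)
  fix a assume a: "a \<in> pw H"
  have pw: "subgroup (pw H) G" using HG by simp
  have aG: "a \<in> carrier G" using subgroup.mem_carrier[OF pw a] .
  have "{z \<in> H. cgr (pw H) (z [^] p) a} = H"
    using a pow_in_pw pw by (auto simp: cgr_def subgroup.m_closed subgroup.m_inv_closed)
  then show "card {h \<in> H. h [^] p = a} * card (pw H) = card H"
    using card_neutral_fibre[OF finite_subgroup[OF Hs] HG pw finite_subgroup[OF pw] ne aG] by simp
qed

end

section \<open>Powerful subgroups\<close>

locale odd_p_group = p_group +
  assumes odd_p: "odd p"
begin

lemma p_ge_3: "3 \<le> p"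
  using prime_p odd_p prime_ge_2_nat[OF prime_p] by (cases "p = 2") auto

lemma p_dvd_choose_2: "p dvd (p choose 2)"
  using prime_p p_ge_3 by (intro dvd_choose_prime) auto

text \<open>The prime is odd, so it divides \<open>p choose 2\<close>, and the commutator contributes a power of
  its \<open>p\<close>-th power only.\<close>

lemma power_of_product_class_2_mod:
  assumes N: "normal_in N H" and xy: "x \<in> H" "y \<in> H"
    and e: "comm (comm y x) x \<in> N" and f: "comm (comm y x) y \<in> N" and c: "comm y x [^] p \<in> N"
  shows "cgr N ((x \<otimes> y) [^] p) (x [^] p \<otimes> y [^] p)"
proof -
  note nN = normal_inD[OF N]
  have [simp]: "x \<in> carrier G" "y \<in> carrier G" using xy subgroup.mem_carrier[OF nN(2)] by auto
  have NG: "N \<subseteq> carrier G" using subgroup.subset[OF nN(1)] .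
  let ?r = "x [^] p \<otimes> y [^] p"
  let ?c = "comm y x [^] (p choose 2)" and ?e = "comm (comm y x) x [^] (p choose 3)"
    and ?f = "comm (comm y x) y [^] ((p choose 2) + 2 * (p choose 3))"
  have "cgr N ((x \<otimes> y) [^] p) (?r \<otimes> ?c \<otimes> ?e \<otimes> ?f)"
    using e f xy by (intro power_of_product_mod[OF N]) (auto intro: nN(4))
  moreover have "?c \<in> N" using pow_dvd_closed[OF nN(1) _ c p_dvd_choose_2] by simp
  then have "?c \<otimes> (?e \<otimes> ?f) \<in> N"
    using e f nN(1) by (auto intro!: subgroup.m_closed subgroup_pow_closed is_group)
  moreover have "?r \<otimes> ?c \<otimes> ?e \<otimes> ?f = ?r \<otimes> (?c \<otimes> (?e \<otimes> ?f))" by (simp add: m_assoc)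
  ultimately show ?thesis 
    by - (rule cgr_absorb[OF nN(1), where n = "?c \<otimes> (?e \<otimes> ?f)"], simp_all)
qed

text \<open>Here \<open>p choose 3\<close> has to be divisible by \<open>p\<close> as well, which is false for \<open>p = 3\<close>.\<close>

lemma power_of_product_class_3_mod:
  assumes p: "p \<noteq> 3" and N: "normal_in N H" and xy: "x \<in> H" "y \<in> H"
    and e: "comm (comm (comm y x) x) x \<in> N" "comm (comm (comm y x) x) y \<in> N"
    and f: "comm (comm (comm y x) y) x \<in> N" "comm (comm (comm y x) y) y \<in> N"
    and pow: "comm y x [^] p \<in> N" "comm (comm y x) x [^] p \<in> N" "comm (comm y x) y [^] p \<in> N"
  shows "cgr N ((x \<otimes> y) [^] p) (x [^] p \<otimes> y [^] p)"
proof -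
  note nN = normal_inD[OF N]
  have [simp]: "x \<in> carrier G" "y \<in> carrier G" using xy subgroup.mem_carrier[OF nN(2)] by auto
  have NG: "N \<subseteq> carrier G" using subgroup.subset[OF nN(1)] .
  let ?r = "x [^] p \<otimes> y [^] p"
  let ?c = "comm y x [^] (p choose 2)" and ?e = "comm (comm y x) x [^] (p choose 3)"
    and ?f = "comm (comm y x) y [^] ((p choose 2) + 2 * (p choose 3))"
  have "p dvd (p choose 3)" using prime_p p_ge_3 p by (intro dvd_choose_prime) auto
  then have "?c \<in> N" "?e \<in> N" "?f \<in> N"
    using pow_dvd_closed[OF nN(1) _ pow(1)] pow_dvd_closed[OF nN(1) _ pow(2)] pow_dvd_closed[OF nN(1) _ pow(3)]
      p_dvd_choose_2 by auto
  moreover have "cgr N ((x \<otimes> y) [^] p) (?r \<otimes> ?c \<otimes> ?e \<otimes> ?f)"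
    using e f xy by (intro power_of_product_mod[OF N])
  moreover have "?r \<otimes> ?c \<otimes> ?e \<otimes> ?f = ?r \<otimes> (?c \<otimes> (?e \<otimes> ?f))" by (simp add: m_assoc)
  moreover have "?c \<otimes> (?e \<otimes> ?f) \<in> N"
    using \<open>?c \<in> N\<close> \<open>?e \<in> N\<close> \<open>?f \<in> N\<close> nN(1) by (auto intro!: subgroup.m_closed)
  ultimately show ?thesis 
    by - (rule cgr_absorb[OF nN(1), where n = "?c \<otimes> (?e \<otimes> ?f)"], simp_all)
qed

text \<open>The condition that defines powerful groups for odd primes, stated for a subset of the
  ambient group.\<close>

definition powerful_set :: "'a set \<Rightarrow> bool" where
  "powerful_set H \<longleftrightarrow> subgroup H G \<and> (\<forall>x\<in>H. \<forall>y\<in>H. comm x y \<in> pw H)"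

text \<open>The notion of Lubotzky and Mann: not only the commutators of \<open>N\<close>, but those of \<open>N\<close> with
  the larger group \<open>H\<close> are controlled by \<open>pw N\<close>.\<close>

definition powerfully_embedded :: "'a set \<Rightarrow> 'a set \<Rightarrow> bool" where
  "powerfully_embedded N H \<longleftrightarrow> normal_in N H \<and> (\<forall>n\<in>N. \<forall>h\<in>H. comm n h \<in> pw N)"

lemma powerfully_embedded_self: "powerful_set H \<Longrightarrow> powerfully_embedded H H"
  by (simp add: powerful_set_def powerfully_embedded_def normal_in_self)

lemma powerfully_embedded_imp_powerful: "powerfully_embedded N H \<Longrightarrow> powerful_set N"
  using normal_inD(1,3) by (fastforce simp: powerful_set_def powerfully_embedded_def)

text \<open>Suppose that \<open>[pw N, H]\<close> is not contained in \<open>pw (pw N)\<close>. Enlarge \<open>pw (pw N)\<close> to a normal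
  subgroup \<open>K\<close> that is as large as possible subject to not containing \<open>[pw N, H]\<close>. Adding an
  element that is central modulo \<open>K\<close> gives a subgroup \<open>L\<close> that contains \<open>[pw N, H]\<close> and
  satisfies \<open>[L, H] \<subseteq> K\<close>. So \<open>[pw N, H, H]\<close> is trivial modulo \<open>K\<close>, and the class two formula
  shows for \<open>n\<close> in \<open>N\<close> and \<open>h\<close> in \<open>H\<close> that \<open>[n^p, h]\<close> agrees with \<open>[n, h]^p\<close> modulo \<open>K\<close>. The
  latter lies in \<open>pw (pw N)\<close>, so all these commutators lie in \<open>K\<close>, a contradiction.\<close>

theorem powerfully_embedded_pw:
  assumes N: "powerfully_embedded N H"
  shows "powerfully_embedded (pw N) H"
proof -
  let ?A = "pw N" let ?B = "pw (pw N)"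
  have nN: "normal_in N H" and NA: "\<And>n h. n \<in> N \<Longrightarrow> h \<in> H \<Longrightarrow> comm n h \<in> ?A"
    using N by (auto simp: powerfully_embedded_def)
  note H = normal_inD(2)[OF nN] and NH = normal_inD(3)[OF nN]
  have car: "x \<in> carrier G" if "x \<in> H" for x using that subgroup.mem_carrier[OF H] by blast
  have nA: "normal_in ?A H" and nB: "normal_in ?B H" using nN by (simp_all add: normal_in_pw)
  have BA: "?B \<subseteq> ?A" using pw_subset[OF normal_inD(1)[OF nA]] .
  note AH = normal_inD(3)[OF nA]
  have "comm a h \<in> ?B" if "a \<in> ?A" "h \<in> H" for a h
  proof (rule ccontr)
    assume nab: "comm a h \<notin> ?B"
    let ?P = "\<lambda>K. normal_in K H \<and> ?B \<subseteq> K \<and> K \<subseteq> ?A \<and> (\<exists>a\<in>?A. \<exists>h\<in>H. comm a h \<notin> K)"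
    \<comment> \<open>The normal subgroup \<open>K\<close> is as large as possible without containing all these
      commutators.\<close>
    have "\<exists>K. ?P K \<and> (\<forall>L. ?P L \<longrightarrow> card L \<le> card K)"
      using nB BA nab that finite_subgroup[OF H]
      by (intro ex_has_greatest_nat[of _ ?B _ "Suc (card H)"])
        (auto intro!: card_mono dest: normal_inD(3) simp: less_Suc_eq_le)
    then obtain K where K: "?P K" and Kmax: "\<And>L. ?P L \<Longrightarrow> card L \<le> card K" by blast
    then have nK: "normal_in K H" and BK: "?B \<subseteq> K" and KA: "K \<subseteq> ?A" by auto
    have "K \<subset> ?A" using K normal_inD(4)[OF nA] by blast
    then obtain u where u: "u \<in> ?A" "u \<notin> K" "\<And>h. h \<in> H \<Longrightarrow> comm u h \<in> K"
      using normal_in_central_element[OF nK nA] by blast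
    let ?L = "generate G (insert u K)"
    have uH: "u \<in> H" using u(1) AH by blast
    have KH: "insert u K \<subseteq> H" using uH KA AH by auto
    have nL: "normal_in ?L H" using normal_in_generate_insert[OF nK uH u(3)] .
    have LA: "?L \<subseteq> ?A" using generate_subgroup_incl[OF _ normal_inD(1)[OF nA]] u(1) KA by simp
    have KL: "K \<subset> ?L" using u(2) by (auto intro: generate.incl)
    have "card K < card ?L"
      using psubset_card_mono[OF finite_subgroup[OF normal_inD(1)[OF nL]] KL] .
    then have AL: "comm a h \<in> ?L" if "a \<in> ?A" "h \<in> H" for a h
      using Kmax[of ?L] nL BK KL LA that by fastforce
    have LK: "comm l h \<in> K" if "l \<in> ?L" "h \<in> H" for l h
      using comm_generate_left[OF nK KH that(2) _ that(1)] u(3) normal_inD(4)[OF nK] that by auto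
    have "comm (n [^] p) h \<in> K" if n: "n \<in> N" and h: "h \<in> H" for n h
    proof -
      let ?z = "comm n h" let ?c = "comm ?z n"
      have nH: "n \<in> H" using n NH by blast
      have z: "?z \<in> ?A" "?z \<in> H" using NA n h AH by auto
      have c: "?c \<in> ?L" "?c \<in> H" using AL[OF z(1) nH] LA AH by auto
      have zp: "?z [^] p \<in> ?B" using pow_in_pw[OF z(1)] .
      have "cgr K ((?z \<otimes> ?c) [^] p) (?z [^] p \<otimes> ?c [^] p)"
      proof (rule power_of_product_class_2_mod[OF nK z(2) c(2)])
        show "comm (comm ?c ?z) ?z \<in> K" "comm (comm ?c ?z) ?c \<in> K" "comm ?c ?z [^] p \<in> K"
          using LK[OF c(1) z(2)] normal_inD(4)[OF nK] z c normal_inD(1)[OF nK]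
          by (auto intro: subgroup_pow_closed is_group)
      qed
      then have "cgr K (comm (?z [^] p) n) (?c [^] p)"
        using car[OF nH] car[OF z(2)] car[OF c(2)] by (simp add: pow_mult_comm cgr_cancel_left)
      moreover have "comm (?z [^] p) n \<in> K" using normal_inD(4)[OF nB zp nH] BK by blast
      ultimately have cp: "?c [^] p \<in> K"
        using car[OF nH] car[OF z(2)] car[OF c(2)] cgr_sym[OF normal_inD(1)[OF nK]]
          cgr_member[OF normal_inD(1)[OF nK] order_refl] by (meson comm_closed nat_pow_closed)
      have "cgr K ((n \<otimes> ?z) [^] p) (n [^] p \<otimes> ?z [^] p)"
        using LK[OF c(1)] nH z cp by (intro power_of_product_class_2_mod[OF nK nH z(2)]) auto
      then have "cgr K (comm (n [^] p) h) (?z [^] p)"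
        using car[OF nH] car[OF h] by (simp add: pow_mult_comm cgr_cancel_left)
      then show ?thesis
        using cgr_member[OF normal_inD(1)[OF nK] order_refl] zp BK car[OF nH] car[OF h] by (meson comm_closed nat_pow_closed subsetD)
    qed
    moreover have "{n [^] p | n. n \<in> N} \<subseteq> H"
      using NH subgroup_pow_closed[OF is_group H] by blast
    ultimately have "comm a h \<in> K" if "a \<in> ?A" "h \<in> H" for a h
      using comm_generate_left[OF nK, of "{n [^] p | n. n \<in> N}" h a] that unfolding pw_def by blast
    then show False using K by blast
  qed
  then show ?thesis using nA by (simp add: powerfully_embedded_def)
qed

lemma powerful_funpow_pw_embedded:
  "powerful_set H \<Longrightarrow> powerfully_embedded ((pw ^^ k) H) H"
  by (induction k) (simp_all add: powerfully_embedded_self powerfully_embedded_pw)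

lemma powerful_funpow_pw: "powerful_set H \<Longrightarrow> powerful_set ((pw ^^ k) H)"
  using powerful_funpow_pw_embedded powerfully_embedded_imp_powerful by blast

lemma powerful_subgroup: "powerful_set H \<Longrightarrow> subgroup H G"
  by (simp add: powerful_set_def)

lemma powerful_comm:
  assumes "powerful_set H" "x \<in> (pw ^^ k) H" "h \<in> H"
  shows "comm x h \<in> (pw ^^ Suc k) H"
  using powerful_funpow_pw_embedded[OF assms(1), of k] assms(2,3) by (simp add: powerfully_embedded_def)

lemma powerful_normal: "powerful_set H \<Longrightarrow> normal_in ((pw ^^ k) H) H"
  using powerful_funpow_pw_embedded by (auto simp: powerfully_embedded_def)

text \<open>The commutator of \<open>x\<close> and \<open>c\<close> lies in level \<open>Suc k\<close>; hence its \<open>p\<close>-th power and its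
  further commutators lie two levels below \<open>c\<close>. This single congruence drives the counting
  of roots.\<close>

lemma powerful_pow_mult:
  assumes H: "powerful_set H" and x: "x \<in> H" and c: "c \<in> (pw ^^ k) H"
  shows "cgr ((pw ^^ Suc (Suc k)) H) ((x \<otimes> c) [^] p) (x [^] p \<otimes> c [^] p)"
proof -
  have cH: "c \<in> H" using c normal_inD(3)[OF powerful_normal[OF H]] by blast
  have z: "comm c x \<in> (pw ^^ Suc k) H" using powerful_comm[OF H c x] .
  show ?thesis
    using powerful_comm[OF H z x] powerful_comm[OF H z cH] pow_in_pw[OF z]
    by (intro power_of_product_class_2_mod[OF powerful_normal[OF H] x cH]) auto
qed

lemma powerful_root_mod:
  assumes H: "powerful_set H" and s: "s \<in> (pw ^^ Suc k) H"
  shows "\<exists>c\<in>(pw ^^ k) H. cgr ((pw ^^ Suc (Suc k)) H) (c [^] p) s"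
proof (rule root_mod)
  show "normal_in ((pw ^^ Suc (Suc k)) H) H" by (rule powerful_normal[OF H])
  show "subgroup ((pw ^^ k) H) G" "(pw ^^ k) H \<subseteq> H"
    using normal_inD[OF powerful_normal[OF H]] by auto
  then show "cgr ((pw ^^ Suc (Suc k)) H) ((c \<otimes> d) [^] p) (c [^] p \<otimes> d [^] p)"
    if "c \<in> (pw ^^ k) H" "d \<in> (pw ^^ k) H" for c d
    using powerful_pow_mult[OF H _ that(2)] that by blast
  show "s \<in> pw ((pw ^^ k) H)" using s by simp
qed

lemma uniform_root:
  assumes "uniform H" "subgroup H G" "a \<in> pw H"
  obtains h where "h \<in> H" "a = h [^] p"
proof -
  have "card H > 0" using finite_subgroup[OF assms(2)] subgroup.one_closed[OF assms(2)] by (auto simp: card_gt_0_iff)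
  moreover have "card {h \<in> H. h [^] p = a} * card (pw H) = card H"
    using assms(1,3) by (simp add: uniform_def)
  ultimately have "card {h \<in> H. h [^] p = a} \<noteq> 0" by (metis mult_0 less_irrefl)
  then have "{h \<in> H. h [^] p = a} \<noteq> {}" by (metis card.empty)
  then show thesis using that by blast
qed

text \<open>Translation by elements of level \<open>k\<close> shifts \<open>p\<close>-th powers by arbitrary elements of level
  \<open>Suc k\<close>, up to level \<open>Suc (Suc k)\<close>. This is the input that \<open>neutral_chain\<close> needs.\<close>

theorem powerful_uniform:
  assumes H: "powerful_set H"
  shows "uniform H"
proof -
  note Hs = powerful_subgroup[OF H]
  have HG: "H \<subseteq> carrier G" using Hs by (rule subgroup.subset)
  have sub: "subgroup ((pw ^^ k) H) G" for k using funpow_pw_subgroup[OF Hs] .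
  obtain n where n: "\<And>k. k \<ge> n \<Longrightarrow> (pw ^^ k) H = {\<one>}" using funpow_pw_trivial[OF Hs] by blast
  have "neutral p H ((pw ^^ Suc 0) H)"
  proof (rule neutral_chain[where T = "\<lambda>k. (pw ^^ k) H" and n = n and S = "\<lambda>k. (pw ^^ Suc k) H"])
    show "normal_in ((pw ^^ Suc (Suc k)) H) ((pw ^^ Suc k) H)" for k
      using normal_in_subset[OF powerful_normal[OF H] sub] funpow_pw_antimono[OF Hs] normal_inD(3)[OF powerful_normal[OF H]]
      by (meson le_SucI order_refl)
    show "z \<otimes> c \<in> H \<and> cgr ((pw ^^ Suc (Suc k)) H) ((z \<otimes> c) [^] p) (z [^] p \<otimes> c [^] p)"
      if "z \<in> H" "c \<in> (pw ^^ k) H" for k z c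
      using powerful_pow_mult[OF H that] that normal_inD(3)[OF powerful_normal[OF H]] subgroup.m_closed[OF Hs]
      by blast
    show "finite H" "finite ((pw ^^ Suc k) H)" for k
      by (rule finite_subgroup[OF Hs], rule finite_subgroup[OF sub])
    show "(pw ^^ Suc n) H = {\<one>}" by (rule n) simp
    show "(pw ^^ k) H \<subseteq> carrier G" for k by (rule subgroup.subset[OF sub])
    show "\<exists>c\<in>(pw ^^ k) H. cgr ((pw ^^ Suc (Suc k)) H) (c [^] p) s" if "s \<in> (pw ^^ Suc k) H" for k s
      using powerful_root_mod[OF H that] .
  qed (rule HG)
  then show ?thesis using neutral_imp_uniform[OF Hs] by simp
qed

lemma powerful_root:
  assumes "powerful_set H" "a \<in> (pw ^^ (k + j)) H"
  obtains h where "h \<in> (pw ^^ k) H" "a = h [^] (p ^ j)"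
proof -
  have "\<exists>h\<in>(pw ^^ k) H. a = h [^] (p ^ j)"
    using assms(2)
  proof (induction j arbitrary: a)
    case 0
    then have "a \<in> carrier G"
      using funpow_pw_subset[OF subgroup.subset[OF powerful_subgroup[OF assms(1)]], of k] by auto
    then show ?case using 0 by (intro bexI[of _ a]) auto
  next
    case (Suc j)
    have "powerful_set ((pw ^^ (k + j)) H)" using powerful_funpow_pw[OF assms(1)] .
    then obtain b where b: "b \<in> (pw ^^ (k + j)) H" "a = b [^] p"
      using Suc.prems uniform_root[OF powerful_uniform powerful_subgroup] by (metis add_Suc_right comp_apply funpow.simps(2))
    then obtain h where h: "h \<in> (pw ^^ k) H" "b = h [^] (p ^ j)" using Suc.IH by blast
    have "h \<in> carrier G" using h funpow_pw_subset[OF subgroup.subset[OF powerful_subgroup[OF assms(1)]]] by blast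
    then show ?case using b h by (auto intro!: bexI[of _ h] simp: nat_pow_pow mult.commute)
  qed
  then show thesis using that by blast
qed

text \<open>The \<open>p ^ Suc i\<close>-th roots of an element are the \<open>p\<close>-th roots of its \<open>p ^ i\<close>-th roots in \<open>pw
  D\<close>. Counting in two steps multiplies the indices along the chain, and since the counts are
  positive, every element of the iterate is a power. The first step uses that \<open>D\<close> is
  uniform, all later ones that \<open>pw D\<close> is powerful.\<close>

theorem uniform_power_structure:
  assumes D: "subgroup D G" and u: "uniform D" and pw: "powerful_set (pw D)"
  shows "(pw ^^ Suc i) D = {g [^] (p ^ Suc i) | g. g \<in> D}"
    and "a \<in> (pw ^^ Suc i) D \<Longrightarrow> card {g \<in> D. g [^] (p ^ Suc i) = a} * card ((pw ^^ Suc i) D) = card D"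
proof -
  have DG: "D \<subseteq> carrier G" using D by (rule subgroup.subset)
  have count: "card {g \<in> E. g [^] (p ^ Suc i) = a} * card ((pw ^^ Suc i) E) = card E"
    if "subgroup E G" "uniform E" "powerful_set (pw E)" "a \<in> (pw ^^ Suc i) E" for E a i
    using that
  proof (induction i arbitrary: E a)
    case 0
    then show ?case by (simp add: uniform_def)
  next
    case (Suc i)
    have E: "E \<subseteq> carrier G" using Suc.prems(1) by (rule subgroup.subset)
    have fE: "finite E" using finite_subgroup[OF Suc.prems(1)] .
    have pE: "subgroup (pw E) G" using E by simp
    have fpE: "finite (pw E)" using finite_subgroup[OF pE] .
    have shift: "(pw ^^ Suc (Suc i)) E = (pw ^^ Suc i) (pw E)" by (simp add: funpow_swap1)
    let ?B = "{b \<in> pw E. b [^] (p ^ Suc i) = a}"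
    have IH: "card ?B * card ((pw ^^ Suc i) (pw E)) = card (pw E)"
      using Suc.prems pE powerful_uniform powerful_funpow_pw[of "pw E" 1] shift by (intro Suc.IH) auto
    have "g [^] (p ^ Suc (Suc i)) = (g [^] p) [^] (p ^ Suc i)" if "g \<in> E" for g
      using that E nat_pow_pow[of g p "p ^ Suc i"] by auto
    then have "{g \<in> E. g [^] (p ^ Suc (Suc i)) = a} = (\<Union>b\<in>?B. {g \<in> E. g [^] p = b})"
      using pow_in_pw by auto
    moreover have "card (\<Union>b\<in>?B. {g \<in> E. g [^] p = b}) = (\<Sum>b\<in>?B. card {g \<in> E. g [^] p = b})"
      using fE fpE by (intro card_UN_disjoint) auto
    moreover have "\<dots> * card (pw E) = (\<Sum>b\<in>?B. card E)"
      unfolding sum_distrib_right using Suc.prems(2) by (intro sum.cong) (auto simp: uniform_def)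
    ultimately have 1: "card {g \<in> E. g [^] (p ^ Suc (Suc i)) = a} * card (pw E) = card ?B * card E" by simp
    have "card (pw E) * (card {g \<in> E. g [^] (p ^ Suc (Suc i)) = a} * card ((pw ^^ Suc i) (pw E)))
        = (card {g \<in> E. g [^] (p ^ Suc (Suc i)) = a} * card (pw E)) * card ((pw ^^ Suc i) (pw E))"
      by (simp only: ac_simps)
    also have "\<dots> = (card ?B * card ((pw ^^ Suc i) (pw E))) * card E" unfolding 1 by (simp only: ac_simps)
    also have "\<dots> = card (pw E) * card E" unfolding IH ..
    finally show ?case using fpE subgroup.one_closed[OF pE] by (auto simp only: shift mult_cancel1 card_0_eq)
  qed
  show c: "card {g \<in> D. g [^] (p ^ Suc i) = a} * card ((pw ^^ Suc i) D) = card D"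
    if "a \<in> (pw ^^ Suc i) D" for a using count[OF D u pw that] .
  show "(pw ^^ Suc i) D = {g [^] (p ^ Suc i) | g. g \<in> D}"
  proof (intro equalityI subsetI)
    fix a assume "a \<in> (pw ^^ Suc i) D"
    have "card D > 0" using finite_subgroup[OF D] subgroup.one_closed[OF D] by (auto simp: card_gt_0_iff)
    then have "card {g \<in> D. g [^] (p ^ Suc i) = a} \<noteq> 0"
      using c[OF \<open>a \<in> (pw ^^ Suc i) D\<close>] by (metis mult_0 less_irrefl)
    then have "{g \<in> D. g [^] (p ^ Suc i) = a} \<noteq> {}" by (metis card.empty)
    then show "a \<in> {g [^] (p ^ Suc i) | g. g \<in> D}" by blast
  next
    fix a assume "a \<in> {g [^] (p ^ Suc i) | g. g \<in> D}"
    then show "a \<in> (pw ^^ Suc i) D" using pow_in_funpow_pw[OF DG, of _ 0 "Suc i"] by auto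
  qed
qed

end

section \<open>Elements of bounded order in powerful groups\<close>

context odd_p_group
begin

text \<open>Powers of products are products of powers modulo \<open>pw (pw H)\<close>, which is superfluous among
  generators of \<open>pw H\<close>.\<close>

lemma powerful_pw_generate:
  assumes H: "powerful_set H" and S: "S \<subseteq> H" and gen: "generate G S = H"
  shows "pw H = generate G {s [^] p | s. s \<in> S}"
proof -
  note Hs = powerful_subgroup[OF H]
  have HG: "H \<subseteq> carrier G" using Hs by (rule subgroup.subset)
  have pH: "subgroup (pw H) G" using HG by simp
  let ?S = "{s [^] p | s. s \<in> S}" let ?W = "generate G (?S \<union> pw (pw H))"
  have ppH: "pw (pw H) \<subseteq> pw H" using pw_subset[OF pH] .
  have S': "?S \<subseteq> pw H" using S by (auto intro: pow_in_pw)
  have W: "subgroup ?W G" using S' ppH subgroup.subset[OF pH] by (intro generate_is_subgroup) auto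
  have "h \<in> H \<and> h [^] p \<in> ?W" if "h \<in> generate G S" for h
    using that
  proof (induction rule: generate.induct)
    case one
    then show ?case using subgroup.one_closed[OF Hs] subgroup.one_closed[OF W] by simp
  next
    case (incl h)
    then show ?case using S by (auto intro: generate.incl)
  next
    case (inv h)
    have "h [^] p \<in> ?W" "h \<in> H" using inv S by (auto intro: generate.incl)
    then show ?case using subgroup.m_inv_closed[OF W] subgroup.m_inv_closed[OF Hs] HG
      by (auto simp: nat_pow_inv)
  next
    case (eng h k)
    then have hk: "h \<in> H" "k \<in> H" "h \<otimes> k \<in> H" using subgroup.m_closed[OF Hs] by auto
    have "cgr (pw (pw H)) ((h \<otimes> k) [^] p) (h [^] p \<otimes> k [^] p)"
      using powerful_pow_mult[OF H hk(1), of k 0] hk by simp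
    moreover have "h [^] p \<otimes> k [^] p \<in> ?W" using eng subgroup.m_closed[OF W] by blast
    moreover have "pw (pw H) \<subseteq> ?W" by (auto intro: generate.incl)
    ultimately have "(h \<otimes> k) [^] p \<in> ?W"
      using cgr_member[OF W] hk HG by (meson m_closed nat_pow_closed subsetD)
    then show ?case using hk by simp
  qed
  then have "{h [^] p | h. h \<in> H} \<subseteq> ?W" using gen by auto
  then have "generate G {h [^] p | h. h \<in> H} \<subseteq> ?W" by (rule generate_subgroup_incl[OF _ W])
  then have "pw H \<subseteq> ?W" by (simp flip: pw_def)
  then show ?thesis using pw_superfluous[OF pH S'] by simp
qed

lemma powerful_funpow_pw_generate:
  assumes H: "powerful_set H" and S: "S \<subseteq> H" and gen: "generate G S = H"
  shows "(pw ^^ k) H = generate G {s [^] (p ^ k) | s. s \<in> S}"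
proof (induction k)
  case 0
  have "{s [^] (p ^ 0) | s. s \<in> S} = S"
    using S subgroup.subset[OF powerful_subgroup[OF H]] by (auto simp: subset_iff) (metis l_one)+
  then show ?case using gen by simp
next
  case (Suc k)
  let ?S = "{s [^] (p ^ k) | s. s \<in> S}"
  have "?S \<subseteq> (pw ^^ k) H" unfolding Suc by (auto intro: generate.incl)
  then have "pw ((pw ^^ k) H) = generate G {t [^] p | t. t \<in> ?S}"
    using Suc by (intro powerful_pw_generate powerful_funpow_pw[OF H]) auto
  moreover have "{t [^] p | t. t \<in> ?S} = {s [^] (p ^ Suc k) | s. s \<in> S}"
  proof -
    have "(s [^] (p ^ k)) [^] p = s [^] (p ^ Suc k)" if "s \<in> S" for s
      using that S subgroup.mem_carrier[OF powerful_subgroup[OF H]] by (simp add: nat_pow_pow mult.commute subset_iff)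
    then have "(\<lambda>s. (s [^] (p ^ k)) [^] p) ` S = (\<lambda>s. s [^] (p ^ Suc k)) ` S" by (intro image_cong) auto
    then show ?thesis by (auto simp: image_def)
  qed
  ultimately show ?case by simp
qed

text \<open>Since \<open>v\<close> commutes with itself, every commutator of two generators involves an element of
  \<open>pw H\<close>. Hence it lies in \<open>pw (pw H)\<close>, which consists of products of \<open>p\<close>-th powers of
  elements of \<open>pw H\<close>. These subgroups are the smaller powerful groups to which the induction
  in \<open>powerful_om_subgroup\<close> is applied.\<close>

lemma powerful_generate_insert_pw:
  assumes H: "powerful_set H" and v: "v \<in> H"
  shows "powerful_set (generate G (insert v (pw H)))" (is "powerful_set ?K")
proof -
  note Hs = powerful_subgroup[OF H]
  have pH: "pw H \<subseteq> H" using pw_subset[OF Hs] .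
  have sub: "insert v (pw H) \<subseteq> H" using v pH by auto
  have K: "subgroup ?K G" using sub subgroup.subset[OF Hs] by (intro generate_is_subgroup) auto
  have nN: "normal_in (pw (pw H)) H" using powerful_normal[OF H, of 2] by (simp add: numeral_2_eq_2)
  have 1: "comm a b \<in> pw (pw H)" if "a \<in> pw H" "b \<in> H" for a b
    using powerful_comm[OF H, of a 1 b] that by simp
  have vG: "v \<in> carrier G" using v subgroup.mem_carrier[OF Hs] by blast
  have "comm a b \<in> pw (pw H)" if ab: "a \<in> insert v (pw H)" "b \<in> insert v (pw H)" for a b
  proof (cases "a \<in> pw H")
    case False
    then have [simp]: "a = v" using ab by simp
    show ?thesis
    proof (cases "b \<in> pw H")
      case True
      then have "inv (comm b v) \<in> pw (pw H)"
        using 1[OF True v] subgroup.m_inv_closed[OF normal_inD(1)[OF nN]] by blast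
      then show ?thesis using True vG pH subgroup.mem_carrier[OF Hs] by (simp add: inv_commutator subset_iff)
    next
      case False
      then have "b = v" using ab by simp
      then show ?thesis using vG subgroup.one_closed[OF normal_inD(1)[OF nN]] comm_eq_one_iff[of v v] by simp
    qed
  qed (use 1 ab sub in blast)
  then have "comm x y \<in> pw (pw H)" if "x \<in> ?K" "y \<in> ?K" for x y
    using comm_generate[OF nN sub sub] that by blast
  moreover have "pw (pw H) \<subseteq> pw ?K" by (intro pw_mono) (auto intro: generate.incl)
  ultimately show ?thesis using K by (auto simp: powerful_set_def)
qed

text \<open>The set of solutions itself and not the subgroup that it generates, since the coincidence
  of the two is to be proved.\<close>

definition om :: "nat \<Rightarrow> 'a set \<Rightarrow> 'a set" where
  "om i H = {h \<in> H. h [^] (p ^ i) = \<one>}"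

lemma om_conj:
  assumes "H \<subseteq> carrier G" "h \<in> om i H" "x \<in> carrier G"
  shows "(inv x \<otimes> h \<otimes> x) [^] (p ^ i) = \<one>"
  using assms conj_pow[of h x "p ^ i"] by (auto simp: om_def subset_iff)

lemma normal_in_om:
  assumes N: "normal_in N H" and sub: "subgroup (om i N) G"
  shows "normal_in (om i N) H"
proof -
  note nN = normal_inD[OF N]
  have "comm n h \<in> om i N" if n: "n \<in> om i N" and h: "h \<in> H" for n h
  proof -
    have nN': "n \<in> N" using n by (simp add: om_def)
    have G: "n \<in> carrier G" "h \<in> carrier G"
      using subgroup.mem_carrier[OF nN(1) nN'] subgroup.mem_carrier[OF nN(2) h] by auto
    have "inv h \<otimes> n \<otimes> h \<in> om i N"
      using om_conj[OF subgroup.subset[OF nN(1)] n G(2)] nN(6)[OF nN' h] by (simp add: om_def)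
    then have "inv n \<otimes> (inv h \<otimes> n \<otimes> h) \<in> om i N"
      using n sub by (simp add: subgroup.m_closed subgroup.m_inv_closed)
    then show ?thesis using G by (simp add: comm_def m_assoc)
  qed
  then show ?thesis unfolding normal_in_def using sub nN(2,3) by (auto simp: om_def)
qed

lemma om_mono_exponent: "H \<subseteq> carrier G \<Longrightarrow> i \<le> j \<Longrightarrow> om i H \<subseteq> om j H"
proof
  fix h assume a: "H \<subseteq> carrier G" "i \<le> j" "h \<in> om i H"
  then have "p ^ j = p ^ i * p ^ (j - i)" "h \<in> carrier G"
    by (auto simp: om_def subset_iff simp flip: power_add)
  then have "h [^] (p ^ j) = (h [^] (p ^ i)) [^] (p ^ (j - i))" by (simp add: nat_pow_pow)
  then show "h \<in> om j H" using a by (simp add: om_def)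
qed

lemma commutative_om_subgroup:
  assumes H: "subgroup H G" and comm: "\<And>x y. x \<in> H \<Longrightarrow> y \<in> H \<Longrightarrow> x \<otimes> y = y \<otimes> x"
  shows "subgroup (om i H) G"
proof (rule subgroupI)
  have car: "x \<in> carrier G" if "x \<in> H" for x using that subgroup.mem_carrier[OF H] by blast
  show "om i H \<subseteq> carrier G" using car by (auto simp: om_def)
  show "om i H \<noteq> {}" using subgroup.one_closed[OF H] by (auto simp: om_def)
  show "inv a \<in> om i H" if "a \<in> om i H" for a
    using that car subgroup.m_inv_closed[OF H] by (auto simp: om_def nat_pow_inv)
  show "a \<otimes> b \<in> om i H" if "a \<in> om i H" "b \<in> om i H" for a b
    using that car comm subgroup.m_closed[OF H] pow_mult_distrib[of a b] by (auto simp: om_def)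
qed

lemma om_closed_mult_imp_subgroup:
  assumes H: "subgroup H G" and mult: "\<And>x y. x \<in> om i H \<Longrightarrow> y \<in> om i H \<Longrightarrow> (x \<otimes> y) [^] (p ^ i) = \<one>"
  shows "subgroup (om i H) G"
proof (rule subgroupI)
  have car: "x \<in> carrier G" if "x \<in> H" for x using that subgroup.mem_carrier[OF H] by blast
  show "om i H \<subseteq> carrier G" using car by (auto simp: om_def)
  show "om i H \<noteq> {}" using subgroup.one_closed[OF H] by (auto simp: om_def)
  show "inv a \<in> om i H" if "a \<in> om i H" for a
    using that car subgroup.m_inv_closed[OF H] by (auto simp: om_def nat_pow_inv)
  show "a \<otimes> b \<in> om i H" if "a \<in> om i H" "b \<in> om i H" for a b
    using that mult subgroup.m_closed[OF H] by (auto simp: om_def)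
qed

text \<open>Induction on the order of \<open>H\<close>. Unless \<open>H\<close> is cyclic, hence abelian, each \<open>v\<close> in \<open>H\<close> lies
  in the proper powerful subgroup generated by \<open>v\<close> and \<open>pw H\<close>. It contains the conjugates of
  \<open>v\<close>, so by the induction hypothesis the order of \<open>[v, x]\<close> is at most \<open>p^i\<close> if that of \<open>v\<close>
  is (fact \<open>E\<close>).

  The main point is the estimate \<open>Q\<close>: if \<open>s\<close> is in level \<open>b + 1\<close>, has order at most
  \<open>p^(a+1)\<close>, and \<open>v\<close> has order at most \<open>p^(a+b+1)\<close>, then \<open>[s, v]\<close> has order at most \<open>p^a\<close>,
  one factor \<open>p\<close> less than \<open>s\<close>. Write \<open>s = x^p\<close> with \<open>x\<close> in level \<open>b\<close>. Then \<open>[x^p, v]\<close>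
  agrees with \<open>[x, v]^p\<close> up to commutators of higher weight, which are deeper in the chain
  and so are covered by the same estimate for larger \<open>a + b\<close>; the order of \<open>[x, v]\<close> itself
  comes from the estimate for \<open>a + 1\<close> and \<open>b - 1\<close>, or from \<open>E\<close> if \<open>b = 0\<close>.

  By \<open>Q\<close> the power map is multiplicative on elements of order at most \<open>p^i\<close> modulo the
  elements of order at most \<open>p^(i-1)\<close> in \<open>pw H\<close>, a subgroup by the induction hypothesis.\<close>

theorem powerful_om_subgroup:
  assumes "powerful_set H"
  shows "subgroup (om i H) G"
  using assms
proof (induction "card H" arbitrary: H i rule: less_induct)
  case less
  note H = less.prems
  note Hs = powerful_subgroup[OF H]
  have HG: "H \<subseteq> carrier G" using Hs by (rule subgroup.subset)
  have car: "x \<in> carrier G" if "x \<in> H" for x using that HG by blast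
  have IH: "subgroup (om i K) G" if "powerful_set K" "K \<subset> H" for K i
    using less.hyps[of K] that psubset_card_mono[OF finite_subgroup[OF Hs]] by blast
  show ?case
  proof (cases "\<exists>v\<in>H. generate G (insert v (pw H)) = H")
    case True
    then obtain v where v: "v \<in> H" "generate G (insert v (pw H)) = H" by blast
    then have gen: "generate G {v} = H" using pw_superfluous[OF Hs, of "{v}"] by simp
    have "x \<otimes> y = y \<otimes> x" if "x \<in> H" "y \<in> H" for x y
    proof -
      have "comm x y \<in> {\<one>}"
        using comm_generate[OF normal_in_one[OF Hs], of "{v}" "{v}" x y] v(1) gen that car[OF v(1)]
          comm_eq_one_iff[of v v] by auto
      then show ?thesis using car that by (simp add: comm_eq_one_iff)
    qed
    then show ?thesis by (rule commutative_om_subgroup[OF Hs])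
  next
    case False
    let ?H = "\<lambda>k. (pw ^^ k) H"
    let ?O = "\<lambda>a b. om a (?H b)"
    note H1 = powerful_comm[OF H] and nH = powerful_normal[OF H]
    have Hk: "subgroup (?H k) G" "?H k \<subseteq> H" for k using normal_inD[OF nH] by auto
    have anti: "?H j \<subseteq> ?H i" if "i \<le> j" for i j using funpow_pw_antimono[OF Hs that] .
    have "H \<noteq> {\<one>}"
      using False subgroup.one_closed[OF Hs] by (auto simp: generate_one)
    then have "pw H \<subset> H" using pw_psubset[OF Hs] by blast
    then have "subgroup (om a (pw H)) G" for a
      using IH[of "pw H"] powerful_funpow_pw[OF H, of 1] by simp
    then have sO: "subgroup (?O a b) G" if "b \<ge> 1" for a b
    proof -
      have "?O a b = om a (pw H) \<inter> ?H b" using anti[OF that] by (auto simp: om_def)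
      then show ?thesis using \<open>\<And>a. subgroup (om a (pw H)) G\<close> Hk by (simp add: subgroups_Inter_pair)
    qed
    have nO: "normal_in (?O a b) H" if "b \<ge> 1" for a b using normal_in_om[OF nH sO[OF that]] .
    have E: "comm v x \<in> ?O i 1" "comm x v \<in> ?O i 1" if v: "v \<in> om i H" and x: "x \<in> H" for v x i
    proof -
      have vH: "v \<in> H" using v by (simp add: om_def)
      let ?K = "generate G (insert v (pw H))"
      have pK: "powerful_set ?K" using powerful_generate_insert_pw[OF H vH] .
      note K = powerful_subgroup[OF pK]
      have "?K \<subset> H" using False vH generate_subgroup_incl[OF _ Hs, of "insert v (pw H)"] pw_subset[OF Hs] by blast
      then have oK: "subgroup (om i ?K) G" using IH[OF pK] by blast
      have c: "comm v x \<in> pw H" using H1[of v 0 x] vH x by simp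
      have vK: "v \<in> ?K" "comm v x \<in> ?K" using c by (auto intro: generate.incl)
      then have "v \<otimes> comm v x \<in> ?K" using subgroup.m_closed[OF K] by blast
      moreover have "(v \<otimes> comm v x) [^] (p ^ i) = \<one>"
        using om_conj[OF HG v car[OF x]] conj_eq_mult_comm[OF car[OF vH] car[OF x]] by simp
      ultimately have "v \<otimes> comm v x \<in> om i ?K" "v \<in> om i ?K"
        using v vK by (auto simp: om_def)
      then have "inv v \<otimes> (v \<otimes> comm v x) \<in> om i ?K"
        using oK by (simp add: subgroup.m_closed subgroup.m_inv_closed)
      then have "comm v x \<in> om i ?K" using car[OF vH] car[OF x] by simp
      then show 1: "comm v x \<in> ?O i 1" using c by (simp add: om_def)
      show "comm x v \<in> ?O i 1"
        using subgroup.m_inv_closed[OF sO 1] car[OF vH] car[OF x] by (simp add: inv_commutator)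
    qed
    \<comment> \<open>The chain is trivial from level \<open>e\<close> on, which starts the descending induction on \<open>a +
      b\<close>. The measure orders pairs lexicographically: first by decreasing \<open>a + b\<close>, then by
      increasing \<open>b\<close>.\<close>
    obtain e where e: "\<And>k. k \<ge> e \<Longrightarrow> ?H k = {\<one>}" using funpow_pw_trivial[OF Hs] by blast
    have Q: "comm s v [^] (p ^ a) = \<one>"
      if "s \<in> ?O (Suc a) (Suc b)" "v \<in> om (Suc (a + b)) H" for s v a b
      using that
    proof (induction "(e - (a + b)) * (e + 1) + b" arbitrary: s v a b rule: less_induct)
      case (less a b s v)
      note s = less.prems(1) and v = less.prems(2)
      have sH: "s \<in> ?H (Suc b)" and vH: "v \<in> H" using s v by (auto simp: om_def)
      have sv: "comm s v \<in> ?H (Suc (Suc b))" using H1[OF sH vH] .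
      show ?case
      proof (cases "a + b < e")
        case False
        then have "?H (Suc (Suc b) + a) = {\<one>}" by (intro e) simp
        then show ?thesis using pow_in_funpow_pw[OF HG sv, of a] by simp
      next
        case True
        obtain x where x: "x \<in> ?H b" "s = x [^] p"
          using powerful_root[OF H, of s b 1] sH by auto
        have xH: "x \<in> H" using x Hk by blast
        have xs: "x [^] (p ^ Suc (Suc a)) = \<one>"
          using s x(2) car[OF xH] by (simp add: om_def nat_pow_pow)
        let ?r = "comm x v" let ?z = "comm ?r x" let ?N = "?O a 1"
        have r: "?r \<in> ?O (Suc a) (Suc b)"
        proof (cases b)
          case 0
          then show ?thesis using E(2)[of v "Suc a" x] v xH by simp
        next
          case (Suc b')
          have "?r [^] (p ^ Suc a) = \<one>"
          proof (rule less.hyps)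
            show "(e - (Suc a + b')) * (e + 1) + b' < (e - (a + b)) * (e + 1) + b" using Suc by simp
            show "x \<in> ?O (Suc (Suc a)) (Suc b')" using x xs Suc by (simp add: om_def)
            show "v \<in> om (Suc (Suc a + b')) H" using v Suc by simp
          qed
          then show ?thesis using H1[OF x(1) vH] by (simp add: om_def)
        qed
        have rH: "?r \<in> H" using r Hk(2)[of "Suc b"] unfolding om_def by blast
        have z: "?z \<in> ?O (Suc a) (Suc (Suc b))"
          using normal_inD(4)[OF nO r xH] H1[of ?r "Suc b" x] r xH by (simp add: om_def)
        have zH: "?z \<in> H" using z Hk(2)[of "Suc (Suc b)"] unfolding om_def by blast
        have IHz: "comm ?z w \<in> ?N" if w: "w \<in> om (Suc (Suc (a + b))) H" for w
        proof -
          have wH: "w \<in> H" using w by (simp add: om_def)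
          have "comm ?z w [^] (p ^ a) = \<one>"
          proof (rule less.hyps)
            have "e - (a + b) = Suc (e - (a + Suc b))" using True by simp
            then show "(e - (a + Suc b)) * (e + 1) + Suc b < (e - (a + b)) * (e + 1) + b" using True by simp
            show "?z \<in> ?O (Suc a) (Suc (Suc b))" by (rule z)
            show "w \<in> om (Suc (a + Suc b)) H" using w by simp
          qed
          moreover have "comm ?z w \<in> ?H (Suc (Suc (Suc b)))" using H1[of ?z "Suc (Suc b)" w] z wH by (simp add: om_def)
          then have "comm ?z w \<in> ?H 1" using anti[of 1 "Suc (Suc (Suc b))"] by auto
          ultimately show ?thesis by (simp add: om_def)
        qed
        have xo: "x \<in> om (Suc (Suc (a + b))) H"
          using om_mono_exponent[OF HG, of "Suc (Suc a)" "Suc (Suc (a + b))"] xs xH by (auto simp: om_def)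
        have ro: "?r \<in> om (Suc (Suc (a + b))) H"
          using om_mono_exponent[OF HG, of "Suc a" "Suc (Suc (a + b))"] r rH by (auto simp: om_def)
        have powN: "w [^] p \<in> ?N" if w: "w \<in> ?O (Suc a) (Suc k)" for w k
        proof -
          have "w \<in> ?H (Suc k)" "w \<in> H" using w Hk(2)[of "Suc k"] unfolding om_def by blast+
          then have "w [^] p \<in> ?H 1" using pow_in_pw[of w H] by simp
          then show ?thesis using w car[OF \<open>w \<in> H\<close>] by (simp add: om_def nat_pow_pow)
        qed
        note nN = nO[OF order_refl, of a]
        have "cgr ?N ((x \<otimes> ?r) [^] p) (x [^] p \<otimes> ?r [^] p)"
          using IHz[OF xo] IHz[OF ro] powN[OF z] by (rule power_of_product_class_2_mod[OF nN xH rH])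
        then have "cgr ?N (comm s v) (?r [^] p)"
          using car[OF xH] car[OF vH] by (simp add: pow_mult_comm cgr_cancel_left x(2))
        moreover have "comm s v \<in> carrier G" "?r [^] p \<in> carrier G" using x(2) car[OF xH] car[OF vH] by auto
        ultimately have "comm s v \<in> ?N"
          using cgr_member[OF normal_inD(1)[OF nN] order_refl] powN[OF r] by blast
        then show ?thesis by (simp add: om_def)
      qed
    qed
    show ?thesis
    proof (cases i)
      case 0
      then have "om i H = {\<one>}" using subgroup.one_closed[OF Hs] car by (auto simp: om_def)
      then show ?thesis by (simp add: triv_subgroup)
    next
      case (Suc a)
      let ?N = "?O a 1"
      note nN = nO[OF order_refl, of a]
      have powN: "w [^] p \<in> ?N" if "w \<in> om (Suc a) H" for w
        using that pow_in_pw[of w H] car by (simp add: om_def nat_pow_pow)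
      show ?thesis
      proof (rule om_closed_mult_imp_subgroup[OF Hs])
        fix x y assume x: "x \<in> om i H" and y: "y \<in> om i H"
        have xy: "x \<in> H" "y \<in> H" using x y by (auto simp: om_def)
        let ?c = "comm y x"
        have c: "?c \<in> ?O (Suc a) (Suc 0)" using E(1)[of y i x] y xy(1) Suc by simp
        have cH: "?c \<in> H" using c Hk(2)[of "Suc 0"] unfolding om_def by blast
        have cN: "comm ?c w \<in> ?N" if w: "w \<in> om i H" for w
        proof -
          have "comm ?c w [^] (p ^ a) = \<one>" using Q[OF c, of w] w Suc by simp
          moreover have "comm ?c w \<in> ?H (Suc (Suc 0))" using H1[of ?c "Suc 0" w] c w by (simp add: om_def)
          then have "comm ?c w \<in> ?H 1" using anti[of 1 "Suc (Suc 0)"] by auto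
          ultimately show ?thesis by (simp add: om_def)
        qed
        have "cgr ?N ((x \<otimes> y) [^] p) (x [^] p \<otimes> y [^] p)"
        proof (rule power_of_product_class_2_mod[OF nN xy])
          show "comm ?c x \<in> ?N" "comm ?c y \<in> ?N" using cN x y by auto
          show "?c [^] p \<in> ?N" using powN[of ?c] c cH by (simp add: om_def)
        qed
        moreover have "x [^] p \<otimes> y [^] p \<in> ?N"
          using powN x y Suc subgroup.m_closed[OF normal_inD(1)[OF nN]] by simp
        ultimately have "(x \<otimes> y) [^] p \<in> ?N"
          using cgr_member[OF normal_inD(1)[OF nN] order_refl, of "(x \<otimes> y) [^] p" "x [^] p \<otimes> y [^] p"]
            car[OF xy(1)] car[OF xy(2)] by simp
        then show "(x \<otimes> y) [^] (p ^ i) = \<one>"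
          using car[OF xy(1)] car[OF xy(2)] by (simp add: om_def nat_pow_pow Suc)
      qed
    qed
  qed
qed

end

context p_group
begin

lemma maximal_subgroupD:
  assumes "maximal_subgroup M G"
  shows "subgroup M G" "M \<subset> carrier G" "normal_in M (carrier G)"
    "x \<in> carrier G \<Longrightarrow> x [^] p \<in> M"
    "x \<in> carrier G \<Longrightarrow> y \<in> carrier G \<Longrightarrow> comm x y \<in> M"
proof -
  show M: "subgroup M G" "M \<subset> carrier G"
    using assms subgroup.subset[of M G] by (auto simp: maximal_subgroup_def)
  have "L = M" if "subgroup L G" "M \<subseteq> L" "L \<subset> carrier G" for L
    using assms that by (auto simp: maximal_subgroup_def)
  note max = maximal_imp_normal[OF M(1) subgroup_self M(2) this]
  show "normal_in M (carrier G)" "x \<in> carrier G \<Longrightarrow> x [^] p \<in> M"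
    "x \<in> carrier G \<Longrightarrow> y \<in> carrier G \<Longrightarrow> comm x y \<in> M"
    using max by blast+
qed

lemma proper_subgroup_in_maximal_subgroup:
  assumes "subgroup D G" "D \<noteq> carrier G"
  obtains M where "maximal_subgroup M G" "D \<subseteq> M"
proof -
  have "D \<subset> carrier G" using assms subgroup.subset by blast
  then obtain M where M: "subgroup M G" "D \<subseteq> M" "M \<subset> carrier G"
    "\<And>L. subgroup L G \<Longrightarrow> M \<subseteq> L \<Longrightarrow> L \<subset> carrier G \<Longrightarrow> L = M"
    using maximal_subgroup_between[OF assms(1) subgroup_self] by metis
  have "maximal_subgroup M G"
    unfolding maximal_subgroup_def
  proof (intro conjI allI impI)
    show "subgroup M G" "M \<noteq> carrier G" using M by auto
    show "K = M \<or> K = carrier G" if "subgroup K G \<and> M \<subseteq> K" for K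
      using M(4)[of K] that subgroup.subset[of K G] by blast
  qed
  then show thesis using that M(2) by blast
qed

lemma noncommutative_maximal_containing:
  assumes nc: "u \<in> carrier G" "v \<in> carrier G" "comm u v \<noteq> \<one>" and x: "x \<in> carrier G"
  obtains M where "maximal_subgroup M G" "x \<in> M"
proof -
  have "generate G {x} \<noteq> carrier G"
  proof
    assume gen: "generate G {x} = carrier G"
    have "comm u v \<in> {\<one>}"
      using comm_generate[OF normal_in_one[OF subgroup_self], of "{x}" "{x}" u v] gen nc x
        comm_eq_one_iff[of x x] by auto
    then show False using nc by simp
  qed
  then obtain M where "maximal_subgroup M G" "generate G {x} \<subseteq> M"
    using proper_subgroup_in_maximal_subgroup[of "generate G {x}"] generate_is_subgroup x by auto
  then show thesis using that by (auto intro: generate.incl)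
qed

text \<open>Double counting: every element is congruent modulo \<open>D\<close> to exactly \<open>card D\<close> elements \<open>z\<close>.
  This avoids choosing representatives of the cosets.\<close>

lemma card_cgr_sum:
  assumes D: "subgroup D G" and W: "W \<subseteq> carrier G"
  shows "(\<Sum>z\<in>carrier G. card {w \<in> W. cgr D w z}) = card W * card D"
proof -
  have DG: "D \<subseteq> carrier G" using D by (rule subgroup.subset)
  have fW: "finite W" using W finite_carrier by (rule finite_subset)
  have "card {z \<in> carrier G. cgr D w z} = card D" if w: "w \<in> carrier G" for w
  proof (rule bij_betw_same_card[symmetric])
    show "bij_betw (\<lambda>d. w \<otimes> d) D {z \<in> carrier G. cgr D w z}"
    proof (rule bij_betwI[where g = "\<lambda>z. inv w \<otimes> z"])
      show "(\<lambda>d. w \<otimes> d) \<in> D \<rightarrow> {z \<in> carrier G. cgr D w z}"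
        using w DG subgroup.m_inv_closed[OF D]
        by (auto simp: cgr_def inv_mult_group m_assoc subset_iff)
      show "(\<lambda>z. inv w \<otimes> z) \<in> {z \<in> carrier G. cgr D w z} \<rightarrow> D"
      proof
        fix z assume z: "z \<in> {z \<in> carrier G. cgr D w z}"
        then have "cgr D z w" using cgr_sym[OF D w] by simp
        then show "inv w \<otimes> z \<in> D" by (simp add: cgr_def)
      qed
    qed (use w DG in auto)
  qed
  then have "(\<Sum>w\<in>W. card {z \<in> carrier G. cgr D w z}) = card W * card D"
    using W by (simp add: subset_iff)
  moreover have "(\<Sum>z\<in>carrier G. card {w \<in> W. cgr D w z}) = (\<Sum>w\<in>W. card {z \<in> carrier G. cgr D w z})"
    unfolding card_eq_sum by (rule sum.swap_restrict[OF finite_carrier fW])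
  ultimately show ?thesis by simp
qed

end

section \<open>Nonpowerful groups whose maximal subgroups are powerful\<close>

locale nonpowerful_M1_group = odd_p_group +
  assumes powerful_maximal: "\<And>M. maximal_subgroup M G \<Longrightarrow> powerful_set M"
    and not_powerful: "\<not> powerful_set (carrier G)"
begin

text \<open>The Frattini subgroup, described by its generators: a maximal subgroup of a \<open>p\<close>-group is
  normal of index \<open>p\<close>.\<close>

definition Phi :: "'a set" where
  "Phi = generate G ({comm x y | x y. x \<in> carrier G \<and> y \<in> carrier G} \<union> pw (carrier G))"

lemma pwG_subgroup: "subgroup (pw (carrier G)) G" by simp

lemma pwG_carrier: "pw (carrier G) \<subseteq> carrier G" using subgroup.subset[OF pwG_subgroup] .

lemma maximal_containing:
  assumes "x \<in> carrier G"
  obtains M where "maximal_subgroup M G" "x \<in> M"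
proof -
  obtain u v where uv: "u \<in> carrier G" "v \<in> carrier G" "comm u v \<notin> pw (carrier G)"
    using not_powerful subgroup_self by (auto simp: powerful_set_def)
  then have "comm u v \<noteq> \<one>" using subgroup.one_closed[OF pwG_subgroup] by auto
  then show thesis using noncommutative_maximal_containing[OF uv(1,2) _ assms] that by blast
qed

lemma Phi_in_maximal:
  assumes M: "maximal_subgroup M G"
  shows "Phi \<subseteq> M" "pw (carrier G) \<subseteq> M"
proof -
  note m = maximal_subgroupD[OF M]
  show "pw (carrier G) \<subseteq> M" unfolding pw_def using m(4) by (intro generate_subgroup_incl[OF _ m(1)]) auto
  then show "Phi \<subseteq> M" unfolding Phi_def using m(5) by (intro generate_subgroup_incl[OF _ m(1)]) auto
qed

lemma Phi_subgroup: "subgroup Phi G"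
  unfolding Phi_def using pwG_carrier by (intro generate_is_subgroup) auto

lemma Phi_carrier: "Phi \<subseteq> carrier G" using subgroup.subset[OF Phi_subgroup] .

lemma comm_in_Phi: "x \<in> carrier G \<Longrightarrow> y \<in> carrier G \<Longrightarrow> comm x y \<in> Phi"
  unfolding Phi_def by (rule generate.incl) blast

lemma pwG_in_Phi: "pw (carrier G) \<subseteq> Phi"
  unfolding Phi_def by (auto intro: generate.incl)

lemma normal_pwG: "normal_in (pw (carrier G)) (carrier G)"
  by (rule normal_in_pw[OF normal_in_self[OF subgroup_self]])

lemma normal_Phi: "normal_in Phi (carrier G)"
  unfolding normal_in_def using Phi_subgroup subgroup_self Phi_carrier comm_in_Phi by blast

lemma pw_maximal_subset:
  assumes M: "maximal_subgroup M G"
  shows "pw M \<subseteq> pw (carrier G)" "pw M \<subseteq> Phi" "pw (pw M) \<subseteq> pw (pw (carrier G))" "pw (pw M) \<subseteq> pw Phi"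
proof -
  show 1: "pw M \<subseteq> pw (carrier G)" using maximal_subgroupD(2)[OF M] by (intro pw_mono) auto
  then show 2: "pw M \<subseteq> Phi" using pwG_in_Phi by blast
  show "pw (pw M) \<subseteq> pw (pw (carrier G))" "pw (pw M) \<subseteq> pw Phi" using 1 2 by (simp_all add: pw_mono)
qed

text \<open>Every \<open>g\<close> lies in some maximal subgroup, which contains \<open>Phi\<close> and is powerful. Covering
  the group by maximal subgroups in this way is possible because it is not cyclic.\<close>

lemma comm_Phi_in_pwG:
  assumes "f \<in> Phi" "g \<in> carrier G"
  shows "comm f g \<in> pw (carrier G)"
proof -
  obtain M where M: "maximal_subgroup M G" "g \<in> M" using maximal_containing assms(2) by blast
  then have "comm f g \<in> pw M"
    using powerful_maximal[OF M(1)] Phi_in_maximal(1)[OF M(1)] assms(1) by (auto simp: powerful_set_def)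
  then show ?thesis using pw_maximal_subset(1)[OF M(1)] by blast
qed

text \<open>Otherwise both elements would lie in a common maximal subgroup, which is powerful.\<close>

lemma generate_pair:
  assumes "x \<in> carrier G" "y \<in> carrier G" "comm x y \<notin> pw (carrier G)"
  shows "generate G {x, y} = carrier G"
proof (rule ccontr)
  assume "generate G {x, y} \<noteq> carrier G"
  then obtain M where M: "maximal_subgroup M G" "generate G {x, y} \<subseteq> M"
    using proper_subgroup_in_maximal_subgroup[of "generate G {x, y}"] generate_is_subgroup assms by auto
  then have "x \<in> M" "y \<in> M" by (auto intro: generate.incl)
  then have "comm x y \<in> pw M" using powerful_maximal[OF M(1)] by (auto simp: powerful_set_def)
  then show False using assms pw_maximal_subset(1)[OF M(1)] by blast
qed

lemma Phi_eq_generate: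
  assumes xy: "x \<in> carrier G" "y \<in> carrier G" and c: "comm x y \<notin> pw (carrier G)"
  shows "Phi = generate G (insert (comm x y) (pw (carrier G)))" (is "_ = ?N")
proof
  have cG: "comm x y \<in> carrier G" using xy by simp
  have nN: "normal_in ?N (carrier G)"
    using comm_Phi_in_pwG[OF comm_in_Phi[OF xy]] by (intro normal_in_generate_insert[OF normal_pwG cG])
  note N = normal_inD(1)[OF nN]
  have cN: "comm x y \<in> ?N" by (auto intro: generate.incl)
  then have "comm y x \<in> ?N" using subgroup.m_inv_closed[OF N cN] xy by (simp add: inv_commutator)
  moreover have "comm x x = \<one>" "comm y y = \<one>" using xy by (simp_all add: comm_eq_one_iff)
  ultimately have "comm a b \<in> ?N" if "a \<in> {x, y}" "b \<in> {x, y}" for a b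
    using that cN subgroup.one_closed[OF N] by auto
  then have "comm u v \<in> ?N" if "u \<in> carrier G" "v \<in> carrier G" for u v
    using comm_generate[OF nN, of "{x, y}" "{x, y}" u v] generate_pair[OF assms] that xy by blast
  moreover have "pw (carrier G) \<subseteq> ?N" by (auto intro: generate.incl)
  ultimately show "Phi \<subseteq> ?N" unfolding Phi_def by (intro generate_subgroup_incl[OF _ N]) auto
  show "?N \<subseteq> Phi" using comm_in_Phi[OF xy] pwG_in_Phi by (intro generate_subgroup_incl[OF _ Phi_subgroup]) auto
qed

lemma noncommuting_pair:
  obtains x y where "x \<in> carrier G" "y \<in> carrier G" "comm x y \<notin> pw (carrier G)"
  using not_powerful subgroup_self by (auto simp: powerful_set_def)

lemma normal_pw_pwG: "normal_in (pw (pw (carrier G))) (carrier G)"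
  by (rule normal_in_pw[OF normal_pwG])

lemma normal_pw_Phi: "normal_in (pw Phi) (carrier G)"
  by (rule normal_in_pw[OF normal_Phi])

lemma pw_pwG_in_pw_Phi: "pw (pw (carrier G)) \<subseteq> pw Phi"
  by (rule pw_mono[OF pwG_in_Phi])

lemma pw_Phi_in_pwG: "pw Phi \<subseteq> pw (carrier G)"
  by (rule pw_mono[OF Phi_carrier])

lemma comm_pwG_Phi:
  assumes u: "u \<in> pw (carrier G)" and f: "f \<in> Phi"
  shows "comm u f \<in> pw (pw (carrier G))"
proof (rule comm_generate_left[OF normal_pw_pwG _ _ _ u[unfolded pw_def]])
  show "f \<in> carrier G" using f Phi_carrier by blast
  fix a assume "a \<in> {h [^] p | h. h \<in> carrier G}"
  then obtain g where g: "g \<in> carrier G" "a = g [^] p" by blast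
  obtain M where M: "maximal_subgroup M G" "g \<in> M" using maximal_containing g(1) by blast
  have "a \<in> (pw ^^ 1) M" using pow_in_pw[OF M(2)] g(2) by simp
  then have "comm a f \<in> pw (pw M)"
    using powerful_comm[OF powerful_maximal[OF M(1)], of a 1 f] Phi_in_maximal(1)[OF M(1)] f by auto
  then show "comm a f \<in> pw (pw (carrier G))" using pw_maximal_subset(3)[OF M(1)] by blast
qed auto

text \<open>Modulo \<open>pw (pw G)\<close> the subgroup \<open>pw G\<close> commutes with \<open>Phi\<close>, and \<open>Phi\<close> is generated by \<open>pw
  G\<close> and a single further element.\<close>

lemma comm_Phi_Phi:
  assumes "f \<in> Phi" "f' \<in> Phi"
  shows "comm f f' \<in> pw (pw (carrier G))"
proof -
  obtain x y where xy: "x \<in> carrier G" "y \<in> carrier G" "comm x y \<notin> pw (carrier G)"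
    using noncommuting_pair .
  let ?c = "comm x y"
  have cG: "?c \<in> carrier G" and cP: "?c \<in> Phi" using xy comm_in_Phi by auto
  have sub: "insert ?c (pw (carrier G)) \<subseteq> carrier G" using cG pwG_carrier by auto
  have "comm a b \<in> pw (pw (carrier G))"
    if a: "a \<in> insert ?c (pw (carrier G))" and b: "b \<in> insert ?c (pw (carrier G))" for a b
  proof (cases "a \<in> pw (carrier G)")
    case True
    then show ?thesis using comm_pwG_Phi b cP pwG_in_Phi by blast
  next
    case False
    then have a: "a = ?c" using a by blast
    show ?thesis
    proof (cases "b \<in> pw (carrier G)")
      case True
      then have "comm b ?c \<in> pw (pw (carrier G))" using comm_pwG_Phi cP by blast
      then have "inv (comm b ?c) \<in> pw (pw (carrier G))"
        using subgroup.m_inv_closed[OF normal_inD(1)[OF normal_pw_pwG]] by blast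
      then show ?thesis using a cG subgroup.mem_carrier[OF pwG_subgroup True] by (simp add: inv_commutator)
    next
      case False
      then have "b = ?c" using b by blast
      then show ?thesis using a cG comm_eq_one_iff[of ?c ?c]
          subgroup.one_closed[OF normal_inD(1)[OF normal_pw_pwG]] by simp
    qed
  qed
  then show ?thesis
    using comm_generate[OF normal_pw_pwG sub sub] assms Phi_eq_generate[OF xy] by blast
qed

lemma powerful_Phi: "powerful_set Phi"
  using comm_Phi_Phi Phi_subgroup pw_pwG_in_pw_Phi by (auto simp: powerful_set_def)

lemma powerful_pwG: "powerful_set (pw (carrier G))"
  using comm_Phi_Phi pwG_in_Phi by (auto simp: powerful_set_def)

text \<open>The commutator of \<open>g^p\<close> with \<open>y\<close> agrees with \<open>[g, y]^p\<close> modulo \<open>pw (pw M)\<close> for a maximal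
  subgroup \<open>M\<close> that contains \<open>g\<close>, and \<open>[g, y]\<close> lies in \<open>Phi\<close>.\<close>

lemma comm_pwG:
  assumes u: "u \<in> pw (carrier G)" and y: "y \<in> carrier G"
  shows "comm u y \<in> pw Phi"
proof (rule comm_generate_left[OF normal_pw_Phi _ y _ u[unfolded pw_def]])
  fix a assume "a \<in> {h [^] p | h. h \<in> carrier G}"
  then obtain g where g: "g \<in> carrier G" "a = g [^] p" by blast
  obtain M where M: "maximal_subgroup M G" "g \<in> M" using maximal_containing g(1) by blast
  let ?c = "comm g y"
  have c: "?c \<in> Phi" "?c \<in> carrier G" using comm_in_Phi g(1) y by auto
  have "cgr (pw (pw M)) ((g \<otimes> ?c) [^] p) (g [^] p \<otimes> ?c [^] p)"
    using powerful_pow_mult[OF powerful_maximal[OF M(1)] M(2), of ?c 0] c Phi_in_maximal(1)[OF M(1)] by auto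
  then have "cgr (pw (pw M)) (comm a y) (?c [^] p)"
    using g y c by (simp add: pow_mult_comm cgr_cancel_left)
  then have "cgr (pw Phi) (comm a y) (?c [^] p)" using pw_maximal_subset(4)[OF M(1)] cgr_mono by blast
  then show "comm a y \<in> pw Phi"
    using cgr_member[OF normal_inD(1)[OF normal_pw_Phi] order_refl] pow_in_pw[OF c(1)] g y c
    by (meson comm_closed nat_pow_closed)
qed auto

text \<open>The dividing line between the regular groups and the exceptional one.\<close>

definition multiplicative_mod_Phi :: bool where
  "multiplicative_mod_Phi \<longleftrightarrow> (\<forall>x\<in>carrier G. \<forall>y\<in>carrier G.
     cgr (pw Phi) ((x \<otimes> y) [^] p) (x [^] p \<otimes> y [^] p))"

lemma comm_of_Phi:
  assumes "x \<in> carrier G" "y \<in> carrier G" "f \<in> Phi"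
  shows "comm (comm f x) y \<in> pw Phi"
  using comm_pwG[OF comm_Phi_in_pwG[OF assms(3,1)] assms(2)] .

text \<open>Commutators of weight four vanish modulo \<open>pw Phi\<close>, so that the class three formula
  applies.\<close>

lemma multiplicative_if_not_3:
  assumes "p \<noteq> 3"
  shows multiplicative_mod_Phi
  unfolding multiplicative_mod_Phi_def
proof (intro ballI power_of_product_class_3_mod[OF assms normal_pw_Phi])
  fix x y assume xy: "x \<in> carrier G" "y \<in> carrier G"
  have c: "comm y x \<in> Phi" using comm_in_Phi xy by blast
  show "comm (comm (comm y x) x) x \<in> pw Phi" "comm (comm (comm y x) x) y \<in> pw Phi"
    "comm (comm (comm y x) y) x \<in> pw Phi" "comm (comm (comm y x) y) y \<in> pw Phi"
    using comm_of_Phi xy c by blast+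
  show "comm y x [^] p \<in> pw Phi" using pow_in_pw[OF c] .
  show "comm (comm y x) x [^] p \<in> pw Phi" "comm (comm y x) y [^] p \<in> pw Phi"
    using comm_Phi_in_pwG[OF c] xy pow_in_pw pw_pwG_in_pw_Phi by blast+
qed auto

lemma multiplicative_if_Phi_central:
  assumes "\<And>f g. f \<in> Phi \<Longrightarrow> g \<in> carrier G \<Longrightarrow> comm f g \<in> pw Phi"
  shows multiplicative_mod_Phi
  unfolding multiplicative_mod_Phi_def
  using assms comm_in_Phi pow_in_pw
  by (intro ballI power_of_product_class_2_mod[OF normal_pw_Phi]) auto

text \<open>The coset of \<open>z\<close> lies in a maximal subgroup \<open>M\<close>, which is powerful, and the translation
  argument for \<open>M\<close> applies. In the first step \<open>Phi\<close> takes the place of \<open>M\<close>, so that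
  translations preserve the coset; accordingly the chain starts with \<open>pw Phi\<close> and goes on
  with the iterates of \<open>pw\<close> at \<open>M\<close> from the second on, which lie below \<open>pw Phi\<close>.\<close>

lemma neutral_coset:
  assumes z: "z \<in> carrier G"
  shows "neutral p {w \<in> carrier G. cgr Phi w z} (pw Phi)"
proof -
  obtain M where M: "maximal_subgroup M G" "z \<in> M" using maximal_containing z by blast
  let ?D = "{w \<in> carrier G. cgr Phi w z}"
  let ?M = "\<lambda>k. (pw ^^ k) M"
  let ?S = "\<lambda>k. if k = 0 then pw Phi else ?M (Suc k)" and ?T = "\<lambda>k. if k = 0 then Phi else ?M k"
  have pM: "powerful_set M" using powerful_maximal[OF M(1)] .
  note Ms = powerful_subgroup[OF pM] and PM = Phi_in_maximal(1)[OF M(1)]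
  have Mk: "subgroup (?M k) G" "?M k \<subseteq> M" "?M k \<subseteq> carrier G" for k
    using normal_inD(1,3)[OF powerful_normal[OF pM, of k]] subgroup.subset[of "?M k" G] by blast+
  have anti: "?M j \<subseteq> ?M i" if "i \<le> j" for i j using funpow_pw_antimono[OF Ms that] .
  have MkPhi: "?M k \<subseteq> Phi" if "k \<noteq> 0" for k
    using anti[of 1 k] that pw_maximal_subset(2)[OF M(1)] by auto
  have M2: "?M (Suc (Suc 0)) \<subseteq> pw Phi" using pw_maximal_subset(4)[OF M(1)] by simp
  have DM: "w \<in> M" if "w \<in> ?D" for w
    using cgr_member[OF Ms PM _ _ _ M(2)] that z by blast
  obtain n where n: "\<And>k. k \<ge> n \<Longrightarrow> ?M k = {\<one>}" using funpow_pw_trivial[OF Ms] by blast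
  have TM: "?T k \<subseteq> ?M k" "?T k \<subseteq> Phi" for k using PM MkPhi[of k] by auto
  have "neutral p ?D (?S 0)"
  proof (rule neutral_chain[where T = ?T and S = ?S and n = "Suc n"])
    show "finite ?D" "?D \<subseteq> carrier G" by auto
    show "finite (?S k)" for k using finite_subgroup[OF Mk(1)[of "Suc k"]] finite_subgroup[OF normal_inD(1)[OF normal_pw_Phi]] by auto
    show "?S (Suc n) = {\<one>}" using n[of "Suc (Suc n)"] by simp
    show "?T k \<subseteq> carrier G" for k using Mk(3) Phi_carrier by auto
    show "normal_in (?S (Suc k)) (?S k)" for k
    proof -
      have "normal_in (?M (Suc (Suc k))) M" using powerful_normal[OF pM] .
      moreover have "subgroup (?S k) G" "?S k \<subseteq> M"
        using Mk(1,2)[of "Suc k"] normal_inD(1)[OF normal_pw_Phi] pw_subset[OF Phi_subgroup] PM by auto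
      moreover have "?M (Suc (Suc k)) \<subseteq> ?S k"
        using M2 anti[of "Suc k" "Suc (Suc k)"] by (cases k) (simp_all del: funpow.simps)
      ultimately show ?thesis using normal_in_subset by (simp del: funpow.simps)
    qed
    show "w \<otimes> c \<in> ?D \<and> cgr (?S (Suc k)) ((w \<otimes> c) [^] p) (w [^] p \<otimes> c [^] p)"
      if w: "w \<in> ?D" and c: "c \<in> ?T k" for k w c
    proof
      have cP: "c \<in> Phi" "c \<in> ?M k" using c TM by blast+
      have cG: "c \<in> carrier G" using cP Phi_carrier by blast
      have "cgr Phi (w \<otimes> c) w" using cgr_mult_right[OF _ cP(1) Phi_carrier] w by simp
      then show "w \<otimes> c \<in> ?D" using cgr_trans[OF Phi_subgroup _ _ z, of "w \<otimes> c" w] w cG by simp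
      show "cgr (?S (Suc k)) ((w \<otimes> c) [^] p) (w [^] p \<otimes> c [^] p)"
        using powerful_pow_mult[OF pM DM[OF w] cP(2)] by simp
    qed
    show "\<exists>c\<in>?T k. cgr (?S (Suc k)) (c [^] p) s" if s: "s \<in> ?S k" for k s
    proof (cases k)
      case 0
      then have "s \<in> pw Phi" using s by simp
      then obtain c where c: "c \<in> Phi" "s = c [^] p"
        using uniform_root[OF powerful_uniform[OF powerful_Phi] Phi_subgroup] by blast
      have "s \<in> carrier G" using c Phi_carrier by auto
      then have "cgr (?M (Suc (Suc 0))) (c [^] p) s" using c(2) cgr_refl[OF Mk(1)] by blast
      then show ?thesis using c 0 by auto
    next
      case (Suc j)
      then show ?thesis using powerful_root_mod[OF pM, of s k] s by auto
    qed
  qed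
  then show ?thesis by simp
qed

text \<open>The fibres over the whole group are the disjoint unions of those over the cosets of \<open>Phi\<close>.\<close>

lemma neutral_pw_Phi: "neutral p (carrier G) (pw Phi)"
  unfolding neutral_def
proof (intro ballI)
  fix b s assume b: "b \<in> carrier G" and s: "s \<in> pw Phi"
  let ?W = "\<lambda>b. {w \<in> carrier G. w [^] p = b}"
  have eq: "{w \<in> ?W b. cgr Phi w z} = {w \<in> {w \<in> carrier G. cgr Phi w z}. w [^] p = b}" for b z by auto
  have "card {w \<in> ?W b. cgr Phi w z} = card {w \<in> ?W (b \<otimes> s). cgr Phi w z}" if "z \<in> carrier G" for z
    unfolding eq using neutral_coset[OF that] b s by (auto simp: neutral_def)
  then have "(\<Sum>z\<in>carrier G. card {w \<in> ?W b. cgr Phi w z}) = (\<Sum>z\<in>carrier G. card {w \<in> ?W (b \<otimes> s). cgr Phi w z})"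
    by (rule sum.cong[OF HOL.refl])
  then have "card (?W b) * card Phi = card (?W (b \<otimes> s)) * card Phi"
    using card_cgr_sum[OF Phi_subgroup, of "?W b"] card_cgr_sum[OF Phi_subgroup, of "?W (b \<otimes> s)"] by auto
  moreover have "card Phi \<noteq> 0"
    using finite_subgroup[OF Phi_subgroup] subgroup.one_closed[OF Phi_subgroup] by auto
  ultimately show "card (?W b) = card (?W (b \<otimes> s))" by simp
qed

text \<open>Elements of \<open>pw G\<close> are \<open>p\<close>-th powers modulo \<open>pw Phi\<close>, and translating by a root shifts all
  powers by the same element modulo \<open>pw Phi\<close>.\<close>

theorem uniform_carrier:
  assumes mult: multiplicative_mod_Phi
  shows "uniform (carrier G)"
proof (rule neutral_imp_uniform[OF subgroup_self])
  note nP = normal_pw_Phi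
  show "neutral p (carrier G) (pw (carrier G))"
  proof (rule neutral_step[OF _ _ _ _ neutral_pw_Phi])
    show "normal_in (pw Phi) (pw (carrier G))"
      using normal_in_subset[OF nP pwG_subgroup pw_Phi_in_pwG pwG_carrier] .
    show "finite (pw Phi)" using finite_subgroup[OF normal_inD(1)[OF nP]] .
    fix s assume s: "s \<in> pw (carrier G)"
    have "\<exists>c\<in>carrier G. cgr (pw Phi) (c [^] p) s"
      using mult by (intro root_mod[OF nP subgroup_self order_refl _ s]) (auto simp: multiplicative_mod_Phi_def)
    then obtain c where c: "c \<in> carrier G" "cgr (pw Phi) (c [^] p) s" by blast
    have sG: "s \<in> carrier G" using s pwG_carrier by blast
    have "cgr (pw Phi) ((z \<otimes> c) [^] p) (z [^] p \<otimes> s)" if z: "z \<in> carrier G" for z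
    proof -
      have "cgr (pw Phi) ((z \<otimes> c) [^] p) (z [^] p \<otimes> c [^] p)"
        using mult z c(1) by (auto simp: multiplicative_mod_Phi_def)
      moreover have "cgr (pw Phi) (z [^] p \<otimes> c [^] p) (z [^] p \<otimes> s)"
        using c z sG by (simp add: cgr_cancel_left)
      ultimately show ?thesis
        using cgr_trans[OF normal_inD(1)[OF nP]] z c(1) sG by (meson m_closed nat_pow_closed)
    qed
    then show "\<exists>c\<in>carrier G. \<forall>z\<in>carrier G. z \<otimes> c \<in> carrier G \<and> cgr (pw Phi) ((z \<otimes> c) [^] p) (z [^] p \<otimes> s)"
      using c(1) by auto
  qed auto
qed

lemma Phi_generators:
  assumes xy: "x \<in> carrier G" "y \<in> carrier G" and c: "comm x y \<notin> pw (carrier G)"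
  shows "insert (comm x y) {g [^] p | g. g \<in> carrier G} \<subseteq> Phi" (is "?T \<subseteq> _")
    and "generate G (insert (comm x y) {g [^] p | g. g \<in> carrier G}) = Phi"
proof -
  have "comm x y \<in> Phi" using comm_in_Phi xy by blast
  then show T: "?T \<subseteq> Phi" using pwG_in_Phi pow_in_pw by blast
  show "generate G ?T = Phi"
  proof
    show "generate G ?T \<subseteq> Phi" using generate_subgroup_incl[OF T Phi_subgroup] .
    have "subgroup (generate G ?T) G" using T Phi_carrier by (intro generate_is_subgroup) auto
    moreover have "pw (carrier G) \<subseteq> generate G ?T" unfolding pw_def by (intro mono_generate) auto
    moreover have "comm x y \<in> generate G ?T" by (auto intro: generate.incl)
    ultimately show "Phi \<subseteq> generate G ?T"
      unfolding Phi_eq_generate[OF assms] by (intro generate_subgroup_incl) auto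
  qed
qed

text \<open>Choose \<open>x\<close> and \<open>y\<close> of order at most \<open>p^(i+1)\<close> whose commutator is outside \<open>pw G\<close>. It has
  order at most \<open>p^(i+1)\<close>, because it is a product of conjugates of \<open>x\<close> and its inverse in a
  powerful maximal subgroup. Therefore the iterate of \<open>pw\<close> at \<open>Phi\<close> is generated by the
  powers of \<open>p\<close>-th powers, with no contribution from that commutator. On the other hand \<open>pw
  G\<close> is generated by \<open>p\<close>-th powers of elements of bounded order and by \<open>pw Phi\<close>, which puts
  the iterate at \<open>G\<close> inside the one at \<open>Phi\<close>. Both facts together bound the latter by its
  own \<open>p\<close>-th powers, so it is trivial.\<close>

lemma powers_trivial_if_om_generates:
  assumes mult: multiplicative_mod_Phi and gen: "generate G (om (Suc i) (carrier G)) = carrier G"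
  shows "(pw ^^ Suc i) (carrier G) = {\<one>}"
proof -
  let ?E = "om (Suc i) (carrier G)" and ?P = "(pw ^^ Suc i) Phi"
  have EG: "?E \<subseteq> carrier G" by (auto simp: om_def)
  have P: "subgroup ?P G" using funpow_pw_subgroup[OF Phi_subgroup] .
  have "\<exists>x\<in>?E. \<exists>y\<in>?E. comm x y \<notin> pw (carrier G)"
  proof (rule ccontr)
    assume "\<not> ?thesis"
    then have "comm u v \<in> pw (carrier G)" if "u \<in> carrier G" "v \<in> carrier G" for u v
      using comm_generate[OF normal_pwG EG EG, of u v] gen that by blast
    then show False using not_powerful subgroup_self by (auto simp: powerful_set_def)
  qed
  then obtain x y where xy: "x \<in> ?E" "y \<in> ?E" "comm x y \<notin> pw (carrier G)" by blast
  let ?c = "comm x y"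
  have xyG: "x \<in> carrier G" "y \<in> carrier G" using xy EG by auto
  obtain M where M: "maximal_subgroup M G" "x \<in> M" using maximal_containing xyG(1) by blast
  note m = maximal_subgroupD[OF M(1)]
  have oM: "subgroup (om (Suc i) M) G" using powerful_om_subgroup[OF powerful_maximal[OF M(1)]] .
  have "inv y \<otimes> x \<otimes> y \<in> om (Suc i) M"
    using om_conj[OF order_refl xy(1) xyG(2)] normal_inD(6)[OF m(3) M(2) xyG(2)] by (simp add: om_def)
  moreover have "x \<in> om (Suc i) M" using xy(1) M(2) by (simp add: om_def)
  ultimately have "inv x \<otimes> (inv y \<otimes> x \<otimes> y) \<in> om (Suc i) M"
    using oM by (simp add: subgroup.m_closed subgroup.m_inv_closed)
  then have c1: "?c [^] (p ^ Suc i) = \<one>"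
    using xyG by (simp add: om_def comm_def m_assoc)
  have powP: "f [^] (p ^ Suc i) \<in> ?P" if "f \<in> Phi" for f
    using pow_in_funpow_pw[OF Phi_carrier, of f 0 "Suc i"] that by simp
  let ?S = "{x [^] p | x. x \<in> ?E} \<union> {f [^] p | f. f \<in> Phi}"
  have S: "?S \<subseteq> pw (carrier G)" using pow_in_pw EG Phi_carrier by blast
  have W: "subgroup (generate G ?S) G" using S pwG_carrier by (intro generate_is_subgroup) auto
  have PhiW: "pw Phi \<subseteq> generate G ?S" unfolding pw_def by (intro mono_generate) auto
  have "z \<in> carrier G \<and> z [^] p \<in> generate G ?S" if "z \<in> generate G ?E" for z
    using that
  proof (induction rule: generate.induct)
    case one
    then show ?case using subgroup.one_closed[OF W] by simp
  next
    case (incl z)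
    then show ?case using EG by (auto intro: generate.incl)
  next
    case (inv z)
    then have "z [^] p \<in> generate G ?S" "z \<in> carrier G" using EG by (auto intro: generate.incl)
    then show ?case using subgroup.m_inv_closed[OF W] by (auto simp: nat_pow_inv)
  next
    case (eng z w)
    then have zw: "z \<in> carrier G" "w \<in> carrier G" by auto
    have "cgr (pw Phi) ((z \<otimes> w) [^] p) (z [^] p \<otimes> w [^] p)"
      using mult zw by (auto simp: multiplicative_mod_Phi_def)
    moreover have "z [^] p \<otimes> w [^] p \<in> generate G ?S" using eng subgroup.m_closed[OF W] by blast
    ultimately show ?case using cgr_member[OF W PhiW] zw by (meson m_closed nat_pow_closed)
  qed
  then have "{z [^] p | z. z \<in> carrier G} \<subseteq> generate G ?S" using gen by auto
  then have "generate G {z [^] p | z. z \<in> carrier G} \<subseteq> generate G ?S" by (rule generate_subgroup_incl[OF _ W])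
  then have genS: "generate G ?S = pw (carrier G)"
    using generate_subgroup_incl[OF S pwG_subgroup] by (auto simp flip: pw_def)
  have "(pw ^^ Suc i) (carrier G) = (pw ^^ i) (pw (carrier G))" by (simp add: funpow_swap1)
  also have "\<dots> = generate G {s [^] (p ^ i) | s. s \<in> ?S}"
    by (rule powerful_funpow_pw_generate[OF powerful_pwG S genS])
  also have "\<dots> \<subseteq> ?P"
  proof (rule generate_subgroup_incl[OF _ P], safe)
    fix x assume "x \<in> ?E"
    then have "(x [^] p) [^] (p ^ i) = \<one>" by (auto simp: om_def nat_pow_pow)
    then show "(x [^] p) [^] (p ^ i) \<in> ?P" using subgroup.one_closed[OF P] by simp
  next
    fix f assume f: "f \<in> Phi"
    then have "(f [^] p) [^] (p ^ i) = f [^] (p ^ Suc i)" using Phi_carrier by (simp add: nat_pow_pow subset_iff)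
    then show "(f [^] p) [^] (p ^ i) \<in> ?P" using powP[OF f] by (simp del: funpow.simps)
  qed
  finally have GP: "(pw ^^ Suc i) (carrier G) \<subseteq> ?P" .
  let ?T = "insert ?c {g [^] p | g. g \<in> carrier G}"
  note T = Phi_generators[OF xyG xy(3)]
  have "?P = generate G {s [^] (p ^ Suc i) | s. s \<in> ?T}"
    by (rule powerful_funpow_pw_generate[OF powerful_Phi T])
  also have "\<dots> \<subseteq> pw ?P"
  proof (rule generate_subgroup_incl)
    show pP: "subgroup (pw ?P) G" using subgroup.subset[OF P] by simp
    show "{s [^] (p ^ Suc i) | s. s \<in> ?T} \<subseteq> pw ?P"
    proof safe
      show "?c [^] (p ^ Suc i) \<in> pw ?P" using c1 subgroup.one_closed[OF pP] by simp
      fix g assume g: "g \<in> carrier G"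
      then have "g [^] (p ^ Suc i) \<in> ?P" using GP pow_in_funpow_pw[of "carrier G" g 0 "Suc i"] by auto
      then have "(g [^] (p ^ Suc i)) [^] p \<in> pw ?P" by (rule pow_in_pw)
      then show "(g [^] p) [^] (p ^ Suc i) \<in> pw ?P" using g by (simp add: nat_pow_pow mult.commute del: funpow.simps)
    qed
  qed
  finally have "?P = {\<one>}" using pw_eq_self_imp_trivial[OF P] by blast
  then show ?thesis using GP subgroup.one_closed[OF funpow_pw_subgroup[OF subgroup_self], of "Suc i"] by auto
qed

text \<open>Either all these elements lie in one maximal subgroup, which is powerful, or they generate
  the group. In the second case the exponent of the group divides \<open>p^i\<close>.\<close>

theorem om_carrier_subgroup:
  assumes mult: multiplicative_mod_Phi
  shows "subgroup (om i (carrier G)) G"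
proof (cases "\<exists>M. maximal_subgroup M G \<and> om i (carrier G) \<subseteq> M")
  case True
  then obtain M where M: "maximal_subgroup M G" "om i (carrier G) \<subseteq> M" by blast
  then have "om i (carrier G) = om i M" using maximal_subgroupD(2)[OF M(1)] by (auto simp: om_def)
  then show ?thesis using powerful_om_subgroup[OF powerful_maximal[OF M(1)]] by simp
next
  case False
  show ?thesis
  proof (cases i)
    case 0
    then have "om i (carrier G) = {\<one>}" by (auto simp: om_def)
    then show ?thesis by (simp add: triv_subgroup)
  next
    case (Suc j)
    let ?E = "om i (carrier G)"
    have E: "?E \<subseteq> carrier G" by (auto simp: om_def)
    have "generate G ?E = carrier G"
    proof (rule ccontr)
      assume "generate G ?E \<noteq> carrier G"
      then obtain M where "maximal_subgroup M G" "generate G ?E \<subseteq> M"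
        using proper_subgroup_in_maximal_subgroup generate_is_subgroup[OF E] by metis
      then show False using False by (auto intro: generate.incl)
    qed
    then have "(pw ^^ i) (carrier G) = {\<one>}" using powers_trivial_if_om_generates[OF mult] Suc by simp
    then have "g [^] (p ^ i) = \<one>" if "g \<in> carrier G" for g
      using pow_in_funpow_pw[of "carrier G" g 0 i] that by simp
    then have "?E = carrier G" by (auto simp: om_def)
    then show ?thesis by (simp add: subgroup_self)
  qed
qed

end

section \<open>The exceptional case for the prime three\<close>

context comm_group
begin

text \<open>In additive notation over the field with three elements: \<open>A\<close>, \<open>B\<close> and \<open>T\<close> stand for the
  cubes of \<open>a\<close>, \<open>b\<close> and \<open>a b\<close>, and \<open>E\<close>, \<open>F\<close>, \<open>E + F\<close> for the commutators of \<open>[b,a]\<close> with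
  them. Each of the three commutators would be a nonzero multiple of the corresponding cube,
  and the collection formula gives \<open>T = A + B + E + 2 F\<close>. Each choice of signs makes one of
  \<open>E\<close>, \<open>F\<close>, \<open>E + F\<close> and \<open>E + 2 F\<close> vanish.\<close>

lemma exponent_3_no_eigenvectors:
  assumes car: "A \<in> carrier G" "B \<in> carrier G" and A3: "A \<otimes> (A \<otimes> A) = \<one>" and B3: "B \<otimes> (B \<otimes> B) = \<one>"
    and E: "E = A \<or> E = A \<otimes> A" and F: "F = B \<or> F = B \<otimes> B"
    and ne: "E \<noteq> \<one>" "F \<noteq> \<one>" "E \<otimes> F \<noteq> \<one>" "E \<otimes> (F \<otimes> F) \<noteq> \<one>"
    and T: "T = A \<otimes> B \<otimes> E \<otimes> F \<otimes> F" and EF: "E \<otimes> F = T \<or> E \<otimes> F = T \<otimes> T"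
  shows False
proof -
  have red: "A \<otimes> (A \<otimes> (A \<otimes> w)) = w" "B \<otimes> (B \<otimes> (B \<otimes> w)) = w" if "w \<in> carrier G" for w
    using car A3 B3 that by (metis l_one m_assoc m_closed)+
  note S = m_assoc m_comm m_lcomm A3 B3 red car
  have canc: "u = v" if "w \<otimes> u = w \<otimes> v" "u \<in> carrier G" "v \<in> carrier G" "w \<in> carrier G" for u v w
    using that by simp
  show False
    using E F
  proof (elim disjE)
    assume [simp]: "E = A" "F = B"
    have "A \<otimes> B = A \<otimes> A \<or> A \<otimes> B = A \<otimes> \<one>" using EF by (simp add: T S)
    then have "B = A \<or> B = \<one>" using car canc by blast
    then show False using ne A3 by auto
  next
    assume [simp]: "E = A" "F = B \<otimes> B"
    have "A \<otimes> (B \<otimes> B) = A \<otimes> (A \<otimes> (B \<otimes> B)) \<or> (A \<otimes> B) \<otimes> B = (A \<otimes> B) \<otimes> \<one>" using EF by (simp add: T S)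
    then have "B \<otimes> B \<otimes> \<one> = B \<otimes> B \<otimes> A \<or> B = \<one>"
      using car canc[of A "B \<otimes> B" "A \<otimes> (B \<otimes> B)"] canc[of "A \<otimes> B" B \<one>] by (auto simp: S)
    then have "\<one> = A \<or> B = \<one>" using car canc[of "B \<otimes> B" \<one> A] by auto
    then show False using ne by auto
  next
    assume [simp]: "E = A \<otimes> A" "F = B"
    have "E \<otimes> F = \<one>" using EF by (simp add: T S)
    then show False using ne by simp
  next
    assume [simp]: "E = A \<otimes> A" "F = B \<otimes> B"
    have "(B \<otimes> B) \<otimes> (A \<otimes> A) = (B \<otimes> B) \<otimes> \<one> \<or> B \<otimes> (A \<otimes> A \<otimes> B) = B \<otimes> \<one>" using EF by (simp add: T S)
    then have "A \<otimes> A = \<one> \<or> A \<otimes> A \<otimes> B = \<one>"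
      using car canc[of "B \<otimes> B" "A \<otimes> A" \<one>] canc[of B "A \<otimes> A \<otimes> B" \<one>] by auto
    then show False using ne by (auto simp: S)
  qed
qed

text \<open>The same equations with \<open>F = 0\<close>: now \<open>T\<close> and \<open>U\<close> are the cubes of \<open>a b\<close> and of \<open>a b^-1\<close>,
  and the commutator with both of them is \<open>E\<close>. Comparing signs leaves \<open>B = 2 E\<close>, with \<open>A\<close>
  equal to \<open>E\<close> or to \<open>2 E\<close>.\<close>

lemma exponent_3_eigenvectors:
  assumes car: "A \<in> carrier G" "B \<in> carrier G" and A3: "A \<otimes> (A \<otimes> A) = \<one>" and B3: "B \<otimes> (B \<otimes> B) = \<one>"
    and E: "E = A \<or> E = A \<otimes> A" and ne: "E \<noteq> \<one>"
    and T: "T = A \<otimes> B \<otimes> E" "E = T \<or> E = T \<otimes> T"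
    and U: "U = A \<otimes> B \<otimes> B \<otimes> E \<otimes> E" "E = U \<or> E = U \<otimes> U"
  shows "E = A \<and> B = A \<otimes> A \<or> E = A \<otimes> A \<and> B = A"
proof -
  have red: "A \<otimes> (A \<otimes> (A \<otimes> w)) = w" "B \<otimes> (B \<otimes> (B \<otimes> w)) = w" if "w \<in> carrier G" for w
    using car A3 B3 that by (metis l_one m_assoc m_closed)+
  note S = m_assoc m_comm m_lcomm A3 B3 red car
  have canc: "u = v" if "w \<otimes> u = w \<otimes> v" "u \<in> carrier G" "v \<in> carrier G" "w \<in> carrier G" for u v w
    using that by simp
  show ?thesis
    using E
  proof
    assume [simp]: "E = A"
    have "A \<otimes> \<one> = A \<otimes> (A \<otimes> B) \<or> A \<otimes> \<one> = A \<otimes> (B \<otimes> B)" using T by (simp add: S)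
    then have "A \<otimes> B = \<one> \<or> B \<otimes> B = \<one>"
      using car canc[of A \<one> "A \<otimes> B"] canc[of A \<one> "B \<otimes> B"] by auto
    then show ?thesis
    proof
      assume "A \<otimes> B = \<one>"
      then have "A \<otimes> A \<otimes> (A \<otimes> B) = A \<otimes> A" using car by simp
      then show ?thesis by (simp add: S)
    next
      assume "B \<otimes> B = \<one>"
      then have "B = \<one>" using B3 car by simp
      then have "U = \<one>" using U(1) by (simp add: S)
      then show ?thesis using U(2) ne car by auto
    qed
  next
    assume [simp]: "E = A \<otimes> A"
    have TB: "T = B" using T(1) by (simp add: S)
    from T(2) show ?thesis
    proof
      assume "E = T"
      then have B: "B = A \<otimes> A" using TB by simp
      have "U = \<one>" unfolding U(1) B by (simp add: S)
      then show ?thesis using U(2) ne car by auto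
    next
      assume "E = T \<otimes> T"
      then have "A \<otimes> A = B \<otimes> B" using TB by simp
      then have "A \<otimes> A \<otimes> (A \<otimes> A) = B \<otimes> B \<otimes> (B \<otimes> B)" by simp
      then have "A = B" by (simp add: S)
      then show ?thesis by simp
    qed
  qed
qed

end

context nonpowerful_M1_group
begin

text \<open>The quotient by \<open>Phi\<close> is elementary abelian, so that inverses are positive powers there.\<close>

lemma power_mod_Phi:
  assumes gen: "g \<in> generate G {x, y}" and xy: "x \<in> carrier G" "y \<in> carrier G"
  shows "\<exists>i j. cgr Phi g (x [^] (i::nat) \<otimes> y [^] (j::nat))"
proof -
  obtain Q :: "'a set monoid" and q where Q: "quotient_map Phi (carrier G) Q q"
    using quotient_map_exists[OF normal_Phi] by blast
  note q = quotient_mapD[OF Q]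
  interpret Q: group Q by (rule q(1))
  have powP: "u [^] p \<in> Phi" if "u \<in> carrier G" for u using pow_in_pw[OF that] pwG_in_Phi by blast
  have comm: "q u \<otimes>\<^bsub>Q\<^esub> q v = q v \<otimes>\<^bsub>Q\<^esub> q u" if "u \<in> carrier G" "v \<in> carrier G" for u v
    using that q(6)[OF that] q(7)[of "comm u v"] comm_in_Phi[OF that] Q.comm_eq_one_iff[of "q u" "q v"] q(2) by auto
  let ?x = "q x" and ?y = "q y"
  have xyQ: "?x \<in> carrier Q" "?y \<in> carrier Q" using q(2) xy by auto
  have inv: "inv\<^bsub>Q\<^esub> (q u) = q u [^]\<^bsub>Q\<^esub> (p - 1)" if u: "u \<in> carrier G" for u
  proof -
    have "q u [^]\<^bsub>Q\<^esub> (p - 1) \<otimes>\<^bsub>Q\<^esub> q u = q u [^]\<^bsub>Q\<^esub> p"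
      using p_ge_3 Q.nat_pow_Suc[of "q u" "p - 1"] by simp
    also have "\<dots> = \<one>\<^bsub>Q\<^esub>" using q(5)[OF u, of p] q(7)[of "u [^] p"] powP[OF u] u by simp
    finally show ?thesis using q(2)[OF u] by (intro Q.inv_equality) auto
  qed
  have "g \<in> carrier G \<and> (\<exists>i j. q g = ?x [^]\<^bsub>Q\<^esub> (i::nat) \<otimes>\<^bsub>Q\<^esub> ?y [^]\<^bsub>Q\<^esub> (j::nat))" using gen
  proof (induction rule: generate.induct)
    case one
    have "q \<one> = ?x [^]\<^bsub>Q\<^esub> (0::nat) \<otimes>\<^bsub>Q\<^esub> ?y [^]\<^bsub>Q\<^esub> (0::nat)"
      using q(7)[of \<one>] subgroup.one_closed[OF Phi_subgroup] by simp
    then show ?case using one_closed by blast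
  next
    case (incl g)
    then have "q g = ?x [^]\<^bsub>Q\<^esub> (1::nat) \<otimes>\<^bsub>Q\<^esub> ?y [^]\<^bsub>Q\<^esub> (0::nat) \<or> q g = ?x [^]\<^bsub>Q\<^esub> (0::nat) \<otimes>\<^bsub>Q\<^esub> ?y [^]\<^bsub>Q\<^esub> (1::nat)"
      using xyQ by auto
    then show ?case using incl xy by blast
  next
    case (inv g)
    then have "q (inv g) = ?x [^]\<^bsub>Q\<^esub> (p - 1) \<otimes>\<^bsub>Q\<^esub> ?y [^]\<^bsub>Q\<^esub> (0::nat) \<or> q (inv g) = ?x [^]\<^bsub>Q\<^esub> (0::nat) \<otimes>\<^bsub>Q\<^esub> ?y [^]\<^bsub>Q\<^esub> (p - 1)"
      using xy xyQ q(4) \<open>\<And>u. u \<in> carrier G \<Longrightarrow> inv\<^bsub>Q\<^esub> (q u) = q u [^]\<^bsub>Q\<^esub> (p - 1)\<close> by auto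
    then show ?case using inv xy by blast
  next
    case (eng g h)
    then obtain i j k l where ij: "q g = ?x [^]\<^bsub>Q\<^esub> (i::nat) \<otimes>\<^bsub>Q\<^esub> ?y [^]\<^bsub>Q\<^esub> (j::nat)"
      "q h = ?x [^]\<^bsub>Q\<^esub> (k::nat) \<otimes>\<^bsub>Q\<^esub> ?y [^]\<^bsub>Q\<^esub> (l::nat)" by blast
    have c: "?y [^]\<^bsub>Q\<^esub> j \<otimes>\<^bsub>Q\<^esub> ?x [^]\<^bsub>Q\<^esub> k = ?x [^]\<^bsub>Q\<^esub> k \<otimes>\<^bsub>Q\<^esub> ?y [^]\<^bsub>Q\<^esub> j"
      using Q.commuting_powers[OF comm[OF xy(2,1)]] xyQ by blast
    have "q (g \<otimes> h) = ?x [^]\<^bsub>Q\<^esub> i \<otimes>\<^bsub>Q\<^esub> (?y [^]\<^bsub>Q\<^esub> j \<otimes>\<^bsub>Q\<^esub> ?x [^]\<^bsub>Q\<^esub> k) \<otimes>\<^bsub>Q\<^esub> ?y [^]\<^bsub>Q\<^esub> l"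
      using ij eng q(3) xyQ by (simp add: Q.m_assoc)
    also have "\<dots> = ?x [^]\<^bsub>Q\<^esub> (i + k) \<otimes>\<^bsub>Q\<^esub> ?y [^]\<^bsub>Q\<^esub> (j + l)"
      unfolding c using xyQ by (simp add: Q.m_assoc flip: Q.nat_pow_mult)
    finally show ?case using eng by auto
  qed
  then show ?thesis using xy by (auto simp: cgr_quotient_map[OF Q] q(3,5))
qed

text \<open>In a powerful maximal subgroup \<open>M\<close> that contains \<open>x\<close> the commutator is a \<open>p\<close>-th power
  \<open>w^p\<close>. Since \<open>M\<close> is generated by \<open>x\<close> and \<open>Phi\<close>, the element \<open>w\<close> is a power of \<open>x\<close> modulo
  \<open>Phi\<close>, and \<open>p\<close>-th powers are multiplicative modulo \<open>pw (pw M)\<close>.\<close>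

lemma comm_Phi_eigenvector:
  assumes xy: "x \<in> carrier G" "y \<in> carrier G" and gen: "generate G {x, y} = carrier G" and f: "f \<in> Phi"
  obtains t where "t < p" "cgr (pw Phi) (comm f x) ((x [^] p) [^] t)"
proof -
  obtain M where M: "maximal_subgroup M G" "x \<in> M" using maximal_containing xy(1) by blast
  note m = maximal_subgroupD[OF M(1)] and pM = powerful_maximal[OF M(1)] and PM = Phi_in_maximal(1)[OF M(1)]
  note N = normal_inD(1)[OF normal_pw_Phi]
  have powM: "u [^] (k::nat) \<in> M" if "u \<in> M" for u k using that subgroup_pow_closed[OF is_group m(1)] by blast
  have "comm f x \<in> pw M" using pM PM f M(2) by (auto simp: powerful_set_def)
  then obtain w where w: "w \<in> M" "comm f x = w [^] p"
    using uniform_root[OF powerful_uniform[OF pM] m(1)] by blast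
  have wG: "w \<in> carrier G" using w m(2) by blast
  obtain i j where ij: "cgr Phi w (x [^] (i::nat) \<otimes> y [^] (j::nat))"
    using power_mod_Phi[of w x y] gen wG xy by blast
  have "x [^] i \<otimes> y [^] j \<in> M"
    using cgr_member[OF m(1) PM _ _ cgr_sym[OF Phi_subgroup _ _ ij] w(1)] wG xy by simp
  then have "inv (x [^] i) \<otimes> (x [^] i \<otimes> y [^] j) \<in> M"
    using powM[OF M(2)] m(1) by (meson subgroup.m_closed subgroup.m_inv_closed)
  then have yj: "y [^] j \<in> M" using xy by simp
  have "p dvd j"
  proof (rule ccontr)
    assume "\<not> p dvd j"
    then have "coprime j p" using prime_p by (metis coprime_commute prime_imp_coprime)
    then obtain k l where kl: "j * k = p * l + 1" using coprime_bezout_strong[of j p] p_ge_3 by auto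
    have "(y [^] j) [^] k = (y [^] p) [^] l \<otimes> y" using kl xy by (simp add: nat_pow_pow)
    moreover have "(y [^] j) [^] k \<in> M" "inv ((y [^] p) [^] l) \<in> M"
      using powM yj m(1,4) xy by (auto intro: subgroup.m_inv_closed)
    ultimately have "inv ((y [^] p) [^] l) \<otimes> ((y [^] p) [^] l \<otimes> y) \<in> M"
      using subgroup.m_closed[OF m(1)] by metis
    then have "y \<in> M" using xy by simp
    then have "generate G {x, y} \<subseteq> M" using M(2) by (intro generate_subgroup_incl[OF _ m(1)]) auto
    then show False using gen m(2) by blast
  qed
  then have yjP: "y [^] j \<in> Phi"
    using pow_dvd_closed[OF Phi_subgroup xy(2)] pow_in_pw[OF xy(2)] pwG_in_Phi by blast
  have "cgr Phi w (x [^] i)"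
    using cgr_absorb[OF Phi_subgroup wG _ yjP ij] xy by simp
  then obtain \<phi> where phi: "\<phi> \<in> Phi" "w = x [^] i \<otimes> \<phi>"
    using cgr_iff_mult[OF wG _ Phi_subgroup] xy by auto
  have phiG: "\<phi> \<in> carrier G" using phi Phi_carrier by blast
  have "cgr (pw (pw M)) (w [^] p) ((x [^] i) [^] p \<otimes> \<phi> [^] p)"
    using powerful_pow_mult[OF pM powM[OF M(2)], of \<phi> 0 i] phi PM by auto
  then have "cgr (pw Phi) (w [^] p) ((x [^] i) [^] p \<otimes> \<phi> [^] p)"
    using cgr_mono pw_maximal_subset(4)[OF M(1)] by blast
  then have 1: "cgr (pw Phi) (w [^] p) ((x [^] i) [^] p)"
    using cgr_absorb[OF N, of "w [^] p" "(x [^] i) [^] p"] pow_in_pw[OF phi(1)] wG xy by simp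
  have "(x [^] i) [^] p = (x [^] p) [^] (i mod p) \<otimes> ((x [^] p) [^] p) [^] (i div p)"
  proof -
    have "i * p = (i mod p + p * (i div p)) * p" by simp
    also have "\<dots> = p * (i mod p) + p * p * (i div p)" by (simp only: algebra_simps)
    finally have "i * p = p * (i mod p) + p * p * (i div p)" .
    then show ?thesis using xy by (simp add: nat_pow_pow nat_pow_mult)
  qed
  moreover have "((x [^] p) [^] p) [^] (i div p) \<in> pw Phi"
    using subgroup_pow_closed[OF is_group N] pow_in_pw[of "x [^] p" Phi] pow_in_pw[OF xy(1)] pwG_in_Phi by blast
  ultimately have "cgr (pw Phi) (comm f x) ((x [^] p) [^] (i mod p))"
    using cgr_absorb[OF N, of "w [^] p" "(x [^] p) [^] (i mod p)"] 1 w(2) wG xy by simp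
  then show thesis using that[of "i mod p"] p_ge_3 by simp
qed

context
  fixes Q :: "'q monoid" and q :: "'a \<Rightarrow> 'q"
  assumes Q: "quotient_map (pw Phi) (carrier G) Q q"
begin

text \<open>The image of \<open>pw G\<close> is central in the quotient by \<open>pw Phi\<close>; as a consequence the
  commutator with an element of \<open>Phi\<close> is bilinear there.\<close>

lemma q_pwG_comm:
  assumes "u \<in> pw (carrier G)" "v \<in> carrier G"
  shows "q (comm u v) = \<one>\<^bsub>Q\<^esub>" "q u \<otimes>\<^bsub>Q\<^esub> q v = q v \<otimes>\<^bsub>Q\<^esub> q u"
proof -
  note q = quotient_mapD[OF Q]
  interpret Q: group Q by (rule q(1))
  have uG: "u \<in> carrier G" using assms pwG_carrier by blast
  show 1: "q (comm u v) = \<one>\<^bsub>Q\<^esub>" using q(7)[of "comm u v"] comm_pwG[OF assms] uG assms(2) by simp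
  then show "q u \<otimes>\<^bsub>Q\<^esub> q v = q v \<otimes>\<^bsub>Q\<^esub> q u"
    using q(6)[OF uG assms(2)] Q.comm_eq_one_iff[of "q u" "q v"] q(2) uG assms(2) by auto
qed

lemma q_comm_mult_right:
  assumes f: "f \<in> Phi" and g: "g \<in> carrier G" "h \<in> carrier G"
  shows "q (comm f (g \<otimes> h)) = q (comm f g) \<otimes>\<^bsub>Q\<^esub> q (comm f h)"
proof -
  note q = quotient_mapD[OF Q]
  interpret Q: group Q by (rule q(1))
  have fG: "f \<in> carrier G" using f Phi_carrier by blast
  have u: "comm f g \<in> pw (carrier G)" "comm f h \<in> pw (carrier G)" using comm_Phi_in_pwG f g by auto
  have "comm f (g \<otimes> h) = comm f h \<otimes> (comm f g \<otimes> comm (comm f g) h)"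
    using fG g by (simp add: comm_def m_assoc inv_mult_group)
  then have "q (comm f (g \<otimes> h)) = q (comm f h) \<otimes>\<^bsub>Q\<^esub> q (comm f g)"
    using q_pwG_comm(1)[OF u(1) g(2)] fG g q(2,3) by simp
  then show ?thesis using q_pwG_comm(2)[OF u(2), of "comm f g"] fG g by simp
qed

lemma q_comm_mult_left:
  assumes f: "f \<in> Phi" "f' \<in> Phi" and g: "g \<in> carrier G"
  shows "q (comm (f \<otimes> f') g) = q (comm f g) \<otimes>\<^bsub>Q\<^esub> q (comm f' g)"
proof -
  note q = quotient_mapD[OF Q]
  interpret Q: group Q by (rule q(1))
  have fG: "f \<in> carrier G" "f' \<in> carrier G" using f Phi_carrier by auto
  have u: "comm f g \<in> pw (carrier G)" using comm_Phi_in_pwG f g by auto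
  have "comm (f \<otimes> f') g = (comm f g \<otimes> comm (comm f g) f') \<otimes> comm f' g"
    using fG g by (simp add: comm_def m_assoc inv_mult_group)
  then show ?thesis using q_pwG_comm(1)[OF u fG(2)] fG g q(2,3) by simp
qed

lemma q_comm_inv_right:
  assumes f: "f \<in> Phi" and g: "g \<in> carrier G"
  shows "q (comm f (inv g)) = inv\<^bsub>Q\<^esub> (q (comm f g))"
proof -
  note q = quotient_mapD[OF Q]
  interpret Q: group Q by (rule q(1))
  have fG: "f \<in> carrier G" using f Phi_carrier by blast
  have "q (comm f (inv g)) \<otimes>\<^bsub>Q\<^esub> q (comm f g) = q (comm f \<one>)"
    using q_comm_mult_right[OF f, of "inv g" g] g by simp
  also have "\<dots> = \<one>\<^bsub>Q\<^esub>"
    using fG q(7)[of \<one>] subgroup.one_closed[OF normal_inD(1)[OF normal_pw_Phi]] by (simp add: comm_def)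
  finally show ?thesis using q(2) fG g by (intro Q.inv_equality[symmetric]) auto
qed

lemma q_comm_inv_left:
  assumes f: "f \<in> Phi" and g: "g \<in> carrier G"
  shows "q (comm (inv f) g) = inv\<^bsub>Q\<^esub> (q (comm f g))"
proof -
  note q = quotient_mapD[OF Q]
  interpret Q: group Q by (rule q(1))
  have fG: "f \<in> carrier G" using f Phi_carrier by blast
  have "q (comm (inv f) g) \<otimes>\<^bsub>Q\<^esub> q (comm f g) = q (comm \<one> g)"
    using q_comm_mult_left[OF subgroup.m_inv_closed[OF Phi_subgroup f] f g] fG by simp
  also have "\<dots> = \<one>\<^bsub>Q\<^esub>"
    using g q(7)[of \<one>] subgroup.one_closed[OF normal_inD(1)[OF normal_pw_Phi]] by (simp add: comm_def)
  finally show ?thesis using q(2) fG g by (intro Q.inv_equality[symmetric]) auto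
qed

lemma q_comm_inv_generator:
  assumes a: "a \<in> carrier G" and b: "b \<in> carrier G" and g: "g \<in> carrier G"
  shows "q (comm (comm (inv b) a) g) = inv\<^bsub>Q\<^esub> (q (comm (comm b a) g))"
proof -
  note q = quotient_mapD[OF Q]
  interpret Q: group Q by (rule q(1))
  let ?c = "comm b a"
  have c: "?c \<in> Phi" "inv ?c \<in> Phi" using comm_in_Phi a b subgroup.m_inv_closed[OF Phi_subgroup] by auto
  have u: "comm (inv ?c) (inv b) \<in> pw (carrier G)" using comm_Phi_in_pwG[OF c(2)] b by simp
  have "comm (inv b) a = inv ?c \<otimes> comm (inv ?c) (inv b)"
    using a b by (simp add: comm_def m_assoc inv_mult_group)
  then have "q (comm (comm (inv b) a) g) = q (comm (inv ?c) g) \<otimes>\<^bsub>Q\<^esub> q (comm (comm (inv ?c) (inv b)) g)"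
    using q_comm_mult_left[OF c(2) _ g] u pwG_in_Phi by auto
  then show ?thesis using q_pwG_comm(1)[OF u g] q_comm_inv_left[OF c(1) g] q(2) a b g by simp
qed

context
  assumes p3: "p = 3"
begin

text \<open>A central subgroup of exponent three, viewed as a vector space over the field with three
  elements.\<close>

abbreviation V :: "'q set" where "V \<equiv> q ` pw (carrier G)"

lemma comm_group_V: "comm_group (Q\<lparr>carrier := V\<rparr>)"
proof -
  note q = quotient_mapD[OF Q]
  interpret Q: group Q by (rule q(1))
  have car: "u \<in> carrier G" if "u \<in> pw (carrier G)" for u using that pwG_carrier by blast
  have "subgroup V Q"
  proof (rule Q.subgroupI)
    show "V \<subseteq> carrier Q" using q(2) car by auto
    show "V \<noteq> {}" using subgroup.one_closed[OF pwG_subgroup] by blast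
    show "inv\<^bsub>Q\<^esub> a \<in> V" if "a \<in> V" for a
      using that q(4)[OF car] subgroup.m_inv_closed[OF pwG_subgroup] by (auto simp flip: q(4)[OF car])
    show "a \<otimes>\<^bsub>Q\<^esub> b \<in> V" if ab: "a \<in> V" "b \<in> V" for a b
    proof -
      obtain u v where "u \<in> pw (carrier G)" "a = q u" "v \<in> pw (carrier G)" "b = q v" using ab by blast
      then show ?thesis using q(3)[OF car car, of u v] subgroup.m_closed[OF pwG_subgroup]
        by (metis image_eqI)
    qed
  qed
  then have "group (Q\<lparr>carrier := V\<rparr>)" by (rule Q.subgroup_imp_group)
  moreover have "a \<otimes>\<^bsub>Q\<^esub> b = b \<otimes>\<^bsub>Q\<^esub> a" if "a \<in> V" "b \<in> V" for a b
    using that q_pwG_comm(2) car by blast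
  ultimately show ?thesis by (intro group.group_comm_groupI) auto
qed

lemma V_cube: "v \<in> V \<Longrightarrow> v \<otimes>\<^bsub>Q\<^esub> (v \<otimes>\<^bsub>Q\<^esub> v) = \<one>\<^bsub>Q\<^esub>"
proof -
  note q = quotient_mapD[OF Q]
  interpret Q: group Q by (rule q(1))
  assume "v \<in> V"
  then obtain u where u: "u \<in> pw (carrier G)" "v = q u" by blast
  have uG: "u \<in> carrier G" using u pwG_carrier by blast
  have "u [^] p \<in> pw Phi" using pow_in_pw[OF u(1)] pw_pwG_in_pw_Phi by blast
  then have "q u [^]\<^bsub>Q\<^esub> p = \<one>\<^bsub>Q\<^esub>" using q(5)[OF uG, of p] q(7)[of "u [^] p"] uG by simp
  then show ?thesis using u q(2)[OF uG] by (simp add: p3 numeral_3_eq_3 Q.m_assoc)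
qed

lemma V_inv: "v \<in> V \<Longrightarrow> inv\<^bsub>Q\<^esub> v = v \<otimes>\<^bsub>Q\<^esub> v"
proof -
  note q = quotient_mapD[OF Q]
  interpret Q: group Q by (rule q(1))
  assume v: "v \<in> V"
  then have "v \<in> carrier Q" using q(2) pwG_carrier by auto
  then show ?thesis using V_cube[OF v] by (intro Q.inv_equality) (auto simp: Q.m_assoc)
qed

text \<open>The collection formula for cubes modulo \<open>pw Phi\<close>: the coefficients are \<open>3\<close>, \<open>1\<close> and \<open>5\<close>.\<close>

lemma q_cube_mult:
  assumes x: "x \<in> carrier G" and y: "y \<in> carrier G"
  shows "q ((x \<otimes> y) [^] p) = q (x [^] p) \<otimes>\<^bsub>Q\<^esub> q (y [^] p) \<otimes>\<^bsub>Q\<^esub> q (comm (comm y x) x)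
    \<otimes>\<^bsub>Q\<^esub> q (comm (comm y x) y) \<otimes>\<^bsub>Q\<^esub> q (comm (comm y x) y)"
proof -
  note q = quotient_mapD[OF Q]
  interpret Q: group Q by (rule q(1))
  let ?c = "comm y x" let ?e = "comm ?c x" and ?f = "comm ?c y"
  have c: "?c \<in> Phi" "?c \<in> carrier G" using comm_in_Phi x y by auto
  have ef: "?e \<in> pw (carrier G)" "?f \<in> pw (carrier G)" using comm_Phi_in_pwG[OF c(1)] x y by auto
  have Qx: "q x \<in> carrier Q" "q y \<in> carrier Q" "q ?c \<in> carrier Q" "q ?e \<in> carrier Q" "q ?f \<in> carrier Q"
    using q(2) x y by auto
  have 1: "Q.comm (q y) (q x) = q ?c" "Q.comm (q ?c) (q x) = q ?e" "Q.comm (q ?c) (q y) = q ?f"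
    using q(6) x y by auto
  have F: "(q x \<otimes>\<^bsub>Q\<^esub> q y) [^]\<^bsub>Q\<^esub> (3::nat) = q x [^]\<^bsub>Q\<^esub> (3::nat) \<otimes>\<^bsub>Q\<^esub> q y [^]\<^bsub>Q\<^esub> (3::nat) \<otimes>\<^bsub>Q\<^esub> q ?c [^]\<^bsub>Q\<^esub> (3 choose 2)
    \<otimes>\<^bsub>Q\<^esub> q ?e [^]\<^bsub>Q\<^esub> (3 choose 3) \<otimes>\<^bsub>Q\<^esub> q ?f [^]\<^bsub>Q\<^esub> ((3 choose 2) + 2 * (3 choose 3))"
    using Q.power_of_product_class_3[of "q x" "q y" 3] q_pwG_comm(2) ef x y Qx unfolding 1 by auto
  have "?c [^] p \<in> pw Phi" using pow_in_pw[OF c(1)] .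
  then have c3: "q ?c [^]\<^bsub>Q\<^esub> (3::nat) = \<one>\<^bsub>Q\<^esub>" using q(5)[OF c(2), of p] q(7)[of "?c [^] p"] c(2) p3 by simp
  have f3: "q ?f \<otimes>\<^bsub>Q\<^esub> (q ?f \<otimes>\<^bsub>Q\<^esub> q ?f) = \<one>\<^bsub>Q\<^esub>" using V_cube ef(2) by blast
  have n: "(3 choose 2) = (3::nat)" "(3 choose 3) = (1::nat)" by (simp_all add: numeral_3_eq_3 numeral_2_eq_2)
  have "(3::nat) + 2 * 1 = Suc (Suc 3)" by simp
  then have f5: "q ?f [^]\<^bsub>Q\<^esub> ((3::nat) + 2 * 1) = q ?f \<otimes>\<^bsub>Q\<^esub> q ?f"
    using f3 Qx by (simp only: Q.nat_pow_Suc) (simp add: numeral_3_eq_3 Q.m_assoc)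
  show ?thesis
    using F Qx unfolding n f5 c3 by (simp add: p3 q(3,5) x y Q.m_assoc)
qed

text \<open>Two elements with such a commutator generate the group, by \<open>generate_pair\<close>. This form of
  the condition survives a change of generators more easily than generation itself.\<close>

definition generating_pair :: "'a \<Rightarrow> 'a \<Rightarrow> bool" where
  "generating_pair a b \<longleftrightarrow> a \<in> carrier G \<and> b \<in> carrier G \<and> comm b a \<notin> pw (carrier G)"

lemma generating_pair_generate: "generating_pair a b \<Longrightarrow> generate G {a, b} = carrier G"
  using generate_pair[of b a] by (auto simp: generating_pair_def insert_commute)

lemma generating_pair_change:
  assumes "generating_pair a b" "b' \<in> carrier G" "b \<in> generate G {a, b'}"
  shows "generating_pair a b'"
proof -
  have G: "a \<in> carrier G" "b \<in> carrier G" and c: "comm b a \<notin> pw (carrier G)" using assms by (auto simp: generating_pair_def)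
  have "comm b' a \<notin> pw (carrier G)"
  proof
    assume "comm b' a \<in> pw (carrier G)"
    moreover have "comm a a \<in> pw (carrier G)"
      using G subgroup.one_closed[OF pwG_subgroup] comm_eq_one_iff[of a a] by simp
    ultimately have "comm b a \<in> pw (carrier G)"
      using comm_generate_left[OF normal_pwG, of "{a, b'}" a b] assms G by auto
    then show False using c by blast
  qed
  then show ?thesis using assms by (auto simp: generating_pair_def)
qed

lemma generating_pair_sym: "generating_pair a x \<Longrightarrow> generating_pair x a"
  using inv_commutator[of a x] subgroup.m_inv_closed[OF pwG_subgroup, of "comm a x"] by (auto simp: generating_pair_def)

lemma generating_pair_product:
  assumes good: "generating_pair a b"
  shows "generating_pair a (a \<otimes> b)" "generating_pair a (a \<otimes> inv b)"
proof -
  have G: "a \<in> carrier G" "b \<in> carrier G" using good by (auto simp: generating_pair_def)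
  have "inv a \<otimes> (a \<otimes> b) \<in> generate G {a, a \<otimes> b}"
    by (rule generate.eng[OF generate.inv generate.incl]) simp_all
  then show "generating_pair a (a \<otimes> b)" using generating_pair_change[OF good, of "a \<otimes> b"] G by simp
  have "inv a \<otimes> (a \<otimes> inv b) \<in> generate G {a, a \<otimes> inv b}"
    by (rule generate.eng[OF generate.inv generate.incl]) simp_all
  then have "inv b \<in> generate G {a, a \<otimes> inv b}" using G by simp
  from generate_m_inv_closed[OF _ this] have "b \<in> generate G {a, a \<otimes> inv b}" using G by auto
  then show "generating_pair a (a \<otimes> inv b)" using generating_pair_change[OF good, of "a \<otimes> inv b"] G by simp
qed

lemma generating_pair_central:
  assumes "generating_pair a b" "z \<in> carrier G" "comm (comm b a) z \<in> pw Phi" "f \<in> Phi"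
  shows "comm f z \<in> pw Phi"
proof -
  have G: "a \<in> carrier G" "b \<in> carrier G" and c: "comm b a \<notin> pw (carrier G)" using assms by (auto simp: generating_pair_def)
  have "f \<in> generate G (insert (comm b a) (pw (carrier G)))" using Phi_eq_generate[OF G(2,1) c] assms(4) by simp
  then show ?thesis
    using comm_generate_left[OF normal_pw_Phi, of "insert (comm b a) (pw (carrier G))" z f]
      G assms(2,3) pwG_carrier comm_pwG by auto
qed

text \<open>For \<open>p = 3\<close> the exponent in \<open>comm_Phi_eigenvector\<close> is \<open>0\<close>, \<open>1\<close> or \<open>2\<close>.\<close>

lemma generating_pair_eigenvalue:
  assumes "generating_pair x y" "f \<in> Phi"
  shows "q (comm f x) = \<one>\<^bsub>Q\<^esub> \<or> q (comm f x) = q (x [^] p) \<or> q (comm f x) = q (x [^] p) \<otimes>\<^bsub>Q\<^esub> q (x [^] p)"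
proof -
  note q = quotient_mapD[OF Q]
  interpret Q: group Q by (rule q(1))
  have G: "x \<in> carrier G" "y \<in> carrier G" using assms by (auto simp: generating_pair_def)
  have fG: "f \<in> carrier G" using assms Phi_carrier by blast
  obtain t where t: "t < p" "cgr (pw Phi) (comm f x) ((x [^] p) [^] t)"
    using comm_Phi_eigenvector[OF G generating_pair_generate[OF assms(1)] assms(2)] .
  then have "q (comm f x) = q (x [^] p) [^]\<^bsub>Q\<^esub> t"
    using cgr_quotient_map[OF Q] fG G q(5) by simp
  moreover have "t = 0 \<or> t = 1 \<or> t = Suc 1" using t(1) p3 by auto
  moreover have "q (x [^] p) \<in> carrier Q" using q(2) G by simp
  ultimately show ?thesis by auto
qed

text \<open>If no choice of the second generator centralises \<open>[b,a]\<close> modulo \<open>pw Phi\<close>, then neither \<open>a\<close>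
  nor \<open>b\<close> nor \<open>a b\<close> nor \<open>a b^-1\<close> does, and all of them have nonzero eigenvalues.\<close>

lemma generating_pair_exists_central:
  assumes good: "generating_pair a b" and nc: "comm (comm b a) a \<notin> pw Phi"
  shows "\<exists>b'. generating_pair a b' \<and> comm (comm b a) b' \<in> pw Phi"
proof (rule ccontr)
  note q = quotient_mapD[OF Q]
  interpret Q: group Q by (rule q(1))
  interpret V: comm_group "Q\<lparr>carrier := V\<rparr>" by (rule comm_group_V)
  assume none: "\<not> ?thesis"
  have G: "a \<in> carrier G" "b \<in> carrier G" using good by (auto simp: generating_pair_def)
  let ?c = "comm b a"
  have c: "?c \<in> Phi" "?c \<in> carrier G" using comm_in_Phi G by auto
  have K: "q (comm ?c z) = \<one>\<^bsub>Q\<^esub> \<longleftrightarrow> comm ?c z \<in> pw Phi" if "z \<in> carrier G" for z using that c q(7) by simp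
  note good' = generating_pair_product[OF good]
  note sym = generating_pair_sym
  let ?A = "q (a [^] p)" and ?B = "q (b [^] p)" and ?E = "q (comm ?c a)" and ?F = "q (comm ?c b)"
  let ?T = "q ((a \<otimes> b) [^] p)"
  have E: "?E \<noteq> \<one>\<^bsub>Q\<^esub>" and F: "?F \<noteq> \<one>\<^bsub>Q\<^esub>" using K nc none good G by auto
  have V: "?A \<in> V" "?B \<in> V" "?E \<in> V" "?F \<in> V" using pow_in_pw G comm_Phi_in_pwG[OF c(1)] by auto
  have EF: "q (comm ?c (a \<otimes> b)) = ?E \<otimes>\<^bsub>Q\<^esub> ?F" using q_comm_mult_right[OF c(1)] G by simp
  have EFF: "q (comm ?c (a \<otimes> inv b)) = ?E \<otimes>\<^bsub>Q\<^esub> (?F \<otimes>\<^bsub>Q\<^esub> ?F)"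
    using q_comm_mult_right[OF c(1)] q_comm_inv_right[OF c(1)] V_inv[OF V(4)] G by simp
  have ne: "?E \<otimes>\<^bsub>Q\<^esub> ?F \<noteq> \<one>\<^bsub>Q\<^esub>" "?E \<otimes>\<^bsub>Q\<^esub> (?F \<otimes>\<^bsub>Q\<^esub> ?F) \<noteq> \<one>\<^bsub>Q\<^esub>"
    using K[of "a \<otimes> b"] K[of "a \<otimes> inv b"] none good' G EF EFF by auto
  have T: "?T = ?A \<otimes>\<^bsub>Q\<^esub> ?B \<otimes>\<^bsub>Q\<^esub> ?E \<otimes>\<^bsub>Q\<^esub> ?F \<otimes>\<^bsub>Q\<^esub> ?F" using q_cube_mult G by simp
  have "?E = ?A \<or> ?E = ?A \<otimes>\<^bsub>Q\<^esub> ?A" using generating_pair_eigenvalue[OF good c(1)] E by blast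
  moreover have "?F = ?B \<or> ?F = ?B \<otimes>\<^bsub>Q\<^esub> ?B" using generating_pair_eigenvalue[OF sym[OF good] c(1)] F by blast
  moreover have "?E \<otimes>\<^bsub>Q\<^esub> ?F = ?T \<or> ?E \<otimes>\<^bsub>Q\<^esub> ?F = ?T \<otimes>\<^bsub>Q\<^esub> ?T"
    using generating_pair_eigenvalue[OF sym[OF good'(1)] c(1)] ne(1) EF by simp
  ultimately show False
    using V.exponent_3_no_eigenvectors[of ?A ?B ?E ?F ?T] V V_cube E F ne T by simp
qed

lemma generating_pair_central_eigenvectors:
  assumes good: "generating_pair a b" and nc: "comm (comm b a) a \<notin> pw Phi" and cb: "comm (comm b a) b \<in> pw Phi"
  defines "A \<equiv> q (a [^] p)" and "B \<equiv> q (b [^] p)" and "E \<equiv> q (comm (comm b a) a)"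
  shows "E = A \<and> B = A \<otimes>\<^bsub>Q\<^esub> A \<or> E = A \<otimes>\<^bsub>Q\<^esub> A \<and> B = A"
proof -
  note q = quotient_mapD[OF Q]
  interpret Q: group Q by (rule q(1))
  interpret V: comm_group "Q\<lparr>carrier := V\<rparr>" by (rule comm_group_V)
  have G: "a \<in> carrier G" "b \<in> carrier G" using good by (auto simp: generating_pair_def)
  let ?c = "comm b a"
  have c: "?c \<in> Phi" "?c \<in> carrier G" using comm_in_Phi G by auto
  have c1: "comm (inv b) a \<in> Phi" using comm_in_Phi G by auto
  have Eb: "q (comm ?c b) = \<one>\<^bsub>Q\<^esub>" using cb c G q(7) by simp
  have En: "E \<noteq> \<one>\<^bsub>Q\<^esub>" using nc c G q(7) unfolding E_def by simp
  have V: "A \<in> V" "B \<in> V" "E \<in> V" using pow_in_pw G comm_Phi_in_pwG[OF c(1)] unfolding A_def B_def E_def by auto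
  have VQ: "A \<in> carrier Q" "B \<in> carrier Q" "E \<in> carrier Q" using q(2) G unfolding A_def B_def E_def by auto
  note good' = generating_pair_product[OF good, THEN generating_pair_sym]
  let ?T = "q ((a \<otimes> b) [^] p)" and ?U = "q ((a \<otimes> inv b) [^] p)"
  have T: "?T = A \<otimes>\<^bsub>Q\<^esub> B \<otimes>\<^bsub>Q\<^esub> E" using q_cube_mult[OF G] Eb VQ unfolding A_def B_def E_def by simp
  have "q ((inv b) [^] p) = B \<otimes>\<^bsub>Q\<^esub> B"
    using q(4)[of "b [^] p"] G V_inv[OF V(2)] unfolding B_def by (simp add: nat_pow_inv)
  moreover have "q (comm (comm (inv b) a) a) = E \<otimes>\<^bsub>Q\<^esub> E"
    using q_comm_inv_generator[OF G G(1)] V_inv[OF V(3)] unfolding E_def by simp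
  moreover have "q (comm (comm (inv b) a) (inv b)) = \<one>\<^bsub>Q\<^esub>"
    using q_comm_inv_right[OF c1 G(2)] q_comm_inv_generator[OF G G(2)] Eb by simp
  ultimately have U: "?U = A \<otimes>\<^bsub>Q\<^esub> B \<otimes>\<^bsub>Q\<^esub> B \<otimes>\<^bsub>Q\<^esub> E \<otimes>\<^bsub>Q\<^esub> E"
    using q_cube_mult[of a "inv b"] G VQ unfolding A_def by (simp add: Q.m_assoc)
  have ET: "q (comm ?c (a \<otimes> b)) = E" "q (comm ?c (a \<otimes> inv b)) = E"
    using q_comm_mult_right[OF c(1)] q_comm_inv_right[OF c(1)] Eb VQ(3) G unfolding E_def by auto
  have "E = A \<or> E = A \<otimes>\<^bsub>Q\<^esub> A" using generating_pair_eigenvalue[OF good c(1)] En unfolding A_def E_def by blast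
  moreover have "E = ?T \<or> E = ?T \<otimes>\<^bsub>Q\<^esub> ?T"
    using generating_pair_eigenvalue[OF good'(1) c(1)] En ET by simp
  moreover have "E = ?U \<or> E = ?U \<otimes>\<^bsub>Q\<^esub> ?U"
    using generating_pair_eigenvalue[OF good'(2) c(1)] En ET by simp
  ultimately show ?thesis
    using V.exponent_3_eigenvectors[of A B E ?T ?U] V V_cube En T U by simp
qed

text \<open>After the choice of \<open>b\<close> that centralises \<open>Phi\<close> modulo \<open>pw Phi\<close> only two possibilities are
  left, and they are interchanged when \<open>b\<close> is replaced by its inverse.\<close>

lemma exceptional_pair_mod:
  assumes ncentral: "f \<in> Phi" "g \<in> carrier G" "comm f g \<notin> pw Phi"
  shows "\<exists>a b. generating_pair a b \<and> q (comm (comm b a) a) = q (a [^] p) \<and> q (b [^] p) = inv\<^bsub>Q\<^esub> q (a [^] p)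
    \<and> q (comm (comm b a) b) = \<one>\<^bsub>Q\<^esub> \<and> q (a [^] p) \<noteq> \<one>\<^bsub>Q\<^esub>"
proof -
  note q = quotient_mapD[OF Q]
  interpret Q: group Q by (rule q(1))
  note sym = generating_pair_sym
  obtain x y where "x \<in> carrier G" "y \<in> carrier G" "comm x y \<notin> pw (carrier G)" using noncommuting_pair .
  then have g: "generating_pair y x" by (simp add: generating_pair_def)
  then have xyG: "y \<in> carrier G" "x \<in> carrier G" by (auto simp: generating_pair_def)
  have "\<exists>a b. generating_pair a b \<and> comm (comm b a) a \<notin> pw Phi"
  proof (rule ccontr)
    assume "\<not> ?thesis"
    then have 1: "comm (comm x y) y \<in> pw Phi" "comm (comm y x) x \<in> pw Phi" using g sym[OF g] by auto
    have "comm f' z \<in> pw Phi" if "f' \<in> Phi" "z \<in> {y, x}" for f' z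
      using generating_pair_central[OF g _ 1(1)] generating_pair_central[OF sym[OF g] _ 1(2)] that xyG by auto
    then have "comm f g \<in> pw Phi"
      using comm_generate[OF normal_pw_Phi Phi_carrier, of "{y, x}" f g] generating_pair_generate[OF g] ncentral xyG
        by (auto intro: generate.incl)
    then show False using ncentral by blast
  qed
  then obtain a b0 where ab0: "generating_pair a b0" "comm (comm b0 a) a \<notin> pw Phi" by blast
  have aG: "a \<in> carrier G" using ab0 by (simp add: generating_pair_def)
  obtain b where b: "generating_pair a b" "comm (comm b0 a) b \<in> pw Phi" using generating_pair_exists_central[OF ab0] by blast
  have bG: "b \<in> carrier G" using b by (simp add: generating_pair_def)
  have cen: "comm f b \<in> pw Phi" if "f \<in> Phi" for f using generating_pair_central[OF ab0(1) bG b(2) that] .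
  have nc: "comm (comm b' a) a \<notin> pw Phi" if "generating_pair a b'" for b'
    using generating_pair_central[OF that aG] ab0 comm_in_Phi aG by (auto simp: generating_pair_def)
  have AV: "q (a [^] p) \<in> V" using pow_in_pw[OF aG] by blast
  have AQ: "q (a [^] p) \<in> carrier Q" using q(2) aG by simp
  have An: "q (a [^] p) \<noteq> \<one>\<^bsub>Q\<^esub>" if "generating_pair a b'" for b'
    using generating_pair_eigenvalue[OF that, of "comm b' a"] nc[OF that] comm_in_Phi aG that q(7)[of "comm (comm b' a) a"]
    by (auto simp: generating_pair_def)
  have concl: ?thesis if gb: "generating_pair a b'" and cb: "comm (comm b' a) b' \<in> pw Phi"
    and E: "q (comm (comm b' a) a) = q (a [^] p)" "q (b' [^] p) = q (a [^] p) \<otimes>\<^bsub>Q\<^esub> q (a [^] p)" for b'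
  proof -
    have "q (comm (comm b' a) b') = \<one>\<^bsub>Q\<^esub>" using cb gb q(7)[of "comm (comm b' a) b'"] by (auto simp: generating_pair_def)
    then show ?thesis using gb E An[OF gb] V_inv[OF AV] by (intro exI[of _ a] exI[of _ b']) simp
  qed
  have cb: "comm (comm b a) b \<in> pw Phi" using cen comm_in_Phi aG bG by blast
  from generating_pair_central_eigenvectors[OF b(1) nc[OF b(1)] cb] show ?thesis
  proof
    assume "q (comm (comm b a) a) = q (a [^] p) \<and> q (b [^] p) = q (a [^] p) \<otimes>\<^bsub>Q\<^esub> q (a [^] p)"
    then show ?thesis using concl[OF b(1) cb] by blast
  next
    assume 2: "q (comm (comm b a) a) = q (a [^] p) \<otimes>\<^bsub>Q\<^esub> q (a [^] p) \<and> q (b [^] p) = q (a [^] p)"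
    have "inv (inv b) \<in> generate G {a, inv b}" by (rule generate.inv) simp
    then have gi: "generating_pair a (inv b)" using generating_pair_change[OF b(1), of "inv b"] bG by simp
    have ci: "comm (comm (inv b) a) (inv b) \<in> pw Phi"
    proof -
      have c1: "comm (inv b) a \<in> Phi" using comm_in_Phi aG bG by auto
      then have "q (comm (comm (inv b) a) b) = \<one>\<^bsub>Q\<^esub>" using cen[OF c1] q(7)[of "comm (comm (inv b) a) b"] aG bG by simp
      then show ?thesis using q_comm_inv_right[OF c1 bG] q(7)[of "comm (comm (inv b) a) (inv b)"] aG bG by simp
    qed
    have Bi: "q (inv b [^] p) = q (a [^] p) \<otimes>\<^bsub>Q\<^esub> q (a [^] p)"
      using q(4)[of "b [^] p"] 2 bG V_inv[OF AV] by (simp add: nat_pow_inv)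
    from generating_pair_central_eigenvectors[OF gi nc[OF gi] ci] show ?thesis
    proof
      assume "q (comm (comm (inv b) a) a) = q (a [^] p) \<and> q (inv b [^] p) = q (a [^] p) \<otimes>\<^bsub>Q\<^esub> q (a [^] p)"
      then show ?thesis using concl[OF gi ci] by blast
    next
      assume "q (comm (comm (inv b) a) a) = q (a [^] p) \<otimes>\<^bsub>Q\<^esub> q (a [^] p) \<and> q (inv b [^] p) = q (a [^] p)"
      then have "q (a [^] p) \<otimes>\<^bsub>Q\<^esub> q (a [^] p) = q (a [^] p) \<otimes>\<^bsub>Q\<^esub> \<one>\<^bsub>Q\<^esub>" using Bi AQ by simp
      then have "q (a [^] p) = \<one>\<^bsub>Q\<^esub>" using AQ by simp
      then show ?thesis using An[OF gi] by blast
    qed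
  qed
qed

end
end
end

context group
begin

text \<open>The defining relations of the exceptional group in its two generators \<open>a1\<close> and \<open>a2\<close>: here
  \<open>a3\<close> is \<open>[a2, a1]\<close> and \<open>a4\<close> is \<open>a1^3\<close>. The last condition excludes proper quotients.\<close>

definition J_generators :: "'a \<Rightarrow> 'a \<Rightarrow> bool" where
  "J_generators a b \<longleftrightarrow> a \<in> carrier G \<and> b \<in> carrier G \<and> generate G {a, b} = carrier G \<and>
     comm (comm b a) a = a [^] (3::nat) \<and> b [^] (3::nat) = inv (a [^] (3::nat)) \<and>
     comm (comm b a) b = \<one> \<and> comm b a [^] (3::nat) = \<one> \<and>
     (a [^] (3::nat)) [^] (3::nat) = \<one> \<and> a [^] (3::nat) \<noteq> \<one>"

lemma cube_mult_class_2:
  assumes "x \<in> carrier G" "y \<in> carrier G" "comm (comm y x) x = \<one>" "comm (comm y x) y = \<one>"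
  shows "(x \<otimes> y) [^] (3::nat) = x [^] (3::nat) \<otimes> y [^] (3::nat) \<otimes> comm y x [^] (3::nat)"
proof -
  have n: "(3 choose 2) = (3::nat)" by (simp add: numeral_3_eq_3 numeral_2_eq_2)
  show ?thesis using power_of_product_class_3[of x y 3] assms by (simp add: n)
qed

end

context nonpowerful_M1_group
begin

lemma exceptional_pair:
  assumes p3: "p = 3" and nc: "f \<in> Phi" "g \<in> carrier G" "comm f g \<notin> pw Phi"
  obtains a b where "a \<in> carrier G" "b \<in> carrier G" "comm b a \<notin> pw (carrier G)"
    "cgr (pw Phi) (comm (comm b a) a) (a [^] p)" "cgr (pw Phi) (b [^] p) (inv (a [^] p))"
    "comm (comm b a) b \<in> pw Phi" "a [^] p \<notin> pw Phi"
proof -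
  obtain Q :: "'a set monoid" and q where Q: "quotient_map (pw Phi) (carrier G) Q q"
    using quotient_map_exists[OF normal_pw_Phi] by blast
  note q = quotient_mapD[OF Q]
  obtain a b where ab: "generating_pair a b" "q (comm (comm b a) a) = q (a [^] p)"
    "q (b [^] p) = inv\<^bsub>Q\<^esub> q (a [^] p)" "q (comm (comm b a) b) = \<one>\<^bsub>Q\<^esub>" "q (a [^] p) \<noteq> \<one>\<^bsub>Q\<^esub>"
    using exceptional_pair_mod[OF Q p3 nc] by blast
  have G: "a \<in> carrier G" "b \<in> carrier G" "comm b a \<notin> pw (carrier G)"
    using ab(1) by (auto simp: generating_pair_def[OF Q p3])
  show thesis
    using ab(2-5) G q(4)[of "a [^] p"] q(7)[of "a [^] p"] q(7)[of "comm (comm b a) b"]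
    by (intro that[of a b]) (auto simp: cgr_quotient_map[OF Q])
qed

text \<open>The relations hold modulo \<open>pw Phi\<close> for a suitable pair. The subgroup \<open>W\<close> generated by
  \<open>a^3\<close> and \<open>pw Phi\<close> contains all cubes, so it is \<open>pw G\<close>. Modulo \<open>pw (pw G)\<close> it is central,
  which gives first \<open>[b,a]^3 \<in> pw (pw G)\<close>, so that \<open>pw Phi\<close> is contained in \<open>pw (pw G)\<close>, and
  then that \<open>pw G\<close> is generated by \<open>a^3\<close> alone and also by \<open>b^3\<close> alone. So \<open>pw G\<close> is central
  in \<open>G\<close>. Computing \<open>(b [b,a])^3\<close> and \<open>(a [a,b])^3\<close>, which are cubes of conjugates, places
  \<open>[b,a]^3\<close> and then \<open>a^9\<close> into the third iterate of \<open>pw\<close>. Hence \<open>pw (pw G)\<close> equals its own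
  subgroup of cubes, and so it is trivial.\<close>

theorem exceptional_structure:
  assumes p3: "p = 3" and nc: "f \<in> Phi" "g \<in> carrier G" "comm f g \<notin> pw Phi"
  shows "\<exists>a b. J_generators a b"
proof -
  obtain a b where G [simp]: "a \<in> carrier G" "b \<in> carrier G" and cnP: "comm b a \<notin> pw (carrier G)"
    and E1: "cgr (pw Phi) (comm (comm b a) a) (a [^] p)" and E2: "cgr (pw Phi) (b [^] p) (inv (a [^] p))"
    and E3: "comm (comm b a) b \<in> pw Phi" and E4: "a [^] p \<notin> pw Phi"
    using exceptional_pair[OF assms] .
  let ?c = "comm b a" and ?N = "pw Phi" and ?P = "pw (carrier G)"
  have gen: "generate G {a, b} = carrier G" using generate_pair[OF G(2,1) cnP] by (simp add: insert_commute)
  have c: "?c \<in> Phi" "?c \<in> carrier G" using comm_in_Phi by auto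
  note nN = normal_pw_Phi and N = normal_inD(1)[OF normal_pw_Phi]
  have NG: "?N \<subseteq> carrier G" using subgroup.subset[OF N] .
  have self: "comm x x = \<one>" if "x \<in> carrier G" for x using that by (simp add: comm_eq_one_iff)
  have aP: "a [^] p \<in> ?P" "b [^] p \<in> ?P" using pow_in_pw by auto

  \<comment> \<open>Modulo \<open>W\<close> both generators have trivial cubes and the power map is multiplicative; so
    all cubes lie in \<open>W\<close>.\<close>
  let ?W = "generate G (insert (a [^] p) ?N)"
  have nW: "normal_in ?W (carrier G)" using comm_pwG[OF aP(1)] by (intro normal_in_generate_insert[OF nN]) auto
  note W = normal_inD(1)[OF nW]
  have NW: "?N \<subseteq> ?W" and aW: "a [^] p \<in> ?W" by (auto intro: generate.incl)
  have "?c \<in> generate G (insert ?c ?P)" by (auto intro: generate.incl)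
  have "comm ?c a \<in> ?W" using cgr_member[OF W NW _ _ E1 aW] by simp
  then have cW: "comm u z \<in> ?W" if "u \<in> insert ?c ?P" "z \<in> {a, b}" for u z
    using that E3 NW comm_pwG[of u z] G by blast
  have PhiW: "comm f z \<in> ?W" if "f \<in> Phi" "z \<in> carrier G" for f z
  proof (rule comm_generate[OF nW, of "insert ?c ?P" "{a, b}"])
    show "insert ?c ?P \<subseteq> carrier G" "{a, b} \<subseteq> carrier G" using pwG_carrier by auto
    show "f \<in> generate G (insert ?c ?P)" "z \<in> generate G {a, b}"
      using that gen Phi_eq_generate[OF G(2,1) cnP] by auto
  qed (rule cW)
  have bW: "b [^] p \<in> ?W" using cgr_member[OF W NW _ _ E2] aW subgroup.m_inv_closed[OF W] by simp
  have "z \<in> carrier G \<and> z [^] p \<in> ?W" if "z \<in> generate G {a, b}" for z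
    using that
  proof (induction rule: generate.induct)
    case one
    then show ?case using subgroup.one_closed[OF W] by simp
  next
    case (incl z)
    then show ?case using aW bW by auto
  next
    case (inv z)
    then have z: "z \<in> carrier G" "z [^] p \<in> ?W" using aW bW by auto
    then show ?case using subgroup.m_inv_closed[OF W z(2)] by (simp add: nat_pow_inv)
  next
    case (eng x y)
    then have xy: "x \<in> carrier G" "y \<in> carrier G" by auto
    have "cgr ?W ((x \<otimes> y) [^] p) (x [^] p \<otimes> y [^] p)"
      using PhiW comm_in_Phi[OF xy(2,1)] pow_in_pw[OF comm_in_Phi[OF xy(2,1)]] NW xy
      by (intro power_of_product_class_2_mod[OF nW xy]) auto
    moreover have "x [^] p \<otimes> y [^] p \<in> ?W" using eng subgroup.m_closed[OF W] by blast
    ultimately show ?case using cgr_member[OF W order_refl] xy by (meson m_closed nat_pow_closed)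
  qed
  then have "{z [^] p | z. z \<in> carrier G} \<subseteq> ?W" using gen by auto
  then have "generate G {z [^] p | z. z \<in> carrier G} \<subseteq> ?W" by (rule generate_subgroup_incl[OF _ W])
  then have PW: "?P \<subseteq> ?W" by (simp flip: pw_def)

  \<comment> \<open>Since \<open>a^3\<close> and \<open>b^3\<close> are inverse to each other modulo \<open>pw Phi\<close>, and \<open>pw Phi\<close> is central
    modulo \<open>pw (pw G)\<close>, both are central modulo \<open>pw (pw G)\<close>.\<close>
  let ?P3 = "pw ?P"
  note nP3 = normal_pw_pwG and P3 = normal_inD(1)[OF normal_pw_pwG]
  have NP3: "comm n z \<in> ?P3" if n: "n \<in> ?N" and z: "z \<in> carrier G" for n z
  proof (rule comm_generate_left[OF nP3 _ z _ n[unfolded pw_def[of Phi]]])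
    fix u assume "u \<in> {h [^] p | h. h \<in> Phi}"
    then obtain f where f: "f \<in> Phi" "u = f [^] p" by blast
    obtain M where M: "maximal_subgroup M G" "z \<in> M" using maximal_containing z by blast
    have "f \<in> M" using f Phi_in_maximal[OF M(1)] by blast
    then have "u \<in> (pw ^^ 1) M" using pow_in_pw f(2) by simp
    then have "comm u z \<in> pw (pw M)" using powerful_comm[OF powerful_maximal[OF M(1)] _ M(2), of u 1] by simp
    then show "comm u z \<in> ?P3" using pw_maximal_subset(3)[OF M(1)] by blast
  qed (use Phi_carrier in auto)
  have aWb: "a [^] p \<in> generate G (insert (b [^] p) ?N)"
  proof -
    have K: "subgroup (generate G (insert (b [^] p) ?N)) G" using NG by (intro generate_is_subgroup) auto
    have bK: "b [^] p \<in> generate G (insert (b [^] p) ?N)" by (auto intro: generate.incl)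
    have "?N \<subseteq> generate G (insert (b [^] p) ?N)" by (auto intro: generate.incl)
    then have "inv (a [^] p) \<in> generate G (insert (b [^] p) ?N)"
      using cgr_member[OF K _ _ _ cgr_sym[OF N _ _ E2] bK] by simp
    from subgroup.m_inv_closed[OF K this] show ?thesis by simp
  qed
  have "comm (a [^] p) b \<in> ?P3"
  proof (rule comm_generate_left[OF nP3 _ G(2) _ aWb])
    show "insert (b [^] p) ?N \<subseteq> carrier G" using NG by auto
    show "comm u b \<in> ?P3" if "u \<in> insert (b [^] p) ?N" for u
      using that NP3 subgroup.one_closed[OF P3] comm_eq_one_iff[of "b [^] p" b] nat_pow_comm[of b p 1] by auto
  qed
  moreover have "comm (a [^] p) a \<in> ?P3"
    using subgroup.one_closed[OF P3] comm_eq_one_iff[of "a [^] p" a] nat_pow_comm[of a p 1] by auto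
  ultimately have apc: "comm (a [^] p) z \<in> ?P3" if "z \<in> {a, b}" for z using that by blast
  have cen: "comm u z \<in> ?P3" if "u \<in> ?P" "z \<in> carrier G" for u z
  proof (rule comm_generate[OF nP3, of "insert (a [^] p) ?N" "{a, b}"])
    show "insert (a [^] p) ?N \<subseteq> carrier G" "{a, b} \<subseteq> carrier G" using NG by auto
    show "u \<in> ?W" "z \<in> generate G {a, b}" using that gen PW by auto
    show "comm u z \<in> ?P3" if "u \<in> insert (a [^] p) ?N" "z \<in> {a, b}" for u z
      using that NP3[of u z] apc[of z] G by blast
  qed

  \<comment> \<open>The element \<open>a [a,b]\<close> is conjugate to \<open>a\<close>. Its cube can be computed in two ways, and
    this bounds the cube of \<open>[a,b]\<close>.\<close>
  have ic: "comm a b = inv ?c" by (simp add: inv_commutator)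
  let ?y = "comm a b" let ?z = "comm ?y a"
  have y: "?y \<in> Phi" "?y \<in> carrier G" using comm_in_Phi by auto
  have z: "?z \<in> ?P" using comm_Phi_in_pwG[OF y(1)] by simp
  have "cgr ?P3 ((a \<otimes> ?y) [^] p) (a [^] p \<otimes> ?y [^] p)"
    using cen[OF z] pow_in_pw[OF z] by (intro power_of_product_class_2_mod[OF nP3]) auto
  then have "cgr ?P3 (comm (a [^] p) b) (?y [^] p)"
    by (simp add: pow_mult_comm cgr_cancel_left)
  then have "cgr ?P3 (?y [^] p) (comm (a [^] p) b)" using cgr_sym[OF P3] by simp
  then have "?y [^] p \<in> ?P3" using cgr_member[OF P3 order_refl] cen[OF aP(1) G(2)] by (meson G comm_closed nat_pow_closed)
  then have "inv (?y [^] p) \<in> ?P3" using subgroup.m_inv_closed[OF P3] by blast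
  then have cP3: "?c [^] p \<in> ?P3" using ic by (simp flip: nat_pow_inv)

  \<comment> \<open>Now the cubes of all generators of \<open>Phi\<close> lie in \<open>pw (pw G)\<close>.\<close>
  have "?N = generate G {s [^] p | s. s \<in> insert ?c {g [^] p | g. g \<in> carrier G}}"
    using powerful_pw_generate[OF powerful_Phi Phi_generators[OF G(2,1) cnP]] .
  also have "\<dots> \<subseteq> ?P3" using cP3 pow_in_pw by (intro generate_subgroup_incl[OF _ P3]) auto
  finally have NP: "?N \<subseteq> ?P3" .
  have "?W \<subseteq> generate G ({a [^] p} \<union> ?P3)" using NP by (intro mono_generate) auto
  then have Pa: "generate G {a [^] p} = ?P" using PW aP(1) by (intro pw_superfluous[OF pwG_subgroup]) auto
  have "?P \<subseteq> generate G ({b [^] p} \<union> ?P3)"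
  proof -
    have K: "subgroup (generate G ({b [^] p} \<union> ?P3)) G"
      using subgroup.subset[OF P3] by (intro generate_is_subgroup) auto
    have "generate G (insert (b [^] p) ?N) \<subseteq> generate G ({b [^] p} \<union> ?P3)" using NP by (intro mono_generate) auto
    then have "{a [^] p} \<subseteq> generate G ({b [^] p} \<union> ?P3)" using aWb by blast
    from generate_subgroup_incl[OF this K] show ?thesis unfolding Pa .
  qed
  then have Pb: "generate G {b [^] p} = ?P" using aP(2) by (intro pw_superfluous[OF pwG_subgroup]) auto

  note n1 = normal_in_one[OF subgroup_self]
  have pa: "comm (a [^] p) a = \<one>" "comm (b [^] p) b = \<one>"
    using comm_eq_one_iff[of "a [^] p" a] comm_eq_one_iff[of "b [^] p" b] nat_pow_comm[of a p 1] nat_pow_comm[of b p 1]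
    by auto
  have "comm (a [^] p) b \<in> {\<one>}"
    using comm_generate_left[OF n1, of "{b [^] p}" b "a [^] p"] pa Pb aP by auto
  then have cen1: "comm u z = \<one>" if "u \<in> ?P" "z \<in> carrier G" for u z
    using comm_generate[OF n1, of "{a [^] p}" "{a, b}" u z] that gen Pa pa by auto
  have com: "u \<otimes> z = z \<otimes> u" if "u \<in> ?P" "z \<in> carrier G" for u z
    using cen1[OF that] that pwG_carrier comm_eq_one_iff[of u z] by auto

  \<comment> \<open>With \<open>pw G\<close> central the two computations become exact and push everything one level
    further down.\<close>
  let ?P9 = "pw ?P3"
  have P9: "subgroup ?P9 G" using subgroup.subset[OF P3] by simp
  have powP9: "u [^] p \<in> ?P9" if "u \<in> ?N" for u using that NP pow_in_pw by blast
  have cb: "comm ?c b \<in> ?P" using E3 pw_Phi_in_pwG by blast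
  have "(b \<otimes> ?c) [^] p = b [^] p"
    using pow_mult_comm[of b a p] cen1[OF aP(2) G(1)] by simp
  moreover have "(b \<otimes> ?c) [^] p = b [^] p \<otimes> ?c [^] p \<otimes> comm ?c b [^] p"
    using cube_mult_class_2[of b ?c] cen1[OF cb] p3 by simp
  ultimately have "?c [^] p \<otimes> comm ?c b [^] p = \<one>" by (simp add: m_assoc)
  then have "?c [^] p = inv (comm ?c b [^] p)" by (intro inv_equality[symmetric]) auto
  then have c9: "?c [^] p \<in> ?P9" using powP9[OF E3] subgroup.m_inv_closed[OF P9] by simp
  have "(a \<otimes> ?y) [^] p = a [^] p"
    using pow_mult_comm[of a b p] cen1[OF aP(1) G(2)] by simp
  moreover have "(a \<otimes> ?y) [^] p = a [^] p \<otimes> ?y [^] p \<otimes> ?z [^] p"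
    using cube_mult_class_2[of a ?y] cen1[OF z] p3 by simp
  ultimately have "?y [^] p \<otimes> ?z [^] p = \<one>" by (simp add: m_assoc)
  moreover have "?c [^] p \<otimes> ?y [^] p = \<one>" using ic by (simp add: nat_pow_inv)
  ultimately have "?z [^] p = ?c [^] p" by (metis G comm_closed inv_equality inv_inv nat_pow_closed)
  moreover have "comm ?c a = inv ?z"
  proof -
    have "comm (?y \<otimes> ?c) a = (?z \<otimes> comm ?z ?c) \<otimes> comm ?c a"
      by (simp add: comm_def m_assoc inv_mult_group)
    moreover have "?y \<otimes> ?c = \<one>" using ic by simp
    moreover have "comm \<one> a = \<one>" by (simp add: comm_def)
    moreover have "comm ?z ?c = \<one>" by (rule cen1[OF z c(2)])
    ultimately have "\<one> = ?z \<otimes> comm ?c a" by (metis G comm_closed r_one)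
    then have "comm ?c a \<otimes> ?z = \<one>" using com[OF z, of "comm ?c a"] by simp
    then have "inv ?z = comm ?c a" by (rule inv_equality) simp_all
    then show ?thesis by (rule HOL.sym)
  qed
  ultimately have ca9: "comm ?c a [^] p \<in> ?P9"
    using c9 subgroup.m_inv_closed[OF P9, of "?z [^] p"] by (simp add: nat_pow_inv)
  obtain \<phi> where phi: "\<phi> \<in> ?N" "comm ?c a = a [^] p \<otimes> \<phi>"
    using E1 cgr_iff_mult[OF _ _ N, of "comm ?c a" "a [^] p"] by auto
  have phiG: "\<phi> \<in> carrier G" using phi NG by blast
  have "comm ?c a [^] p = (a [^] p) [^] p \<otimes> \<phi> [^] p"
    unfolding phi(2) using com[OF aP(1) phiG] phiG by (intro pow_mult_distrib) auto
  then have "(a [^] p) [^] p = comm ?c a [^] p \<otimes> inv (\<phi> [^] p)" using phiG by (simp add: m_assoc)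
  moreover have "comm ?c a [^] p \<otimes> inv (\<phi> [^] p) \<in> ?P9"
    using ca9 powP9[OF phi(1)] by (intro subgroup.m_closed[OF P9] subgroup.m_inv_closed[OF P9])
  ultimately have a9: "(a [^] p) [^] p \<in> ?P9" by simp
  have "?P3 = generate G {s [^] p | s. s \<in> {a [^] p}}"
    using aP(1) Pa by (intro powerful_pw_generate powerful_pwG) auto
  also have "\<dots> \<subseteq> ?P9" using a9 by (intro generate_subgroup_incl[OF _ P9]) auto
  finally have P31: "?P3 = {\<one>}" by (rule pw_eq_self_imp_trivial[OF P3])
  then have N1: "?N = {\<one>}" using NP subgroup.one_closed[OF N] by blast
  have "\<phi> = \<one>" using phi(1) N1 by simp
  then have F1: "comm ?c a = a [^] p" using phi(2) by simp
  have "a [^] p \<otimes> b [^] p = \<one>" using E2 N1 by (simp add: cgr_def)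
  then have F2: "b [^] p = inv (a [^] p)" using com[OF aP(1), of "b [^] p"] by (intro inv_equality[THEN HOL.sym]) auto
  have F3: "comm ?c b = \<one>" "a [^] p \<noteq> \<one>" using E3 E4 N1 by simp_all
  have F4: "?c [^] p = \<one>" using c9 P31 by simp
  have F5: "(a [^] p) [^] p = \<one>" using pow_in_pw[OF aP(1)] P31 by simp
  have "J_generators a b"
    unfolding J_generators_def p3[symmetric] using gen F1 F2 F3 F4 F5 by simp
  then show ?thesis by blast
qed

end

section \<open>The exceptional relations and a normal form\<close>

locale J_group = group G for G (structure) +
  fixes a b :: 'a
  assumes J: "J_generators a b"
begin

definition c :: 'a where "c = comm b a"
definition d :: 'a where "d = a [^] (3::nat)"

lemma closed [simp]: "a \<in> carrier G" "b \<in> carrier G" "c \<in> carrier G" "d \<in> carrier G"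
  using J by (auto simp: J_generators_def c_def d_def)

lemma gen: "generate G {a, b} = carrier G"
  using J by (simp add: J_generators_def)

lemma relations:
  "comm c a = d" "b [^] (3::nat) = inv d" "comm c b = \<one>" "c [^] (3::nat) = \<one>" "d [^] (3::nat) = \<one>" "d \<noteq> \<one>"
  using J by (simp_all add: J_generators_def c_def d_def)

lemma d_central: "g \<in> carrier G \<Longrightarrow> d \<otimes> g = g \<otimes> d"
proof -
  assume g: "g \<in> carrier G"
  have "d = inv (b [^] (3::nat))" by (simp add: relations)
  then have "comm d b = \<one>"
    using nat_pow_comm[of b 3 1] comm_eq_one_iff[of d b]
      comm_generate_left[OF normal_in_one[OF subgroup_self], of "{b [^] (3::nat)}" b d]
      comm_eq_one_iff[of "b [^] (3::nat)" b]
    by (auto intro: generate.inv)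
  moreover have "comm d a = \<one>"
    using nat_pow_comm[of a 3 1] comm_eq_one_iff[of d a] by (simp add: d_def)
  ultimately have "comm d g \<in> {\<one>}"
    using comm_generate[OF normal_in_one[OF subgroup_self], of "{d}" "{a, b}" d g] gen g
    by (auto intro: generate.incl)
  then show ?thesis using g by (simp add: comm_eq_one_iff)
qed

lemma commute:
  "b \<otimes> a = a \<otimes> b \<otimes> c" "c \<otimes> a = a \<otimes> c \<otimes> d" "c \<otimes> b = b \<otimes> c"
  using mult_comm_swap[of b a] mult_comm_swap[of c a] mult_comm_swap[of c b] relations
  by (auto simp: c_def[symmetric])

lemma d_pow_central: "g \<in> carrier G \<Longrightarrow> d [^] (n::nat) \<otimes> g = g \<otimes> d [^] n"
  using group_commutes_pow[OF d_central] by simp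

lemma d_pow_left: "g \<in> carrier G \<Longrightarrow> h \<in> carrier G \<Longrightarrow> d [^] (n::nat) \<otimes> (g \<otimes> h) = g \<otimes> (d [^] n \<otimes> h)"
  using d_pow_central[of g n] by (simp flip: m_assoc)

lemma c_pow_a: "c [^] (n::nat) \<otimes> a = a \<otimes> (c [^] n \<otimes> d [^] n)"
proof (induction n)
  case (Suc n)
  have "c [^] Suc n \<otimes> a = c [^] n \<otimes> (a \<otimes> c \<otimes> d)" using commute(2) by (simp add: m_assoc)
  also have "\<dots> = c [^] n \<otimes> a \<otimes> c \<otimes> d" by (simp add: m_assoc)
  also have "\<dots> = a \<otimes> (c [^] Suc n \<otimes> d [^] Suc n)" unfolding Suc by (simp add: m_assoc d_pow_left)
  finally show ?case .
qed simp

lemma cb_pow: "c [^] (k::nat) \<otimes> b [^] (j::nat) = b [^] j \<otimes> c [^] k"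
  using commuting_powers[OF commute(3)] by simp

lemma b_pow_a: "b [^] (n::nat) \<otimes> a = a \<otimes> (b [^] n \<otimes> c [^] n)"
proof (induction n)
  case (Suc n)
  have cb: "c [^] n \<otimes> b = b \<otimes> c [^] n" using cb_pow[of n 1] by simp
  have "b [^] Suc n \<otimes> a = b [^] n \<otimes> (a \<otimes> b \<otimes> c)" using commute(1) by (simp add: m_assoc)
  also have "\<dots> = b [^] n \<otimes> a \<otimes> b \<otimes> c" by (simp add: m_assoc)
  also have "\<dots> = a \<otimes> (b [^] n \<otimes> (c [^] n \<otimes> b) \<otimes> c)" unfolding Suc by (simp add: m_assoc)
  also have "\<dots> = a \<otimes> (b [^] Suc n \<otimes> c [^] Suc n)" unfolding cb by (simp add: m_assoc)
  finally show ?case .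
qed simp

lemma bc_a: "b [^] (j::nat) \<otimes> c [^] (k::nat) \<otimes> a = a \<otimes> (b [^] j \<otimes> c [^] k) \<otimes> (c [^] j \<otimes> d [^] k)"
proof -
  have "b [^] j \<otimes> c [^] k \<otimes> a = b [^] j \<otimes> a \<otimes> (c [^] k \<otimes> d [^] k)"
    by (simp add: m_assoc c_pow_a)
  then show ?thesis
    unfolding b_pow_a by (simp add: m_assoc nat_pow_mult add.commute flip: m_assoc[of "c [^] j"] m_assoc[of "c [^] k" "c [^] j"])
qed

lemma d_pow_eq_iff:
  assumes "i < 3" "j < 3"
  shows "d [^] (i::nat) = d [^] j \<longleftrightarrow> i = j"
proof -
  have ne: "d [^] (2::nat) \<noteq> \<one>"
  proof
    assume "d [^] (2::nat) = \<one>"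
    then have "d [^] (3::nat) = d" by (simp add: numeral_3_eq_3 numeral_2_eq_2)
    then show False using relations by simp
  qed
  have "d \<noteq> d [^] (2::nat)" using relations(6) by (simp add: numeral_2_eq_2)
  then have ne2: "d [^] (2::nat) \<noteq> d" by metis
  have "i = 0 \<or> i = 1 \<or> i = 2" "j = 0 \<or> j = 1 \<or> j = 2" using assms by auto
  then show ?thesis
    using ne ne[symmetric] ne2 ne2[symmetric] relations(6) relations(6)[symmetric] by (elim disjE) simp_all
qed

lemma pow_mod:
  fixes n m :: nat
  assumes "x \<in> carrier G" "x [^] m = \<one>"
  shows "x [^] n = x [^] (n mod m)"
proof -
  have "x [^] n = x [^] (m * (n div m)) \<otimes> x [^] (n mod m)" using assms(1) by (simp add: nat_pow_mult)
  also have "x [^] (m * (n div m)) = \<one>" using assms by (simp flip: nat_pow_pow)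
  finally show ?thesis using assms(1) by simp
qed

lemma d_eq: "d = b [^] (6::nat)" and b9: "b [^] (9::nat) = \<one>"
proof -
  have "b [^] (6::nat) = b [^] (3::nat) \<otimes> b [^] (3::nat)" by (simp add: nat_pow_mult)
  also have "\<dots> = inv (d \<otimes> d)" by (simp add: relations inv_mult_group)
  also have "\<dots> = d" using relations(5) by (intro inv_equality) (simp_all add: numeral_3_eq_3 m_assoc)
  finally show "d = b [^] (6::nat)" ..
  then have "b [^] (3 + 6::nat) = b [^] (3::nat) \<otimes> d" by (simp add: nat_pow_mult del: add_numeral_left numeral_plus_numeral)
  then show "b [^] (9::nat) = \<one>" by (simp add: relations)
qed

text \<open>The set of normal forms is closed under right multiplication by generators.\<close>

lemma normal_form:
  assumes "g \<in> carrier G"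
  obtains i j k where "i < (3::nat)" "j < (9::nat)" "k < (3::nat)" "g = a [^] i \<otimes> (b [^] j \<otimes> c [^] k)"
proof -
  define S where "S = {a [^] i \<otimes> (b [^] j \<otimes> c [^] k) | (i::nat) (j::nat) (k::nat). True}"
  have SG: "s \<in> carrier G" if "s \<in> S" for s using that by (auto simp: S_def)
  have Sa: "s \<otimes> a \<in> S" if s: "s \<in> S" for s
  proof -
    obtain i j k :: nat where "s = a [^] i \<otimes> (b [^] j \<otimes> c [^] k)" using s unfolding S_def by blast
    then have "s \<otimes> a = a [^] i \<otimes> (b [^] j \<otimes> c [^] k \<otimes> a)" by (simp add: m_assoc)
    also have "\<dots> = a [^] Suc i \<otimes> (b [^] j \<otimes> c [^] (k + j) \<otimes> d [^] k)"
      unfolding bc_a by (simp add: m_assoc flip: nat_pow_mult)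
    also have "\<dots> = a [^] Suc i \<otimes> (d [^] k \<otimes> b [^] j \<otimes> c [^] (k + j))"
      by (simp add: m_assoc d_pow_central d_pow_left)
    also have "\<dots> = a [^] Suc i \<otimes> (b [^] (6 * k + j) \<otimes> c [^] (k + j))"
      by (simp add: d_eq nat_pow_pow flip: nat_pow_mult)
    finally show ?thesis unfolding S_def by blast
  qed
  have Sb: "s \<otimes> b \<in> S" if s: "s \<in> S" for s
  proof -
    obtain i j k :: nat where "s = a [^] i \<otimes> (b [^] j \<otimes> c [^] k)" using s unfolding S_def by blast
    then have "s \<otimes> b = a [^] i \<otimes> (b [^] j \<otimes> (c [^] k \<otimes> b))" by (simp add: m_assoc)
    also have "\<dots> = a [^] i \<otimes> (b [^] Suc j \<otimes> c [^] k)" using cb_pow[of k 1] by (simp add: m_assoc)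
    finally show ?thesis unfolding S_def by blast
  qed
  have a9: "a [^] (9::nat) = \<one>" using relations(5) by (simp add: d_def nat_pow_pow)
  have pw: "s \<otimes> x [^] (n::nat) \<in> S" if "s \<in> S" "x \<in> {a, b}" for s x n
    using that
  proof (induction n)
    case 0
    then have "s \<in> carrier G" using SG by blast
    then have "s \<otimes> x [^] (0::nat) = s" by simp
    then show ?case using 0(1) by metis
  next
    case (Suc n)
    have "s \<in> carrier G" "x \<in> carrier G" using Suc.prems SG by auto
    then have "s \<otimes> x [^] Suc n = s \<otimes> x [^] n \<otimes> x" by (simp add: m_assoc)
    moreover have "s \<otimes> x [^] n \<in> S" using Suc by blast
    ultimately show ?case using Sa[of "s \<otimes> x [^] n"] Sb[of "s \<otimes> x [^] n"] Suc.prems(2) by auto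
  qed
  have inv9: "inv x = x [^] (8::nat)" if "x \<in> {a, b}" for x
  proof -
    have "x [^] (8::nat) \<otimes> x = x [^] (9::nat)" by (metis nat_pow_Suc eval_nat_numeral(3) semiring_norm(27))
    also have "\<dots> = \<one>" using a9 b9 that by auto
    finally show ?thesis using that by (intro inv_equality) auto
  qed
  have "h \<in> carrier G \<and> (\<forall>s\<in>S. s \<otimes> h \<in> S)" if "h \<in> generate G {a, b}" for h
    using that
  proof (induction rule: generate.induct)
    case one
    have "s \<otimes> \<one> = s" if "s \<in> S" for s using SG[OF that] by simp
    then show ?case by simp
  next
    case (incl h)
    then show ?case using Sa Sb by auto
  next
    case (inv h)
    then show ?case using pw[of _ h 8] inv9[OF inv] by auto
  next
    case (eng h k)
    have "s \<otimes> (h \<otimes> k) \<in> S" if s: "s \<in> S" for s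
    proof -
      have "s \<in> carrier G" using s by (rule SG)
      then have "s \<otimes> (h \<otimes> k) = s \<otimes> h \<otimes> k" using eng by (simp add: m_assoc)
      then show ?thesis using eng s by simp
    qed
    then show ?case using eng by simp
  qed
  moreover have "\<one> = a [^] (0::nat) \<otimes> (b [^] (0::nat) \<otimes> c [^] (0::nat))" by simp
  then have "\<one> \<in> S" unfolding S_def by blast
  ultimately have "\<one> \<otimes> g \<in> S" using gen assms by blast
  then obtain i j k :: nat where "g = a [^] i \<otimes> (b [^] j \<otimes> c [^] k)" using assms by (auto simp: S_def)
  moreover have "a [^] i = a [^] (i mod 3) \<otimes> b [^] (6 * (i div 3))"
  proof -
    have "a [^] i = a [^] (i mod 3) \<otimes> a [^] (3 * (i div 3))" by (simp add: nat_pow_mult)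
    also have "a [^] (3 * (i div 3)) = b [^] (6 * (i div 3))" using d_eq by (simp add: d_def flip: nat_pow_pow)
    finally show ?thesis .
  qed
  ultimately have "g = a [^] (i mod 3) \<otimes> (b [^] (6 * (i div 3) + j) \<otimes> c [^] k)"
    by (simp add: m_assoc flip: nat_pow_mult)
  then have "g = a [^] (i mod 3) \<otimes> (b [^] ((6 * (i div 3) + j) mod 9) \<otimes> c [^] (k mod 3))"
    using pow_mod[OF closed(2) b9, of "6 * (i div 3) + j"] pow_mod[OF closed(3) relations(4), of k] by simp
  then show thesis by (rule that[rotated 3]) simp_all
qed

text \<open>Commuting with \<open>c\<close> detects the exponent of \<open>a\<close>, which is the reason why normal forms are
  unique.\<close>

lemma c_conj_normal_form:
  "c \<otimes> (a [^] (i::nat) \<otimes> (b [^] (j::nat) \<otimes> c [^] (k::nat))) = a [^] i \<otimes> (b [^] j \<otimes> c [^] k) \<otimes> c \<otimes> d [^] i"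
proof (induction i)
  case 0
  have "c \<otimes> b [^] j = b [^] j \<otimes> c" using cb_pow[of 1 j] by simp
  then have "c \<otimes> (b [^] j \<otimes> c [^] k) = b [^] j \<otimes> (c \<otimes> c [^] k)" by (simp flip: m_assoc)
  also have "c \<otimes> c [^] k = c [^] k \<otimes> c" using nat_pow_Suc2[of c k] by simp
  finally show ?case by (simp add: m_assoc)
next
  case (Suc i)
  let ?w = "b [^] j \<otimes> c [^] k"
  have "c \<otimes> (a [^] Suc i \<otimes> ?w) = (c \<otimes> a) \<otimes> (a [^] i \<otimes> ?w)"
    using nat_pow_Suc2[of a i] by (simp add: m_assoc)
  also have "\<dots> = a \<otimes> (c \<otimes> (a [^] i \<otimes> ?w)) \<otimes> d"
    unfolding commute(2) by (simp add: m_assoc d_central)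
  also have "\<dots> = a [^] Suc i \<otimes> ?w \<otimes> c \<otimes> d [^] Suc i"
    unfolding Suc using nat_pow_Suc2[of a i] by (simp add: m_assoc)
  finally show ?case .
qed

text \<open>Commutation with \<open>c\<close> recovers \<open>i\<close>, commutation with \<open>a\<close> recovers \<open>j\<close> modulo three and then
  \<open>k\<close>, and finally the relation between \<open>b^3\<close> and \<open>d\<close> separates the remaining values of \<open>j\<close>.\<close>

lemma normal_form_unique:
  assumes bounds: "i < (3::nat)" "i' < 3" "j < (9::nat)" "j' < 9" "k < (3::nat)" "k' < 3"
    and eq: "a [^] i \<otimes> (b [^] j \<otimes> c [^] k) = a [^] i' \<otimes> (b [^] j' \<otimes> c [^] k')"
  shows "i = i' \<and> j = j' \<and> k = k'"
proof -
  let ?w = "b [^] j \<otimes> c [^] k" and ?w' = "b [^] j' \<otimes> c [^] k'"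
  have "a [^] i \<otimes> ?w \<otimes> c \<otimes> d [^] i = a [^] i \<otimes> ?w \<otimes> c \<otimes> d [^] i'"
    using c_conj_normal_form[of i j k] c_conj_normal_form[of i' j' k'] eq by simp
  then have "d [^] i = d [^] i'" by simp
  \<comment> \<open>The first comparison uses \<open>c\<close>, the second one \<open>a\<close>.\<close>
  then have i: "i = i'" using d_pow_eq_iff bounds by simp
  then have w: "?w = ?w'" using eq by simp
  then have v: "c [^] j \<otimes> d [^] k = c [^] j' \<otimes> d [^] k'"
    using bc_a[of j k] bc_a[of j' k'] by (simp add: m_assoc)
  have va: "c [^] j \<otimes> d [^] k \<otimes> a = a \<otimes> (c [^] j \<otimes> d [^] k) \<otimes> d [^] j" for j k :: nat
  proof -
    have "c [^] j \<otimes> d [^] k \<otimes> a = c [^] j \<otimes> a \<otimes> d [^] k" by (simp add: m_assoc d_pow_central)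
    also have "\<dots> = a \<otimes> (c [^] j \<otimes> (d [^] j \<otimes> d [^] k))" unfolding c_pow_a by (simp add: m_assoc)
    also have "\<dots> = a \<otimes> (c [^] j \<otimes> d [^] k) \<otimes> d [^] j" by (simp add: m_assoc nat_pow_mult add.commute)
    finally show ?thesis .
  qed
  have "a \<otimes> (c [^] j \<otimes> d [^] k) \<otimes> d [^] j = a \<otimes> (c [^] j \<otimes> d [^] k) \<otimes> d [^] j'"
    using va[of j k] va[of j' k'] v by simp
  then have "d [^] j = d [^] j'" by simp
  then have "d [^] (j mod 3) = d [^] (j' mod 3)" using pow_mod[OF closed(4) relations(5)] by metis
  then have j3: "j mod 3 = j' mod 3" by (simp add: d_pow_eq_iff)
  then have "c [^] j = c [^] j'" using pow_mod[OF closed(3) relations(4)] by metis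
  then have "d [^] k = d [^] k'" using v by simp
  then have k: "k = k'" using d_pow_eq_iff bounds by simp
  then have bj: "b [^] j = b [^] j'" using w by simp
  have bjd: "b [^] j = b [^] (j mod 3) \<otimes> inv (d [^] (j div 3))" for j :: nat
  proof -
    have "b [^] j = b [^] (j mod 3) \<otimes> (b [^] (3::nat)) [^] (j div 3)" by (simp add: nat_pow_pow nat_pow_mult)
    then show ?thesis by (simp add: relations nat_pow_inv)
  qed
  have "inv (d [^] (j div 3)) = inv (d [^] (j' div 3))" using bj bjd[of j] bjd[of j'] j3 by simp
  then have "d [^] (j div 3) = d [^] (j' div 3)" by (metis closed(4) inv_inv nat_pow_closed)
  then have "j div 3 = j' div 3" using d_pow_eq_iff[of "j div 3" "j' div 3"] bounds by simp
  then have "j = j'" using j3 by (metis mult_div_mod_eq)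
  then show ?thesis using i k by simp
qed

theorem order_81: "order G = 81"
proof -
  let ?f = "\<lambda>(i, j, k). a [^] (i::nat) \<otimes> (b [^] (j::nat) \<otimes> c [^] (k::nat))"
  let ?D = "{..<3::nat} \<times> {..<9::nat} \<times> {..<3::nat}"
  have "bij_betw ?f ?D (carrier G)"
    unfolding bij_betw_def
  proof
    show "inj_on ?f ?D"
      by (rule inj_onI) (use normal_form_unique in fastforce)
    show "?f ` ?D = carrier G"
    proof
      show "?f ` ?D \<subseteq> carrier G" by auto
      show "carrier G \<subseteq> ?f ` ?D"
      proof
        fix g assume "g \<in> carrier G"
        then obtain i j k where "i < (3::nat)" "j < (9::nat)" "k < (3::nat)" "g = a [^] i \<otimes> (b [^] j \<otimes> c [^] k)"
          by (rule normal_form)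
        then show "g \<in> ?f ` ?D" by (intro image_eqI[of _ _ "(i, j, k)"]) auto
      qed
    qed
  qed
  from bij_betw_same_card[OF this] show ?thesis by (simp add: order_def card_cartesian_product)
qed

end

section \<open>Cubes in the exceptional group\<close>

context J_group
begin

text \<open>The subgroups \<open>D\<close> and \<open>T\<close> turn out to be the last two nontrivial terms of the lower
  central series.\<close>

definition D :: "'a set" where "D = generate G {d}"
definition T :: "'a set" where "T = generate G (insert c D)"

lemma comm_eqI:
  assumes "y \<otimes> x = x \<otimes> y \<otimes> z" "x \<in> carrier G" "y \<in> carrier G" "z \<in> carrier G"
  shows "comm y x = z"
  using assms mult_comm_swap[of y x] by simp

lemma D_subgroup: "subgroup D G" unfolding D_def by (intro generate_is_subgroup) auto

lemma d_in_D: "d \<in> D" "d [^] (n::nat) \<in> D" "inv (d [^] n) \<in> D"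
proof -
  show d: "d \<in> D" by (simp add: D_def generate.incl)
  show "d [^] n \<in> D" using subgroup_pow_closed[OF is_group D_subgroup d] .
  then show "inv (d [^] n) \<in> D" by (rule subgroup.m_inv_closed[OF D_subgroup])
qed

lemma D_subset: "D \<subseteq> {\<one>, d, d \<otimes> d}"
proof
  fix x assume "x \<in> D"
  have d3: "d \<otimes> (d \<otimes> d) = \<one>" using relations(5) by (simp add: numeral_3_eq_3 m_assoc)
  have "inv d = d \<otimes> d" using d3 by (intro inv_equality) (simp_all add: m_assoc)
  moreover have "d \<otimes> d \<otimes> (d \<otimes> d) = d" using d3 by (simp add: m_assoc)
  moreover note d3
  moreover from \<open>x \<in> D\<close> have "x \<in> generate G {d}" by (simp add: D_def)
  then have "x = \<one> \<or> x = d \<or> x = d \<otimes> d"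
  proof (induction rule: generate.induct)
    case (eng x y)
    then show ?case using d3 \<open>d \<otimes> d \<otimes> (d \<otimes> d) = d\<close> by (auto simp: m_assoc)
  qed (use \<open>inv d = d \<otimes> d\<close> in auto)
  ultimately show "x \<in> {\<one>, d, d \<otimes> d}" by simp
qed

lemma comm_D: "x \<in> D \<Longrightarrow> g \<in> carrier G \<Longrightarrow> comm x g = \<one>"
  using comm_generate_left[OF normal_in_one[OF subgroup_self], of "{d}" g x] d_central[of g]
  by (auto simp: D_def comm_eq_one_iff)

lemma normal_D: "normal_in D (carrier G)"
  using D_subgroup subgroup_self subgroup.subset[OF D_subgroup] subgroup.one_closed[OF D_subgroup]
  by (auto simp: normal_in_def comm_D)

lemma comm_c:
  assumes "g \<in> carrier G"
  shows "comm c g \<in> D"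
proof (rule comm_generate[OF normal_D, of "{c}" "{a, b}"])
  show "comm x y \<in> D" if "x \<in> {c}" "y \<in> {a, b}" for x y
    using that relations(1,3) d_in_D(1) subgroup.one_closed[OF D_subgroup] by auto
  show "g \<in> generate G {a, b}" using gen assms by simp
qed (auto intro: generate.incl)

lemma normal_T: "normal_in T (carrier G)"
  unfolding T_def using comm_c by (intro normal_in_generate_insert[OF normal_D]) auto

lemma D_in_T: "D \<subseteq> T" and c_in_T: "c \<in> T"
  by (auto simp: T_def intro: generate.incl)

lemma comm_T:
  assumes "t \<in> T" "g \<in> carrier G"
  shows "comm t g \<in> D"
proof (rule comm_generate_left[OF normal_D _ assms(2) _ assms(1)[unfolded T_def]])
  show "insert c D \<subseteq> carrier G" using subgroup.subset[OF D_subgroup] by auto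
  show "comm x g \<in> D" if "x \<in> insert c D" for x
    using that comm_c[OF assms(2)] comm_D[OF _ assms(2)] subgroup.one_closed[OF D_subgroup] by auto
qed

lemma comm_in_T: "g \<in> carrier G \<Longrightarrow> h \<in> carrier G \<Longrightarrow> comm g h \<in> T"
proof -
  assume gh: "g \<in> carrier G" "h \<in> carrier G"
  note Ts = normal_inD(1)[OF normal_T]
  have "comm b a \<in> T" using c_in_T by (simp add: c_def)
  moreover then have "comm a b \<in> T" using subgroup.m_inv_closed[OF Ts, of "comm b a"] by (simp add: inv_commutator)
  moreover have "comm a a = \<one>" "comm b b = \<one>" by (simp_all add: comm_eq_one_iff)
  ultimately have "comm x y \<in> T" if "x \<in> {a, b}" "y \<in> {a, b}" for x y
    using that subgroup.one_closed[OF Ts] by auto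
  then show ?thesis
    by - (rule comm_generate[OF normal_T, of "{a, b}" "{a, b}" g h], use gen gh in auto)
qed

lemma commutes_c_iff:
  assumes "i < (3::nat)"
  shows "c \<otimes> (a [^] i \<otimes> (b [^] (j::nat) \<otimes> c [^] (k::nat))) = a [^] i \<otimes> (b [^] j \<otimes> c [^] k) \<otimes> c \<longleftrightarrow> i = 0"
proof
  let ?x = "a [^] i \<otimes> (b [^] j \<otimes> c [^] k)"
  assume "c \<otimes> ?x = ?x \<otimes> c"
  then have "?x \<otimes> c \<otimes> d [^] i = ?x \<otimes> c" using c_conj_normal_form[of i j k] by simp
  then have "d [^] i = d [^] (0::nat)" by simp
  then show "i = 0" using d_pow_eq_iff[OF assms, of 0] by simp
qed (use c_conj_normal_form[of i j k] in simp)

lemma T_commutes_c: "t \<in> T \<Longrightarrow> c \<otimes> t = t \<otimes> c"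
proof -
  assume t: "t \<in> T"
  have tG: "t \<in> carrier G" using t normal_inD(3)[OF normal_T] by blast
  have "comm t c \<in> {\<one>}"
  proof (rule comm_generate_left[OF normal_in_one[OF subgroup_self] _ closed(3) _ t[unfolded T_def]])
    show "insert c D \<subseteq> carrier G" using subgroup.subset[OF D_subgroup] by auto
    show "comm x c \<in> {\<one>}" if "x \<in> insert c D" for x
      using that comm_D[of x c] comm_eq_one_iff[of c c] by auto
  qed
  then show ?thesis using tG by (simp add: comm_eq_one_iff)
qed

lemma T_normal_form:
  assumes "t \<in> T"
  shows "\<exists>j\<in>{0, 3, 6}. \<exists>k<3. t = b [^] (j::nat) \<otimes> c [^] (k::nat)"
proof -
  have tG: "t \<in> carrier G" using assms normal_inD(3)[OF normal_T] by blast
  then obtain i j k where t: "i < (3::nat)" "j < (9::nat)" "k < (3::nat)" "t = a [^] i \<otimes> (b [^] j \<otimes> c [^] k)"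
    by (rule normal_form)
  have "i = 0" using T_commutes_c[OF assms] commutes_c_iff[OF t(1), of j k] unfolding t(4) by blast
  then have t': "t = b [^] j \<otimes> c [^] k" using t(4) by simp
  have "comm t a = c [^] j \<otimes> d [^] k" unfolding t' using bc_a[of j k] by (intro comm_eqI) auto
  then have "c [^] j \<otimes> d [^] k \<in> D" using comm_T[OF assms, of a] by simp
  from comm_D[OF this, of a] have "c [^] j \<otimes> d [^] k \<otimes> a = a \<otimes> (c [^] j \<otimes> d [^] k)"
    by (simp add: comm_eq_one_iff)
  moreover have "c [^] j \<otimes> d [^] k \<otimes> a = a \<otimes> (c [^] j \<otimes> d [^] k) \<otimes> d [^] j"
  proof -
    have "c [^] j \<otimes> d [^] k \<otimes> a = c [^] j \<otimes> a \<otimes> d [^] k" by (simp add: m_assoc d_pow_central)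
    also have "\<dots> = a \<otimes> (c [^] j \<otimes> (d [^] j \<otimes> d [^] k))" unfolding c_pow_a by (simp add: m_assoc)
    also have "\<dots> = a \<otimes> (c [^] j \<otimes> d [^] k) \<otimes> d [^] j" by (simp add: m_assoc nat_pow_mult add.commute)
    finally show ?thesis .
  qed
  ultimately have "d [^] j = \<one>" by simp
  then have "d [^] (j mod 3) = d [^] (0::nat)" using pow_mod[OF closed(4) relations(5), of j] by simp
  then have "j mod 3 = 0" using d_pow_eq_iff[of "j mod 3" 0] by simp
  then have "j \<in> {0, 3, 6}" using t(2) by (auto; presburger)
  then show ?thesis using t' t(3) by blast
qed

lemma card_T: "finite T" "card T \<le> 9"
proof -
  have "T \<subseteq> (\<lambda>(j, k). b [^] j \<otimes> c [^] k) ` ({0, 3, 6::nat} \<times> {..<3::nat})"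
    using T_normal_form by fastforce
  moreover have f: "finite ({0, 3, 6::nat} \<times> {..<3::nat})" by simp
  ultimately show "finite T" "card T \<le> 9"
    using finite_subset[OF _ finite_imageI[OF f]] surj_card_le[OF f, of T "\<lambda>(j, k). b [^] j \<otimes> c [^] k"]
    by (auto simp: card_cartesian_product)
qed

lemma bc_cube: "(b [^] (j::nat) \<otimes> c [^] (k::nat)) [^] (3::nat) = inv (d [^] j)"
proof -
  have "(b [^] j \<otimes> c [^] k) [^] (3::nat) = (b [^] j) [^] (3::nat) \<otimes> (c [^] k) [^] (3::nat)"
    using cb_pow[of k j] by (intro pow_mult_distrib) auto
  also have "\<dots> = (b [^] (3::nat)) [^] j \<otimes> (c [^] (3::nat)) [^] k" by (simp add: nat_pow_pow mult.commute)
  finally show ?thesis by (simp add: relations nat_pow_inv)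
qed

lemma cube_formula:
  assumes x: "x \<in> carrier G" and y: "y \<in> carrier G" and z: "comm y x = z" "z [^] (3::nat) = \<one>"
    and e: "comm z x \<in> D" and f: "comm z y = \<one>"
  shows "(x \<otimes> y) [^] (3::nat) = x [^] (3::nat) \<otimes> y [^] (3::nat) \<otimes> comm z x"
proof -
  have n: "(3 choose 2) = (3::nat)" by (simp add: numeral_3_eq_3 numeral_2_eq_2)
  have zG: "z \<in> carrier G" using z x y by auto
  have "comm z x \<otimes> g = g \<otimes> comm z x" if "g \<in> carrier G" for g
    using comm_D[OF e that] zG x that by (simp add: comm_eq_one_iff)
  then show ?thesis using power_of_product_class_3[of x y 3] x y z f zG by (simp add: n)
qed

lemma cd_a: "c [^] (j::nat) \<otimes> d [^] (k::nat) \<otimes> a = a \<otimes> (c [^] j \<otimes> d [^] k) \<otimes> d [^] j"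
proof -
  have "c [^] j \<otimes> d [^] k \<otimes> a = c [^] j \<otimes> a \<otimes> d [^] k" by (simp add: m_assoc d_pow_central)
  also have "\<dots> = a \<otimes> (c [^] j \<otimes> (d [^] j \<otimes> d [^] k))" unfolding c_pow_a by (simp add: m_assoc)
  also have "\<dots> = a \<otimes> (c [^] j \<otimes> d [^] k) \<otimes> d [^] j" by (simp add: m_assoc nat_pow_mult add.commute)
  finally show ?thesis .
qed

lemma cd_cube: "(c [^] (j::nat) \<otimes> d [^] (k::nat)) [^] (3::nat) = \<one>"
proof -
  have "(c [^] j \<otimes> d [^] k) [^] (3::nat) = (c [^] j) [^] (3::nat) \<otimes> (d [^] k) [^] (3::nat)"
    using d_pow_central[of "c [^] j" k] by (intro pow_mult_distrib) auto
  also have "\<dots> = (c [^] (3::nat)) [^] j \<otimes> (d [^] (3::nat)) [^] k" by (simp add: nat_pow_pow mult.commute)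
  finally show ?thesis by (simp add: relations)
qed

lemma comm_cd_bc: "comm (c [^] (l::nat) \<otimes> d [^] (m::nat)) (b [^] (j::nat) \<otimes> c [^] (k::nat)) = \<one>"
proof -
  have "c [^] l \<otimes> d [^] m \<otimes> (b [^] j \<otimes> c [^] k) = c [^] l \<otimes> (b [^] j \<otimes> c [^] k) \<otimes> d [^] m"
    by (simp add: m_assoc d_pow_central d_pow_left)
  also have "c [^] l \<otimes> (b [^] j \<otimes> c [^] k) = b [^] j \<otimes> (c [^] l \<otimes> c [^] k)"
    using cb_pow[of l j] by (simp flip: m_assoc)
  also have "c [^] l \<otimes> c [^] k = c [^] k \<otimes> c [^] l" by (simp add: nat_pow_mult add.commute)
  finally show ?thesis by (simp add: comm_eq_one_iff m_assoc)
qed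

text \<open>The twist by \<open>j\<close> in the commutator cancels the cube of \<open>b^j c^k\<close>, so the cube does not
  depend on \<open>j\<close> and \<open>k\<close>.\<close>

lemma cube_a:
  fixes j k :: nat
  shows "(a \<otimes> (b [^] j \<otimes> c [^] k)) [^] (3::nat) = d"
proof -
  let ?w = "b [^] j \<otimes> c [^] k" and ?v = "c [^] j \<otimes> d [^] k"
  have e: "comm ?v a = d [^] j" using cd_a[of j k] by (intro comm_eqI) auto
  have "(a \<otimes> ?w) [^] (3::nat) = a [^] (3::nat) \<otimes> ?w [^] (3::nat) \<otimes> comm ?v a"
  proof (rule cube_formula)
    show "comm ?w a = ?v" using bc_a[of j k] by (intro comm_eqI) auto
    show "comm ?v a \<in> D" using e d_in_D by simp
  qed (use cd_cube comm_cd_bc in auto)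
  then show ?thesis by (simp add: e bc_cube d_def[symmetric] m_assoc)
qed

lemma cube_aa:
  fixes j k :: nat
  shows "(a [^] (2::nat) \<otimes> (b [^] j \<otimes> c [^] k)) [^] (3::nat) = d \<otimes> d"
proof -
  let ?w = "b [^] j \<otimes> c [^] k" and ?v = "c [^] j \<otimes> d [^] k" and ?v' = "c [^] (2 * j) \<otimes> d [^] (j + 2 * k)"
  let ?x = "a [^] (2::nat)"
  have x: "?x = a \<otimes> a" by (simp add: numeral_2_eq_2)
  have v': "?v \<otimes> ?v \<otimes> d [^] j = ?v'"
  proof -
    have "?v \<otimes> ?v \<otimes> d [^] j = c [^] j \<otimes> (d [^] k \<otimes> c [^] j) \<otimes> (d [^] k \<otimes> d [^] j)"
      by (simp add: m_assoc)
    also have "\<dots> = (c [^] j \<otimes> c [^] j) \<otimes> (d [^] k \<otimes> (d [^] k \<otimes> d [^] j))"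
      unfolding d_pow_central[OF nat_pow_closed[OF closed(3)]] by (simp add: m_assoc)
    also have "\<dots> = ?v'" by (simp add: nat_pow_mult mult_2 add_ac)
    finally show ?thesis .
  qed
  have w: "comm ?w ?x = ?v'"
  proof (rule comm_eqI)
    have "?w \<otimes> ?x = ?w \<otimes> a \<otimes> a" by (simp add: x m_assoc)
    also have "\<dots> = a \<otimes> ?w \<otimes> (?v \<otimes> a)" unfolding bc_a by (simp add: m_assoc)
    also have "\<dots> = a \<otimes> (?w \<otimes> a) \<otimes> ?v \<otimes> d [^] j" unfolding cd_a by (simp add: m_assoc)
    also have "\<dots> = ?x \<otimes> ?w \<otimes> (?v \<otimes> ?v \<otimes> d [^] j)" unfolding bc_a by (simp add: x m_assoc)
    finally show "?w \<otimes> ?x = ?x \<otimes> ?w \<otimes> ?v'" unfolding v' .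
  qed auto
  have e: "comm ?v' ?x = d [^] (4 * j)"
  proof (rule comm_eqI)
    have "?v' \<otimes> ?x = ?v' \<otimes> a \<otimes> a" by (simp add: x m_assoc)
    also have "\<dots> = a \<otimes> ?v' \<otimes> (d [^] (2 * j) \<otimes> a)" unfolding cd_a by (simp add: m_assoc)
    also have "\<dots> = a \<otimes> (?v' \<otimes> a) \<otimes> d [^] (2 * j)"
      unfolding d_pow_central[OF closed(1)] by (simp add: m_assoc)
    also have "\<dots> = ?x \<otimes> ?v' \<otimes> (d [^] (2 * j) \<otimes> d [^] (2 * j))" unfolding cd_a by (simp add: x m_assoc)
    finally show "?v' \<otimes> ?x = ?x \<otimes> ?v' \<otimes> d [^] (4 * j)" by (simp add: nat_pow_mult)
  qed auto
  have "(?x \<otimes> ?w) [^] (3::nat) = ?x [^] (3::nat) \<otimes> ?w [^] (3::nat) \<otimes> comm ?v' ?x"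
  proof (rule cube_formula[OF _ _ w])
    show "comm ?v' ?x \<in> D" using e d_in_D by simp
  qed (use cd_cube comm_cd_bc in auto)
  also have "?x [^] (3::nat) = d \<otimes> d"
  proof -
    have "?x [^] (3::nat) = (a [^] (3::nat)) [^] (2::nat)" by (simp add: nat_pow_pow)
    then show ?thesis by (simp add: d_def numeral_2_eq_2)
  qed
  also have "comm ?v' ?x = d [^] j"
    using e pow_mod[OF closed(4) relations(5), of "4 * j"] pow_mod[OF closed(4) relations(5), of j]
    by (simp add: mod_mult_left_eq[of 4 3 j, symmetric])
  finally show ?thesis by (simp add: bc_cube m_assoc)
qed

text \<open>Outside the centraliser of \<open>c\<close> no cube is trivial. Hence the elements with trivial cube
  all lie in \<open>T\<close>, which has only nine elements, although the cubes generate a group of order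
  three.\<close>

lemma cube_cases:
  assumes "g \<in> carrier G"
  shows "c \<otimes> g = g \<otimes> c \<and> g [^] (3::nat) \<in> D \<and> (g [^] (3::nat) = \<one> \<longrightarrow> g \<in> T)
    \<or> c \<otimes> g \<noteq> g \<otimes> c \<and> g [^] (3::nat) \<in> {d, d \<otimes> d}"
proof -
  obtain i j k where g: "i < (3::nat)" "j < (9::nat)" "k < (3::nat)" "g = a [^] i \<otimes> (b [^] j \<otimes> c [^] k)"
    using assms by (rule normal_form)
  have iff: "c \<otimes> g = g \<otimes> c \<longleftrightarrow> i = 0" using commutes_c_iff[OF g(1), of j k] g(4) by simp
  have "i = 0 \<or> i = 1 \<or> i = 2" using g(1) by auto
  then show ?thesis
  proof (elim disjE)
    assume i: "i = 0"
    then have g': "g = b [^] j \<otimes> c [^] k" using g(4) by simp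
    have 3: "g [^] (3::nat) = inv (d [^] j)" using g' bc_cube by simp
    have "g \<in> T" if "g [^] (3::nat) = \<one>"
    proof -
      have "d [^] j = \<one>" using that 3 by (metis closed(4) inv_eq_1_iff nat_pow_closed)
      then have "d [^] (j mod 3) = d [^] (0::nat)" using pow_mod[OF closed(4) relations(5), of j] by simp
      then have "j mod 3 = 0" using d_pow_eq_iff[of "j mod 3" 0] by simp
      then have "j = 3 * (j div 3)" by presburger
      then have "b [^] j = (b [^] (3::nat)) [^] (j div 3)" by (metis closed(2) nat_pow_pow)
      then have "b [^] j = inv (d [^] (j div 3))" by (simp add: relations nat_pow_inv)
      then have "b [^] j \<in> T" using d_in_D(3) D_in_T by auto
      then show ?thesis unfolding g'
        using subgroup.m_closed[OF normal_inD(1)[OF normal_T]] subgroup_pow_closed[OF is_group normal_inD(1)[OF normal_T] c_in_T]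
        by blast
    qed
    then show ?thesis using iff i 3 d_in_D(3) by auto
  next
    assume "i = 1"
    then show ?thesis using iff cube_a[of j k] g(4) by simp
  next
    assume "i = 2"
    then show ?thesis using iff cube_aa[of j k] g(4) by simp
  qed
qed

end

section \<open>The exceptional group among groups with powerful maximal subgroups\<close>

context odd_p_group
begin

lemma mho_substructure:
  assumes "subgroup M G"
  shows "mho p i (G\<lparr>carrier := M\<rparr>) = generate G {g [^] (p ^ i) | g. g \<in> M}"
proof -
  have "{g [^]\<^bsub>G\<lparr>carrier := M\<rparr>\<^esub> (p ^ i) | g. g \<in> carrier (G\<lparr>carrier := M\<rparr>)} = {g [^] (p ^ i) | g. g \<in> M}"
    by (simp add: nat_pow_def)
  then show ?thesis
    using generate_consistent[of "{g [^] (p ^ i) | g. g \<in> M}" M] subgroup_pow_closed[OF is_group assms] assms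
    by (auto simp: mho_def)
qed

text \<open>The two conventions for commutators differ by inverting both arguments, which preserves
  subgroups.\<close>

lemma derived_subset_iff:
  assumes M: "subgroup M G"
  shows "derived G M \<subseteq> pw M \<longleftrightarrow> (\<forall>x\<in>M. \<forall>y\<in>M. comm x y \<in> pw M)"
proof -
  have car: "x \<in> carrier G" if "x \<in> M" for x using that subgroup.mem_carrier[OF M] by blast
  have pM: "subgroup (pw M) G" using subgroup.subset[OF M] by simp
  have eq: "x \<otimes> y \<otimes> inv x \<otimes> inv y = comm (inv x) (inv y)" if "x \<in> M" "y \<in> M" for x y
    using that car by (simp add: comm_def)
  have eq': "comm x y = inv x \<otimes> inv y \<otimes> inv (inv x) \<otimes> inv (inv y)" if "x \<in> M" "y \<in> M" for x y
    using that car by (simp add: comm_def)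
  have i: "inv x \<in> M" if "x \<in> M" for x using that subgroup.m_inv_closed[OF M] by blast
  have "derived G M \<subseteq> pw M \<longleftrightarrow> derived_set G M \<subseteq> pw M"
    unfolding derived_def using generate_subgroup_incl[OF _ pM] generate.incl[of _ "derived_set G M" G] by blast
  also have "\<dots> \<longleftrightarrow> (\<forall>x\<in>M. \<forall>y\<in>M. comm x y \<in> pw M)"
  proof
    assume "derived_set G M \<subseteq> pw M"
    moreover have "comm x y \<in> derived_set G M" if "x \<in> M" "y \<in> M" for x y
      using eq'[OF that] i that by (metis (no_types, lifting) UN_iff singletonI)
    ultimately show "\<forall>x\<in>M. \<forall>y\<in>M. comm x y \<in> pw M" by blast
  next
    assume "\<forall>x\<in>M. \<forall>y\<in>M. comm x y \<in> pw M"
    then show "derived_set G M \<subseteq> pw M" using eq i by auto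
  qed
  finally show ?thesis .
qed

lemma powerful_substructure_iff:
  assumes M: "subgroup M G"
  shows "powerful p (G\<lparr>carrier := M\<rparr>) \<longleftrightarrow> powerful_set M"
proof -
  obtain k where "card M = p ^ k" using card_subgroup[OF M] .
  then have "finite_p_group p (G\<lparr>carrier := M\<rparr>)"
    using subgroup_imp_group[OF M] prime_p by (auto simp: finite_p_group_def order_def)
  moreover have "mho p 1 (G\<lparr>carrier := M\<rparr>) = pw M"
    using mho_substructure[OF M, of 1] by (simp add: pw_def)
  moreover have "derived (G\<lparr>carrier := M\<rparr>) M = derived G M"
    using derived_consistent[OF _ M, of M] by simp
  ultimately show ?thesis
    using derived_subset_iff[OF M] M by (simp add: powerful_def powerful_set_def)
qed

lemma M1_group_iff: "M1_group p G \<longleftrightarrow> (\<forall>M. maximal_subgroup M G \<longrightarrow> powerful_set M)"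
proof -
  have "finite_p_group p G" using prime_p order_p_power is_group by (auto simp: finite_p_group_def)
  then show ?thesis using powerful_substructure_iff maximal_subgroupD(1) by (auto simp: M1_group_def)
qed

end

context J_group
begin

sublocale odd_p_group G 3
proof unfold_locales
  show "Factorial_Ring.prime (3::nat)" by simp
  have "order G = 3 ^ 4" by (simp add: order_81)
  then show "\<exists>n. order G = 3 ^ n" by blast
  show "odd (3::nat)" by simp
qed

lemma cube_in_D: "g \<in> carrier G \<Longrightarrow> g [^] (3::nat) \<in> D"
  using cube_cases[of g] d_in_D(1) subgroup.m_closed[OF D_subgroup] by auto

text \<open>The index of the subgroup of cubes is at least \<open>27\<close>, but at most \<open>9\<close> elements have trivial
  cube.\<close>

theorem not_mho_index_eq_card_Omega: "\<not> mho_index_eq_card_Omega 3 1 G"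
proof -
  let ?m = "mho 3 1 G"
  have m: "?m = pw (carrier G)" by (simp add: mho_def pw_def)
  have ms: "subgroup ?m G" unfolding m by simp
  have "?m \<subseteq> D" unfolding m pw_def using cube_in_D by (intro generate_subgroup_incl[OF _ D_subgroup]) auto
  then have "card ?m \<le> card {\<one>, d, d \<otimes> d}" using D_subset by (intro card_mono) auto
  also have "\<dots> \<le> 3" using card_length[of "[\<one>, d, d \<otimes> d]"] by simp
  finally have "card ?m \<le> 3" .
  moreover have "card (rcosets ?m) * card ?m = 81" using lagrange[OF ms] order_81 by simp
  ultimately have "card (rcosets ?m) * 3 \<ge> 81" by (metis mult_le_mono2)
  moreover have "Omega 3 1 G \<subseteq> T"
    unfolding Omega_def using cube_cases d_pow_eq_iff[of 1 0] relations
  proof (intro generate_subgroup_incl[OF _ normal_inD(1)[OF normal_T]] subsetI)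
    fix g assume "g \<in> {g \<in> carrier G. g [^] ((3::nat) ^ 1) = \<one>}"
    then have g: "g \<in> carrier G" "g [^] (3::nat) = \<one>" by auto
    have "d \<otimes> d \<noteq> \<one>" using d_pow_eq_iff[of 2 0] by (simp add: numeral_2_eq_2)
    then show "g \<in> T" using cube_cases[OF g(1)] g(2) relations(6) by auto
  qed
  then have "card (Omega 3 1 G) \<le> 9" using card_T card_mono le_trans by blast
  ultimately show ?thesis by (simp add: mho_index_eq_card_Omega_def)
qed

text \<open>A maximal subgroup that centralises \<open>c\<close> is abelian, being generated by \<open>b\<close> and \<open>c\<close>. Any
  other maximal subgroup \<open>M\<close> contains some \<open>x\<close> that does not commute with \<open>c\<close>; it is
  generated by \<open>x\<close> and \<open>T\<close>, so its commutators lie in \<open>D\<close>, and the cube of \<open>x\<close> already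
  generates \<open>D\<close>.\<close>

theorem M1_group: "M1_group 3 G"
  unfolding M1_group_iff
proof (intro allI impI)
  fix M assume "maximal_subgroup M G"
  note m = maximal_subgroupD[OF this]
  have car: "x \<in> carrier G" if "x \<in> M" for x using that m(2) by blast
  have pM: "subgroup (pw M) G" using subgroup.subset[OF m(1)] by simp
  have cM: "c \<in> M" using m(5)[of b a] by (simp add: c_def)
  have dM: "d \<in> M" using m(4)[of a] by (simp add: d_def)
  have pow: "x [^] (n::nat) \<in> M" if "x \<in> M" for x n using subgroup_pow_closed[OF is_group m(1) that] .
  have DM: "D \<subseteq> M" unfolding D_def using dM by (intro generate_subgroup_incl[OF _ m(1)]) auto
  have TM: "T \<subseteq> M" unfolding T_def using cM DM by (intro generate_subgroup_incl[OF _ m(1)]) auto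
  show "powerful_set M"
  proof (cases "\<forall>x\<in>M. c \<otimes> x = x \<otimes> c")
    case True
    have nf: "\<exists>j k. x = b [^] (j::nat) \<otimes> c [^] (k::nat)" if x: "x \<in> M" for x
    proof -
      obtain i j k where x: "i < (3::nat)" "j < (9::nat)" "k < (3::nat)" "x = a [^] i \<otimes> (b [^] j \<otimes> c [^] k)"
        using normal_form[OF car[OF x]] by blast
      have "i = 0" using True \<open>x \<in> M\<close> commutes_c_iff[OF x(1), of j k] x(4) by blast
      then show ?thesis using x(4) by auto
    qed
    have "comm x y = \<one>" if xy: "x \<in> M" "y \<in> M" for x y
    proof -
      obtain j k j' k' :: nat where *: "x = b [^] j \<otimes> c [^] k" "y = b [^] j' \<otimes> c [^] k'"
        using nf xy by metis
      have "x \<otimes> y = b [^] j \<otimes> (c [^] k \<otimes> b [^] j') \<otimes> c [^] k'" by (simp add: * m_assoc)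
      also have "\<dots> = b [^] (j + j') \<otimes> c [^] (k + k')" unfolding cb_pow by (simp add: m_assoc flip: nat_pow_mult)
      also have "\<dots> = b [^] j' \<otimes> (b [^] j \<otimes> c [^] k') \<otimes> c [^] k"
        by (simp add: m_assoc add.commute[of j] add.commute[of k] flip: nat_pow_mult)
      also have "\<dots> = y \<otimes> x" unfolding cb_pow[symmetric] by (simp add: * m_assoc)
      finally show ?thesis using car xy by (simp add: comm_eq_one_iff)
    qed
    then show ?thesis using m(1) subgroup.one_closed[OF pM] by (simp add: powerful_set_def)
  next
    case False
    then obtain x where x: "x \<in> M" "c \<otimes> x \<noteq> x \<otimes> c" by blast
    obtain i j k where xn: "i < (3::nat)" "j < (9::nat)" "k < (3::nat)" "x = a [^] i \<otimes> (b [^] j \<otimes> c [^] k)"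
      using normal_form[OF car[OF x(1)]] by blast
    have i: "i = 1 \<or> i = 2" using xn commutes_c_iff[OF xn(1), of j k] x(2) by auto
    have d3: "d \<otimes> (d \<otimes> d) = \<one>" using relations(5) by (simp add: numeral_3_eq_3 m_assoc)
    have "d \<in> pw M"
    proof -
      have "x [^] (3::nat) \<in> pw M" using pow_in_pw[OF x(1)] .
      moreover have "x [^] (3::nat) = d \<or> x [^] (3::nat) = d \<otimes> d" using cube_cases[OF car[OF x(1)]] x(2) by auto
      moreover have "d = (d \<otimes> d) \<otimes> (d \<otimes> d)" using d3 by (simp add: m_assoc)
      ultimately show ?thesis using subgroup.m_closed[OF pM] by metis
    qed
    then have DpM: "D \<subseteq> pw M" unfolding D_def by (intro generate_subgroup_incl[OF _ pM]) auto
    have inT: "y \<in> T" if y: "y \<in> M" "c \<otimes> y = y \<otimes> c" for y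
    proof -
      obtain i' j' k' where yn: "i' < (3::nat)" "j' < (9::nat)" "k' < (3::nat)" "y = a [^] i' \<otimes> (b [^] j' \<otimes> c [^] k')"
        using normal_form[OF car[OF y(1)]] by blast
      have "i' = 0" using commutes_c_iff[OF yn(1), of j' k'] y(2) yn(4) by blast
      then have y': "y = b [^] j' \<otimes> c [^] k'" using yn(4) by simp
      have b3: "b [^] (3::nat) \<in> M" using m(4)[of b] by simp
      have bm: "b [^] j' = b [^] (j' mod 3) \<otimes> (b [^] (3::nat)) [^] (j' div 3)" by (simp add: nat_pow_pow nat_pow_mult)
      have "j' mod 3 = 0"
      proof (rule ccontr)
        assume j': "j' mod 3 \<noteq> 0"
        have "y \<otimes> inv (c [^] k') \<in> M"
          using y(1) pow[OF cM] by (intro subgroup.m_closed[OF m(1)] subgroup.m_inv_closed[OF m(1)])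
        then have "b [^] j' \<in> M" using y' by (simp add: m_assoc)
        moreover have "b [^] (j' mod 3) = b [^] j' \<otimes> inv ((b [^] (3::nat)) [^] (j' div 3))"
          unfolding bm by (simp add: m_assoc)
        ultimately have bmod: "b [^] (j' mod 3) \<in> M"
          using pow[OF b3] by (auto intro: subgroup.m_closed[OF m(1)] subgroup.m_inv_closed[OF m(1)])
        have "j' mod 3 = 1 \<or> j' mod 3 = 2" using j' by auto
        then have bM: "b \<in> M"
        proof
          assume "j' mod 3 = 2"
          then have "b [^] (3::nat) \<otimes> inv (b [^] (2::nat)) \<in> M"
            using bmod b3 by (auto intro: subgroup.m_closed[OF m(1)] subgroup.m_inv_closed[OF m(1)])
          then show ?thesis by (simp add: numeral_3_eq_3 numeral_2_eq_2 m_assoc inv_mult_group)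
        qed (use bmod in simp)
        have "x \<otimes> inv (b [^] j \<otimes> c [^] k) \<in> M"
          using x(1) pow[OF cM] pow[OF bM] by (intro subgroup.m_closed[OF m(1)] subgroup.m_inv_closed[OF m(1)])
        then have ai: "a [^] i \<in> M" using xn(4) by (simp add: m_assoc)
        have "a \<in> M"
          using i
        proof
          assume "i = 2"
          then have "d \<otimes> inv (a [^] (2::nat)) \<in> M"
            using ai dM by (auto intro: subgroup.m_closed[OF m(1)] subgroup.m_inv_closed[OF m(1)])
          then show ?thesis by (simp add: d_def numeral_3_eq_3 numeral_2_eq_2 m_assoc inv_mult_group)
        qed (use ai in simp)
        then have "generate G {a, b} \<subseteq> M" using bM by (intro generate_subgroup_incl[OF _ m(1)]) auto
        then show False using gen m(2) by blast
      qed
      then have "b [^] j' = inv (d [^] (j' div 3))" using bm by (simp add: relations nat_pow_inv)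
      then have "b [^] j' \<in> T" using d_in_D(3) D_in_T by auto
      then show ?thesis unfolding y'
        using subgroup_pow_closed[OF is_group normal_inD(1)[OF normal_T] c_in_T]
        by (intro subgroup.m_closed[OF normal_inD(1)[OF normal_T]])
    qed
    have cx: "c \<otimes> x [^] (n::nat) = x [^] n \<otimes> c \<otimes> d [^] (i * n)" for n
    proof (induction n)
      case (Suc n)
      have xG: "x \<in> carrier G" using car x(1) by blast
      have x1: "c \<otimes> x = x \<otimes> c \<otimes> d [^] i" using c_conj_normal_form[of i j k] xn(4) by simp
      have "c \<otimes> x [^] Suc n = x [^] n \<otimes> c \<otimes> d [^] (i * n) \<otimes> x" using Suc xG by (simp flip: m_assoc)
      also have "\<dots> = x [^] n \<otimes> (c \<otimes> x) \<otimes> d [^] (i * n)" using xG by (simp add: m_assoc d_pow_central[OF xG])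
      also have "\<dots> = x [^] Suc n \<otimes> c \<otimes> (d [^] i \<otimes> d [^] (i * n))" unfolding x1 using xG by (simp add: m_assoc)
      finally show ?case using xG by (simp add: nat_pow_mult)
    qed simp
    let ?S = "insert x T"
    have inS: "y \<in> generate G ?S" if y: "y \<in> M" for y
    proof -
      obtain i' j' k' where yn: "i' < (3::nat)" "j' < (9::nat)" "k' < (3::nat)" "y = a [^] i' \<otimes> (b [^] j' \<otimes> c [^] k')"
        using normal_form[OF car[OF y]] by blast
      have y1: "c \<otimes> y = y \<otimes> c \<otimes> d [^] i'" using c_conj_normal_form[of i' j' k'] yn(4) by simp
      \<comment> \<open>Since \<open>i\<close> is \<open>1\<close> or \<open>2\<close>, its square is \<open>1\<close> modulo three; so multiplying \<open>y\<close> by this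
        power of \<open>x\<close> cancels the exponent of \<open>a\<close> modulo three.\<close>
      let ?n = "i * (3 - i')"
      have G: "x \<in> carrier G" "y \<in> carrier G" using car x(1) y by auto
      have "c \<otimes> (x [^] ?n \<otimes> y) = x [^] ?n \<otimes> c \<otimes> d [^] (i * ?n) \<otimes> y"
        using cx[of ?n] G by (simp flip: m_assoc)
      also have "\<dots> = x [^] ?n \<otimes> (c \<otimes> y) \<otimes> d [^] (i * ?n)" using G by (simp add: m_assoc d_pow_central[OF G(2)])
      also have "\<dots> = x [^] ?n \<otimes> y \<otimes> c \<otimes> d [^] (i' + i * ?n)" unfolding y1 using G by (simp add: m_assoc nat_pow_mult)
      also have "d [^] (i' + i * ?n) = \<one>"
      proof -
        have "i' = 0 \<or> i' = 1 \<or> i' = 2" using yn(1) by auto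
        then have "(i' + i * ?n) mod 3 = 0" using i by (elim disjE) simp_all
        then show ?thesis using pow_mod[OF closed(4) relations(5), of "i' + i * ?n"] by simp
      qed
      finally have "c \<otimes> (x [^] ?n \<otimes> y) = x [^] ?n \<otimes> y \<otimes> c" using G by simp
      moreover have "x [^] ?n \<otimes> y \<in> M" using subgroup.m_closed[OF m(1) pow[OF x(1)] y] .
      ultimately have t: "x [^] ?n \<otimes> y \<in> T" using inT by blast
      have gS: "subgroup (generate G ?S) G" using G(1) TM car by (intro generate_is_subgroup) auto
      have 1: "x [^] ?n \<in> generate G ?S" by (intro subgroup_pow_closed[OF is_group gS]) (auto intro: generate.incl)
      have 2: "x [^] ?n \<otimes> y \<in> generate G ?S" using t by (auto intro: generate.incl)
      from subgroup.m_closed[OF gS subgroup.m_inv_closed[OF gS 1] 2] show ?thesis using G by simp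
    qed
    have "comm u v \<in> D" if uv: "u \<in> ?S" "v \<in> ?S" for u v
    proof (cases "u \<in> T")
      case True
      then show ?thesis using comm_T car x(1) TM uv(2) by blast
    next
      case False
      then have u: "u = x" using uv by blast
      show ?thesis
      proof (cases "v \<in> T")
        case True
        then have "inv (comm v x) \<in> D" using comm_T car x(1) subgroup.m_inv_closed[OF D_subgroup] by blast
        then show ?thesis using u car x(1) TM True by (simp add: inv_commutator subset_iff)
      next
        case False
        then have "v = x" using uv by blast
        then show ?thesis using u car[OF x(1)] comm_eq_one_iff[of x x] subgroup.one_closed[OF D_subgroup] by simp
      qed
    qed
    then have "comm y z \<in> D" if "y \<in> M" "z \<in> M" for y z
      using comm_generate[OF normal_D, of ?S ?S y z] inS that car x(1) TM by blast
    then show ?thesis using m(1) DpM by (auto simp: powerful_set_def)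
  qed
qed

lemma lower_central_commutator:
  assumes "x \<in> carrier G" "y \<in> carrier G"
  shows "x \<otimes> y \<otimes> inv x \<otimes> inv y = comm (inv x) (inv y)"
  using assms by (simp add: comm_def)

theorem nilpotency_class: "has_nilpotency_class G 3"
proof -
  let ?L = "lower_central G"
  have L1: "?L (Suc 0) \<subseteq> T"
    using comm_in_T by (auto simp: lower_central_commutator intro!: generate_subgroup_incl[OF _ normal_inD(1)[OF normal_T]])
  have TG: "T \<subseteq> carrier G" using normal_inD(3)[OF normal_T] .
  have DG: "D \<subseteq> carrier G" using normal_inD(3)[OF normal_D] .
  have L2: "?L (Suc (Suc 0)) \<subseteq> D"
  proof -
    have "x \<otimes> y \<otimes> inv x \<otimes> inv y \<in> D" if "x \<in> ?L (Suc 0)" "y \<in> carrier G" for x y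
    proof -
      have x: "x \<in> T" using that L1 by blast
      then have "inv x \<in> T" using subgroup.m_inv_closed[OF normal_inD(1)[OF normal_T]] by blast
      then show ?thesis using comm_T[of "inv x" "inv y"] lower_central_commutator[of x y] x TG that(2) by auto
    qed
    then show ?thesis by (auto simp: intro!: generate_subgroup_incl[OF _ D_subgroup])
  qed
  have L3: "?L (Suc (Suc (Suc 0))) \<subseteq> {\<one>}"
  proof -
    have "x \<otimes> y \<otimes> inv x \<otimes> inv y \<in> {\<one>}" if "x \<in> ?L (Suc (Suc 0))" "y \<in> carrier G" for x y
    proof -
      have x: "x \<in> D" using that L2 by blast
      then have "inv x \<in> D" using subgroup.m_inv_closed[OF D_subgroup] by blast
      then show ?thesis using comm_D[of "inv x" "inv y"] lower_central_commutator[of x y] x DG that(2) by auto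
    qed
    then show ?thesis unfolding lower_central.simps(2)[of _ "Suc (Suc 0)"]
      by (intro generate_subgroup_incl[OF _ triv_subgroup]) blast
  qed
  have one: "\<one> \<in> ?L (Suc n)" for n by (simp add: generate.one)
  have c1: "c \<in> ?L (Suc 0)"
  proof -
    have "c = inv b \<otimes> inv a \<otimes> inv (inv b) \<otimes> inv (inv a)" by (simp add: c_def comm_def)
    then show ?thesis unfolding lower_central.simps
      by (intro generate.incl CollectI exI[of _ "inv b"] exI[of _ "inv a"]) auto
  qed
  have sub: "subgroup (?L (Suc 0)) G"
    unfolding lower_central.simps by (intro generate_is_subgroup) auto
  have d2: "d \<in> ?L (Suc (Suc 0))"
  proof -
    have "d = inv c \<otimes> inv a \<otimes> inv (inv c) \<otimes> inv (inv a)"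
      using relations(1) by (simp add: comm_def)
    moreover have "inv c \<in> ?L (Suc 0)" using subgroup.m_inv_closed[OF sub c1] .
    ultimately show ?thesis unfolding lower_central.simps(2)[of _ "Suc 0"]
      by (intro generate.incl CollectI exI[of _ "inv c"] exI[of _ "inv a"]) (simp del: lower_central.simps)
  qed
  have cne: "c \<noteq> \<one>" using relations(1,6) by (auto simp: comm_def)
  have "?L k \<noteq> {\<one>}" if "k < 3" for k
  proof -
    have "k = 0 \<or> k = Suc 0 \<or> k = Suc (Suc 0)" using that by auto
    moreover have "?L 0 \<noteq> {\<one>}" using closed(4) relations(6) unfolding lower_central.simps by blast
    moreover have "?L (Suc 0) \<noteq> {\<one>}" using c1 cne by blast
    moreover have "?L (Suc (Suc 0)) \<noteq> {\<one>}" using d2 relations(6) by blast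
    ultimately show ?thesis by blast
  qed
  moreover have "?L 3 = {\<one>}" using L3 one[of "Suc (Suc 0)"] by (auto simp: numeral_3_eq_3 simp del: lower_central.simps)
  ultimately show ?thesis by (simp add: has_nilpotency_class_def)
qed

theorem M1_81_maximal_class: "M1_81_maximal_class G"
  using M1_group order_81 nilpotency_class by (auto simp: M1_81_maximal_class_def)

end

section \<open>The presentation of the exceptional group\<close>

primrec eval_word :: "('a, 'b) monoid_scheme \<Rightarrow> ('g \<Rightarrow> 'a) \<Rightarrow> 'g word \<Rightarrow> 'a" where
  "eval_word H s [] = \<one>\<^bsub>H\<^esub>"
| "eval_word H s (xb # w) = (if snd xb then s (fst xb) else inv\<^bsub>H\<^esub> s (fst xb)) \<otimes>\<^bsub>H\<^esub> eval_word H s w"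

definition word_class :: "('g word \<times> 'g word) set \<Rightarrow> 'g word \<Rightarrow> 'g word set" where
  "word_class R w = word_rel R `` {w}"

lemma word_class_eq_iff: "word_class R u = word_class R v \<longleftrightarrow> word_eq R u v"
  unfolding word_class_def using eq_equiv_class_iff[OF equiv_word_rel[of R]] by (simp add: word_rel_def)

lemma word_class_closed [simp]: "word_class R w \<in> carrier (presented_group R)"
  by (auto simp: word_class_def presented_group_def quotient_def)

lemma word_class_cases:
  assumes "A \<in> carrier (presented_group R)"
  obtains w where "A = word_class R w"
  using assms by (auto simp: word_class_def presented_group_def quotient_def)

lemma word_class_append: "word_class R (u @ v) = word_class R u \<otimes>\<^bsub>presented_group R\<^esub> word_class R v"
  by (simp add: word_class_def presented_group_mult)

lemma word_class_Nil: "word_class R [] = \<one>\<^bsub>presented_group R\<^esub>"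
  by (simp add: word_class_def presented_group_def)

lemma word_class_False: "word_class R [(x, False)] = inv\<^bsub>presented_group R\<^esub> word_class R [(x, True)]"
proof -
  interpret group "presented_group R" by (rule group_presented_group)
  have "word_eq R ([] @ [(x, False), (x, \<not> False)] @ []) ([] @ [])" by (rule word_eq.cancel)
  then have "word_class R ([(x, False)] @ [(x, True)]) = \<one>\<^bsub>presented_group R\<^esub>"
    by (simp add: word_class_eq_iff flip: word_class_Nil)
  then show ?thesis unfolding word_class_append by (intro inv_equality[THEN HOL.sym]) auto
qed

lemma (in group) eval_word_closed:
  "(\<And>x. s x \<in> carrier G) \<Longrightarrow> eval_word G s w \<in> carrier G"
  by (induction w) auto

lemma (in group) eval_word_append:
  assumes "\<And>x. s x \<in> carrier G"
  shows "eval_word G s (u @ v) = eval_word G s u \<otimes> eval_word G s v"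
  by (induction u) (auto simp: assms eval_word_closed m_assoc)

lemma (in group) eval_word_respects:
  assumes s: "\<And>x. s x \<in> carrier G" and R: "\<And>l r. (l, r) \<in> R \<Longrightarrow> eval_word G s l = eval_word G s r"
    and uv: "word_eq R u v"
  shows "eval_word G s u = eval_word G s v"
  using uv
proof (induction rule: word_eq.induct)
  case (cancel u x b v)
  then show ?case
    by (cases b) (simp_all add: eval_word_append[OF s] s eval_word_closed)
next
  case (rel l r u v)
  then show ?case using R by (simp add: eval_word_append[OF s])
qed auto

text \<open>The universal property of the presented group.\<close>

lemma (in group) presented_group_hom:
  assumes s: "\<And>x. s x \<in> carrier G" and R: "\<And>l r. (l, r) \<in> R \<Longrightarrow> eval_word G s l = eval_word G s r"
  shows "\<exists>h \<in> hom (presented_group R) G. \<forall>w. h (word_class R w) = eval_word G s w"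
proof -
  define h where "h = (\<lambda>A. eval_word G s (SOME w. A = word_class R w))"
  have h: "h (word_class R w) = eval_word G s w" for w
  proof -
    have "word_class R w = word_class R (SOME v. word_class R w = word_class R v)"
      by (rule someI[of "\<lambda>v. word_class R w = word_class R v" w]) simp
    then have "word_eq R w (SOME v. word_class R w = word_class R v)" by (simp only: word_class_eq_iff)
    then show ?thesis unfolding h_def using eval_word_respects[OF s R] by metis
  qed
  have "h \<in> hom (presented_group R) G"
  proof (rule homI)
    show "h A \<in> carrier G" if "A \<in> carrier (presented_group R)" for A
      using that by (rule word_class_cases) (simp add: h eval_word_closed s)
    show "h (A \<otimes>\<^bsub>presented_group R\<^esub> B) = h A \<otimes> h B"
      if AB: "A \<in> carrier (presented_group R)" "B \<in> carrier (presented_group R)" for A B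
    proof -
      obtain u v where "A = word_class R u" "B = word_class R v" using AB word_class_cases by metis
      then show ?thesis by (simp add: h eval_word_append[OF s] flip: word_class_append)
    qed
  qed
  then show ?thesis using h by blast
qed

text \<open>The commutator relations are stated in collected form, which is easier to verify in
  concrete groups.\<close>

lemma (in group) eval_J_relations:
  assumes car: "\<And>x. s x \<in> carrier G"
    and rel: "s A1 [^] (3::nat) = s A4" "s A2 [^] (3::nat) = s A4 \<otimes> s A4" "s A3 [^] (3::nat) = \<one>" "s A4 [^] (3::nat) = \<one>"
      "s A2 \<otimes> s A1 = s A1 \<otimes> s A2 \<otimes> s A3" "s A3 \<otimes> s A1 = s A1 \<otimes> s A3 \<otimes> s A4"
      "s A4 \<otimes> s A1 = s A1 \<otimes> s A4" "s A3 \<otimes> s A2 = s A2 \<otimes> s A3" "s A4 \<otimes> s A2 = s A2 \<otimes> s A4"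
      "s A4 \<otimes> s A3 = s A3 \<otimes> s A4"
    and lr: "(l, r) \<in> J_relations"
  shows "eval_word G s l = eval_word G s r"
proof -
  have comm: "eval_word G s (comm_word x y) = comm (s x) (s y)" for x y
    by (simp add: comm_word_def comm_def car m_assoc)
  have cube: "eval_word G s (gen_word x @ gen_word x @ gen_word x) = s x [^] (3::nat)" for x
    by (simp add: gen_word_def car m_assoc numeral_3_eq_3)
  have gen: "eval_word G s (gen_word x) = s x" "eval_word G s (gen_word x @ gen_word y) = s x \<otimes> s y" for x y
    by (simp_all add: gen_word_def car)
  have commI: "comm (s x) (s y) = s z" if "s x \<otimes> s y = s y \<otimes> s x \<otimes> s z" for x y z
    using that mult_comm_swap[OF car[of x] car[of y]] car by simp
  have comm1: "comm (s x) (s y) = \<one>" if "s x \<otimes> s y = s y \<otimes> s x" for x y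
    using that car by (simp add: comm_eq_one_iff)
  show ?thesis
    using lr unfolding J_relations_def
    by (auto simp: comm cube gen rel(1-4) commI[OF rel(5)] commI[OF rel(6)] comm1[OF rel(7)] comm1[OF rel(8)]
        comm1[OF rel(9)] comm1[OF rel(10)] simp del: append.simps)
qed

definition zeta :: complex where "zeta = cis (2 * pi / 9)"

lemma zeta_pow_9: "zeta ^ 9 = 1"
  by (simp add: zeta_def DeMoivre)

lemma zeta_cube: "zeta ^ 3 \<noteq> 1"
proof
  assume "zeta ^ 3 = 1"
  then have "cis (2 * pi / 3) = 1" by (simp add: zeta_def DeMoivre)
  then have "cos (2 * pi / 3) = 1" by (metis cis.simps(1) one_complex.simps(1))
  then show False using cos_120 by (simp add: mult.commute)
qed

text \<open>Bijections under composition. A composite applies its right factor first, which matches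
  the multiplication of matrices.\<close>

definition bijections :: "('x \<Rightarrow> 'x) monoid" where
  "bijections = \<lparr>carrier = {f. bij f}, monoid.mult = (\<circ>), monoid.one = id\<rparr>"

lemma group_bijections: "group bijections"
proof (rule groupI)
  show "\<exists>g\<in>carrier bijections. g \<otimes>\<^bsub>bijections\<^esub> f = \<one>\<^bsub>bijections\<^esub>" if "f \<in> carrier bijections" for f
    using that by (auto simp: bijections_def bij_imp_bij_inv bij_is_inj inv_o_cancel intro!: exI[of _ "inv_into UNIV f"])
qed (auto simp: bijections_def bij_comp o_assoc)

text \<open>A representation that is induced from a one-dimensional character of the abelian subgroup
  generated by \<open>A2\<close> and \<open>A3\<close>; the character is nontrivial on \<open>A4\<close>. The matrices are written
  as maps on triples.\<close>

fun monomial_rep :: "J_gen \<Rightarrow> complex \<times> complex \<times> complex \<Rightarrow> complex \<times> complex \<times> complex" where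
  "monomial_rep A1 (x, y, z) = (zeta * y, zeta * z, zeta * x)"
| "monomial_rep A2 (x, y, z) = (zeta ^ 8 * x, zeta ^ 2 * y, zeta ^ 8 * z)"
| "monomial_rep A3 (x, y, z) = (x, zeta ^ 6 * y, zeta ^ 3 * z)"
| "monomial_rep A4 (x, y, z) = (zeta ^ 3 * x, zeta ^ 3 * y, zeta ^ 3 * z)"

lemma zeta_mult: "zeta * (zeta ^ 8 * x) = x" "zeta ^ 8 * (zeta * x) = x"
  "zeta ^ 2 * (zeta ^ 7 * x) = x" "zeta ^ 7 * (zeta ^ 2 * x) = x"
  "zeta ^ 3 * (zeta ^ 6 * x) = x" "zeta ^ 6 * (zeta ^ 3 * x) = x"
proof -
  have "zeta ^ i * (zeta ^ j * x) = x" if "i + j = 9" for i j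
    using that zeta_pow_9 by (simp flip: mult.assoc power_add)
  from this[of 1 8] this[of 8 1] this[of 2 7] this[of 7 2] this[of 3 6] this[of 6 3]
  show "zeta * (zeta ^ 8 * x) = x" "zeta ^ 8 * (zeta * x) = x"
  "zeta ^ 2 * (zeta ^ 7 * x) = x" "zeta ^ 7 * (zeta ^ 2 * x) = x"
  "zeta ^ 3 * (zeta ^ 6 * x) = x" "zeta ^ 6 * (zeta ^ 3 * x) = x" by simp_all
qed

lemma bij_monomial_rep: "bij (monomial_rep g)"
proof (cases g)
  case A1
  show ?thesis unfolding A1
    by (rule o_bij[of "\<lambda>(x, y, z). (zeta ^ 8 * z, zeta ^ 8 * x, zeta ^ 8 * y)"]) (auto simp: fun_eq_iff zeta_mult zeta_pow_9)
next
  case A2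
  show ?thesis unfolding A2
    by (rule o_bij[of "\<lambda>(x, y, z). (zeta * x, zeta ^ 7 * y, zeta * z)"]) (auto simp: fun_eq_iff zeta_mult zeta_pow_9)
next
  case A3
  show ?thesis unfolding A3
    by (rule o_bij[of "\<lambda>(x, y, z). (x, zeta ^ 3 * y, zeta ^ 6 * z)"]) (auto simp: fun_eq_iff zeta_mult zeta_pow_9)
next
  case A4
  show ?thesis unfolding A4
    by (rule o_bij[of "\<lambda>(x, y, z). (zeta ^ 6 * x, zeta ^ 6 * y, zeta ^ 6 * z)"]) (auto simp: fun_eq_iff zeta_mult zeta_pow_9)
qed

text \<open>The matrices of the monomial representation satisfy the relations, and \<open>A4\<close> acts as a
  primitive third root of unity. Without such a witness the presentation might collapse to a
  smaller group.\<close>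

lemma A4_nontrivial: "word_class J_relations [(A4, True)] \<noteq> \<one>\<^bsub>presented_group J_relations\<^esub>"
proof
  interpret B: group "bijections :: (complex \<times> complex \<times> complex \<Rightarrow> _) monoid" by (rule group_bijections)
  let ?B = "bijections :: (complex \<times> complex \<times> complex \<Rightarrow> _) monoid"
  have car: "monomial_rep x \<in> carrier ?B" for x using bij_monomial_rep by (simp add: bijections_def)
  have red: "zeta ^ n = zeta ^ (n mod 9)" for n
  proof -
    have "zeta ^ n = (zeta ^ 9) ^ (n div 9) * zeta ^ (n mod 9)" by (simp flip: power_mult power_add)
    then show ?thesis by (simp add: zeta_pow_9)
  qed
  have m: "f \<otimes>\<^bsub>?B\<^esub> g = f \<circ> g" "\<one>\<^bsub>?B\<^esub> = id" for f g by (simp_all add: bijections_def)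
  have p: "f [^]\<^bsub>?B\<^esub> (3::nat) = f \<circ> f \<circ> f" for f by (simp add: m numeral_3_eq_3)
  have z: "zeta * (zeta * (zeta * x)) = zeta ^ 3 * x" for x by (simp add: power3_eq_cube)
  have zz: "zeta ^ i * (zeta ^ j * x) = zeta ^ ((i + j) mod 9) * x" for i j x
    using red[of "i + j"] by (simp add: power_add flip: mult.assoc)
  have z1: "zeta ^ i * (zeta * x) = zeta ^ (Suc i mod 9) * x" "zeta * (zeta ^ i * x) = zeta ^ (Suc i mod 9) * x" for i x
    using zz[of i 1 x] zz[of 1 i x] by simp_all
  have rel: "eval_word ?B monomial_rep l = eval_word ?B monomial_rep r" if "(l, r) \<in> J_relations" for l r
    by (rule B.eval_J_relations[rotated -1, OF that car])
      (auto simp: m p fun_eq_iff z zz z1 zeta_pow_9 red[of 18] red[of 24] simp del: One_nat_def)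
  obtain h where h: "h \<in> hom (presented_group J_relations) ?B"
    "\<And>w. h (word_class J_relations w) = eval_word ?B monomial_rep w"
    using B.presented_group_hom[OF car rel] by blast
  assume "word_class J_relations [(A4, True)] = \<one>\<^bsub>presented_group J_relations\<^esub>"
  then have "eval_word ?B monomial_rep [(A4, True)] = eval_word ?B monomial_rep []"
    using h(2)[of "[(A4, True)]"] h(2)[of "[]"] by (simp add: word_class_Nil)
  then have "monomial_rep A4 = id" by (simp add: m)
  then have "monomial_rep A4 (1, 1, 1) = (1, 1, 1)" by simp
  then show False using zeta_cube by simp
qed

text \<open>The relations give everything except that \<open>a^3\<close> is nontrivial, which needs the
  representation above.\<close>

lemma J_group_exceptional_J:
  "J_group exceptional_J (word_class J_relations [(A1, True)]) (word_class J_relations [(A2, True)])"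
proof -
  let ?J = "presented_group J_relations" and ?w = "word_class J_relations"
  interpret G: group ?J by (rule group_presented_group)
  let ?a = "?w [(A1, True)]" and ?b = "?w [(A2, True)]" and ?c = "?w [(A3, True)]" and ?d = "?w [(A4, True)]"
  have rel: "?w l = ?w r" if "(l, r) \<in> J_relations" for l r
    using word_eq.rel[OF that, of "[]" "[]"] by (simp add: word_class_eq_iff)
  have Cons: "?w (x # y # w) = ?w [x] \<otimes>\<^bsub>?J\<^esub> ?w (y # w)" for x y w
    using word_class_append[of J_relations "[x]" "y # w"] by simp
  have gen: "?w (gen_word x) = ?w [(x, True)]" for x by (simp add: gen_word_def)
  have cube: "?w (gen_word x @ gen_word x @ gen_word x) = ?w [(x, True)] [^]\<^bsub>?J\<^esub> (3::nat)" for x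
    by (simp add: gen_word_def Cons numeral_3_eq_3 G.m_assoc)
  have comm: "?w (comm_word x y) = G.comm (?w [(x, True)]) (?w [(y, True)])" for x y
    by (simp add: comm_word_def Cons G.comm_def word_class_False G.m_assoc)
  have "(gen_word A1 @ gen_word A1 @ gen_word A1, gen_word A4) \<in> J_relations"
    "(gen_word A2 @ gen_word A2 @ gen_word A2, gen_word A4 @ gen_word A4) \<in> J_relations"
    "(gen_word A3 @ gen_word A3 @ gen_word A3, []) \<in> J_relations"
    "(gen_word A4 @ gen_word A4 @ gen_word A4, []) \<in> J_relations"
    "(comm_word A2 A1, gen_word A3) \<in> J_relations" "(comm_word A3 A1, gen_word A4) \<in> J_relations"
    "(comm_word A3 A2, []) \<in> J_relations"
    by (simp_all add: J_relations_def)
  from this[THEN rel]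
  have r: "?a [^]\<^bsub>?J\<^esub> (3::nat) = ?d" "?b [^]\<^bsub>?J\<^esub> (3::nat) = ?d \<otimes>\<^bsub>?J\<^esub> ?d" "?c [^]\<^bsub>?J\<^esub> (3::nat) = \<one>\<^bsub>?J\<^esub>"
    "?d [^]\<^bsub>?J\<^esub> (3::nat) = \<one>\<^bsub>?J\<^esub>" "G.comm ?b ?a = ?c" "G.comm ?c ?a = ?d" "G.comm ?c ?b = \<one>\<^bsub>?J\<^esub>"
    by (simp_all add: cube comm gen word_class_append[of _ "gen_word A4" "gen_word A4"] word_class_Nil)
  have dd: "?d \<otimes>\<^bsub>?J\<^esub> ?d = inv\<^bsub>?J\<^esub> ?d"
    using r(4) by (intro G.inv_equality[THEN HOL.sym]) (simp_all add: numeral_3_eq_3)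
  let ?K = "generate ?J {?a, ?b}"
  have K: "subgroup ?K ?J" by (intro G.generate_is_subgroup) auto
  have aK: "?a \<in> ?K" "?b \<in> ?K" by (auto intro: generate.incl)
  have "?c \<in> ?K" using G.comm_in_subgroup[OF K aK(2,1)] r(5) by simp
  moreover have "?d \<in> ?K" using subgroup_pow_closed[OF G.is_group K aK(1), of 3] r(1) by simp
  ultimately have gK: "?w [(x, True)] \<in> ?K" for x using aK by (cases x) auto
  have "?w [xb] \<in> ?K" for xb
    using gK subgroup.m_inv_closed[OF K gK] by (cases xb; cases "snd xb") (auto simp: word_class_False)
  then have "?w w \<in> ?K" for w
  proof (induction w)
    case Nil
    then show ?case using subgroup.one_closed[OF K] by (simp add: word_class_Nil)
  next
    case (Cons x w)
    then show ?case using subgroup.m_closed[OF K] word_class_append[of J_relations "[x]" w] by simp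
  qed
  then have "carrier ?J \<subseteq> ?K" using word_class_cases by (metis subsetI)
  then have "?K = carrier ?J" using subgroup.subset[OF K] by blast
  then have "G.J_generators ?a ?b"
    unfolding G.J_generators_def using r dd A4_nontrivial by simp
  then show ?thesis unfolding exceptional_J_def by unfold_locales
qed

text \<open>The universal property gives a surjection from the presented group, and both groups have
  \<open>81\<close> elements.\<close>

lemma (in J_group) iso_exceptional_J: "G \<cong> exceptional_J"
proof -
  interpret EJ: J_group exceptional_J "word_class J_relations [(A1, True)]" "word_class J_relations [(A2, True)]"
    by (rule J_group_exceptional_J)
  define s where "s = (\<lambda>x. case x of A1 \<Rightarrow> a | A2 \<Rightarrow> b | A3 \<Rightarrow> c | A4 \<Rightarrow> d)"
  have s: "s A1 = a" "s A2 = b" "s A3 = c" "s A4 = d" by (simp_all add: s_def)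
  have car: "s x \<in> carrier G" for x by (cases x) (simp_all add: s)
  have dd: "inv d = d \<otimes> d"
    using relations(5) by (intro inv_equality) (simp_all add: numeral_3_eq_3 m_assoc)
  have a3: "a [^] (3::nat) = d" by (simp add: d_def)
  have b3: "b [^] (3::nat) = d \<otimes> d" using relations(2) dd by simp
  note d_commutes = d_central[OF closed(1)] d_central[OF closed(2)] d_central[OF closed(3)]
  have rel: "eval_word G s l = eval_word G s r" if "(l, r) \<in> J_relations" for l r
    by (rule eval_J_relations[rotated -1, OF that car])
      (simp_all only: s a3 b3 relations(4,5) commute d_commutes)
  obtain h where h: "h \<in> hom (presented_group J_relations) G"
    "\<And>w. h (word_class J_relations w) = eval_word G s w"
    using presented_group_hom[OF car rel] by blast
  then have hJ: "h \<in> hom exceptional_J G" by (simp add: exceptional_J_def)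
  interpret h: group_hom exceptional_J G h by unfold_locales (rule hJ)
  have img: "h ` carrier exceptional_J = carrier G"
  proof
    show "h ` carrier exceptional_J \<subseteq> carrier G" by auto
    have "subgroup (h ` carrier exceptional_J) G" by (rule h.img_is_subgroup)
    moreover have "h (word_class J_relations [(A1, True)]) = a" "h (word_class J_relations [(A2, True)]) = b"
      using h(2)[of "[(A1, True)]"] h(2)[of "[(A2, True)]"] by (simp_all add: s)
    then have "{a, b} \<subseteq> h ` carrier exceptional_J" unfolding exceptional_J_def using word_class_closed by (metis empty_subsetI image_eqI insert_subset)
    ultimately have "generate G {a, b} \<subseteq> h ` carrier exceptional_J" by (rule generate_subgroup_incl[rotated])
    then show "carrier G \<subseteq> h ` carrier exceptional_J" using gen by simp
  qed
  have "card (carrier exceptional_J) = card (carrier G)"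
    using EJ.order_81 order_81 by (simp add: order_def)
  then have "inj_on h (carrier exceptional_J)"
    using img EJ.finite_carrier by (intro eq_card_imp_inj_on) simp_all
  then have "h \<in> iso exceptional_J G" using hJ img by (simp add: iso_def bij_betw_def)
  then have "exceptional_J \<cong> G" by (auto simp: is_iso_def)
  then show ?thesis by (rule EJ.iso_sym)
qed

lemma J_group_of_iso:
  assumes G: "group G" and iso: "G \<cong> exceptional_J"
  shows "\<exists>a b. J_group G a b"
proof -
  interpret G: group G by fact
  interpret EJ: J_group exceptional_J "word_class J_relations [(A1, True)]" "word_class J_relations [(A2, True)]"
    by (rule J_group_exceptional_J)
  have "exceptional_J \<cong> G" using G.iso_sym[OF iso] .
  then obtain h where h: "h \<in> iso exceptional_J G" by (auto simp: is_iso_def)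
  interpret h: group_hom exceptional_J G h using h by unfold_locales (simp add: iso_def)
  have bij: "bij_betw h (carrier exceptional_J) (carrier G)" using h by (simp add: iso_def)
  have comm: "h (EJ.comm x y) = G.comm (h x) (h y)" if "x \<in> carrier exceptional_J" "y \<in> carrier exceptional_J" for x y
    using that by (simp add: EJ.comm_def G.comm_def)
  have pow: "h (x [^]\<^bsub>exceptional_J\<^esub> (n::nat)) = h x [^]\<^bsub>G\<^esub> n" if "x \<in> carrier exceptional_J" for x n
    using h.hom_nat_pow[OF that] by simp
  let ?a = "word_class J_relations [(A1, True)]" and ?b = "word_class J_relations [(A2, True)]"
  note J = EJ.J[unfolded EJ.J_generators_def]
  have "G.J_generators (h ?a) (h ?b)"
    unfolding G.J_generators_def
  proof (intro conjI)
    have "generate G (h ` {?a, ?b}) = h ` generate exceptional_J {?a, ?b}"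
      using EJ.closed by (intro h.generate_img) auto
    then show "generate G {h ?a, h ?b} = carrier G" using EJ.gen bij by (simp add: bij_betw_def)
    show "h ?a [^]\<^bsub>G\<^esub> (3::nat) \<noteq> \<one>\<^bsub>G\<^esub>"
    proof
      assume "h ?a [^]\<^bsub>G\<^esub> (3::nat) = \<one>\<^bsub>G\<^esub>"
      then have "h (?a [^]\<^bsub>exceptional_J\<^esub> (3::nat)) = h \<one>\<^bsub>exceptional_J\<^esub>" using EJ.closed by (simp add: pow)
      then show False using bij J EJ.closed(1) by (auto simp: bij_betw_def inj_on_def)
    qed
  qed (use J EJ.closed in \<open>simp_all flip: comm pow h.hom_inv\<close>)
  then have "J_group G (h ?a) (h ?b)" by (intro J_group.intro J_group_axioms.intro G.is_group)
  then show ?thesis by blast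
qed

section \<open>Regular power structure and uniqueness\<close>

context p_group
begin

text \<open>The intersection of two different maximal subgroups has index at least \<open>p^2\<close>, and two of
  them exist in every noncommutative \<open>p\<close>-group.\<close>

lemma card_maximal_intersection:
  assumes nc: "u \<in> carrier G" "v \<in> carrier G" "comm u v \<noteq> \<one>"
  obtains K where "subgroup K G" "K \<noteq> carrier G" "card K * p ^ 2 \<le> order G"
    "pw (carrier G) \<subseteq> K" "\<And>x y. x \<in> carrier G \<Longrightarrow> y \<in> carrier G \<Longrightarrow> comm x y \<in> K"
proof -
  have step: "card A * p \<le> card B" if AB: "subgroup A G" "subgroup B G" "A \<subset> B" for A B
  proof -
    obtain i j where ij: "card A = p ^ i" "card B = p ^ j" using card_subgroup AB by metis
    have "card A < card B" using AB finite_subgroup psubset_card_mono by metis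
    then have "i < j" using ij prime_p prime_gt_1_nat power_less_imp_less_exp by metis
    then have "p ^ Suc i \<le> p ^ j" using prime_p prime_gt_0_nat by (intro power_increasing) (auto simp: Suc_le_eq)
    then show ?thesis using ij by (simp add: mult.commute)
  qed
  obtain M where M: "maximal_subgroup M G" using noncommutative_maximal_containing[OF nc nc(1)] by blast
  note m = maximal_subgroupD[OF M]
  obtain x where x: "x \<in> carrier G" "x \<notin> M" using m(2) by blast
  obtain L where L: "maximal_subgroup L G" "x \<in> L" using noncommutative_maximal_containing[OF nc x(1)] by blast
  note l = maximal_subgroupD[OF L(1)]
  let ?K = "M \<inter> L"
  have K: "subgroup ?K G" using m(1) l(1) by (rule subgroups_Inter_pair)
  have "?K \<noteq> M"
  proof
    assume "?K = M"
    then have "M \<subseteq> L" by blast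
    then have "L = M \<or> L = carrier G" using M l(1) by (auto simp: maximal_subgroup_def)
    then show False using L(2) x(2) l(2) by blast
  qed
  then have "card ?K * p \<le> card M" using K m(1) by (intro step) auto
  moreover have "card M * p \<le> card (carrier G)" using m(1,2) subgroup_self by (intro step)
  ultimately have "card ?K * p * p \<le> card (carrier G)" by (meson le_trans mult_le_mono1)
  then have "card ?K * p ^ 2 \<le> order G" by (simp add: order_def power2_eq_square mult.assoc)
  moreover have "pw (carrier G) \<subseteq> ?K"
    unfolding pw_def using m(4) l(4) by (intro generate_subgroup_incl[OF _ K]) auto
  ultimately show thesis using that[of ?K] K m(2,5) l(5) by blast
qed

lemma central_commutators_class_2:
  assumes C: "subgroup C G" and comm: "\<And>x y. x \<in> carrier G \<Longrightarrow> y \<in> carrier G \<Longrightarrow> comm x y \<in> C"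
    and central: "\<And>x y. x \<in> C \<Longrightarrow> y \<in> carrier G \<Longrightarrow> comm x y = \<one>"
  shows "\<not> has_nilpotency_class G 3"
proof -
  have eq: "x \<otimes> y \<otimes> inv x \<otimes> inv y = comm (inv x) (inv y)" if "x \<in> carrier G" "y \<in> carrier G" for x y
    using that by (simp add: comm_def)
  have CG: "C \<subseteq> carrier G" using C by (rule subgroup.subset)
  have L1: "lower_central G (Suc 0) \<subseteq> C"
    using comm by (auto simp: eq intro!: generate_subgroup_incl[OF _ C])
  have "x \<otimes> y \<otimes> inv x \<otimes> inv y \<in> {\<one>}" if xy: "x \<in> lower_central G (Suc 0)" "y \<in> carrier G" for x y
  proof -
    have x: "x \<in> C" "x \<in> carrier G" using xy L1 CG by blast+
    then have "inv x \<in> C" using subgroup.m_inv_closed[OF C] by blast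
    then show ?thesis using central[of "inv x" "inv y"] eq[OF x(2) xy(2)] xy(2) by simp
  qed
  then have "lower_central G (Suc (Suc 0)) \<subseteq> {\<one>}"
    unfolding lower_central.simps(2)[of _ "Suc 0"] by (intro generate_subgroup_incl[OF _ triv_subgroup]) blast
  then have "lower_central G 2 = {\<one>}" by (auto simp: numeral_2_eq_2 generate.one)
  then show ?thesis by (auto simp: has_nilpotency_class_def intro!: exI[of _ "2::nat"])
qed

end

context odd_p_group
begin

text \<open>The fibre of the power map over the identity has the same size as all the others. So its
  size is the index of the subgroup of powers, which is the third condition on a regular
  power structure.\<close>

lemma regular_power_structureI:
  assumes u: "uniform (carrier G)" and pw: "powerful_set (pw (carrier G))"
    and om: "\<And>i. subgroup (om i (carrier G)) G"
  shows "regular_power_structure p G"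
  unfolding regular_power_structure_def
proof (intro allI impI)
  fix i :: nat assume "1 \<le> i"
  then obtain j where i: "i = Suc j" by (cases i) auto
  note ups = uniform_power_structure[OF subgroup_self u pw, where i=j, folded i]
  have gs: "generate G H = H" if "subgroup H G" for H
    using generate_subgroup_incl[OF order_refl that] by (auto intro: generate.incl)
  have sub: "subgroup ((pw ^^ i) (carrier G)) G" using funpow_pw_subgroup[OF subgroup_self] .
  have mho: "mho p i G = (pw ^^ i) (carrier G)"
    unfolding mho_def ups(1)[symmetric] using gs[OF sub] .
  have Om: "Omega p i G = om i (carrier G)" using gs[OF om[of i]] by (simp add: Omega_def om_def)
  have "g [^] (p ^ i) = \<one> \<longleftrightarrow> ord g \<le> p ^ i" if g: "g \<in> carrier G" for g
  proof
    assume "g [^] (p ^ i) = \<one>"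
    then show "ord g \<le> p ^ i" using pow_eq_id[OF g] prime_p prime_gt_0_nat by (intro dvd_imp_le) auto
  next
    assume le: "ord g \<le> p ^ i"
    obtain n where "order G = p ^ n" using order_p_power by blast
    then have "ord g dvd p ^ n" using ord_dvd_group_order[OF g] by simp
    then obtain k where k: "ord g = p ^ k" using prime_p divides_primepow_nat by blast
    then have "k \<le> i" using le prime_p prime_gt_1_nat power_le_imp_le_exp by metis
    then show "g [^] (p ^ i) = \<one>" using pow_eq_id[OF g] k by (simp add: le_imp_power_dvd)
  qed
  then have ord: "om i (carrier G) = {g \<in> carrier G. ord g \<le> p ^ i}" by (auto simp: om_def)
  have "card (om i (carrier G)) * card (mho p i G) = card (carrier G)"
    using ups(2)[of \<one>] subgroup.one_closed[OF sub] by (simp add: om_def mho)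
  moreover have "card (rcosets (mho p i G)) * card (mho p i G) = card (carrier G)"
    using lagrange[OF sub] by (simp add: mho order_def)
  moreover have "card (mho p i G) > 0"
    using finite_subgroup[OF sub] subgroup.one_closed[OF sub] by (auto simp: mho card_gt_0_iff)
  ultimately have "card (rcosets (mho p i G)) = card (om i (carrier G))"
    by (metis less_irrefl mult_cancel2)
  then show "mho p i G = {g [^] (p ^ i) | g. g \<in> carrier G} \<and>
      Omega p i G = {g \<in> carrier G. ord g \<le> p ^ i} \<and> mho_index_eq_card_Omega p i G"
    using mho ups(1) Om ord by (simp add: mho_index_eq_card_Omega_def)
qed

lemma powerful_regular: "powerful_set (carrier G) \<Longrightarrow> regular_power_structure p G"
  using regular_power_structureI powerful_uniform powerful_funpow_pw[of "carrier G" 1] powerful_om_subgroup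
  by simp

text \<open>Suppose that the class is three. Then \<open>pw G\<close> is not central, so that \<open>pw (pw G)\<close> is
  nontrivial, while the order of \<open>pw G\<close> is at most nine. Hence \<open>pw G\<close> is cyclic and
  generated by a cube \<open>g = x^3\<close>. Each \<open>h\<close> conjugates \<open>x\<close> to a power \<open>x^(1+3r)\<close>, and \<open>h^3\<close>
  lies in \<open>pw G\<close>, so it commutes with \<open>x\<close>. Therefore \<open>x^((1+3r)^3) = x\<close>, which means \<open>x^(9r)
  = 1\<close> because \<open>x\<close> has order at most \<open>27\<close>, and then \<open>h\<close> commutes with \<open>x^3\<close>. But then \<open>pw G\<close>
  is central after all.\<close>

lemma powerful_81_class:
  assumes P: "powerful_set (carrier G)" and p3: "p = 3" and o: "order G = 81"
  shows "\<not> has_nilpotency_class G 3"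
proof
  assume cl: "has_nilpotency_class G 3"
  let ?P = "pw (carrier G)"
  have Ps: "subgroup ?P G" by simp
  have PG: "?P \<subseteq> carrier G" using subgroup.subset[OF Ps] .
  have comm: "comm x y \<in> ?P" if "x \<in> carrier G" "y \<in> carrier G" for x y
    using P that by (simp add: powerful_set_def)
  obtain u h0 where u: "u \<in> ?P" "h0 \<in> carrier G" "comm u h0 \<noteq> \<one>"
    using central_commutators_class_2[OF Ps comm] cl by blast
  have "u \<in> carrier G" using u PG by blast
  then obtain K where K: "subgroup K G" "card K * p ^ 2 \<le> order G" "?P \<subseteq> K"
    using card_maximal_intersection[OF _ u(2,3)] by metis
  have cP: "card ?P \<le> 9" using K(2) o p3 card_mono[OF finite_subgroup[OF K(1)] K(3)] by simp
  have "comm u h0 \<in> pw ?P" using powerful_comm[OF P, of u 1 h0] u by simp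
  then have nt: "pw ?P \<noteq> {\<one>}" using u(3) by auto
  have "\<exists>g\<in>?P. g [^] p \<noteq> \<one>"
  proof (rule ccontr)
    assume "\<not> ?thesis"
    then have "{g [^] p | g. g \<in> ?P} \<subseteq> {\<one>}" by auto
    then have "pw ?P \<subseteq> {\<one>}" unfolding pw_def[of ?P] by (rule generate_subgroup_incl[OF _ triv_subgroup])
    then show False using nt subgroup.one_closed[OF pw_subgroup[OF PG]] by blast
  qed
  then obtain g where g: "g \<in> ?P" "g [^] p \<noteq> \<one>" by blast
  have gG: "g \<in> carrier G" using g PG by blast
  have gs: "subgroup (generate G {g}) G" using gG by (intro generate_is_subgroup) auto
  have gP: "generate G {g} \<subseteq> ?P" using g by (intro generate_subgroup_incl[OF _ Ps]) auto
  obtain k where k: "card (generate G {g}) = p ^ k" using card_subgroup[OF gs] .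
  have "k \<ge> 2"
  proof (rule ccontr)
    assume "\<not> k \<ge> 2"
    then have "p ^ k dvd p" by (cases k) (auto simp: not_le less_Suc_eq numeral_2_eq_2)
    then have "ord g dvd p" using generate_pow_card[OF gG] k by simp
    then show False using g(2) pow_eq_id[OF gG] by simp
  qed
  then have "p ^ 2 \<le> p ^ k" using p3 by (intro power_increasing) auto
  then have "card ?P \<le> card (generate G {g})" using cP k p3 by simp
  then have gen: "generate G {g} = ?P" using card_seteq[OF finite_subgroup[OF Ps] gP] by simp
  obtain x where x: "x \<in> carrier G" "g = x [^] p"
    using uniform_root[OF powerful_uniform[OF P] subgroup_self g(1)] by blast
  have small: "card (pw H) * 3 \<le> card H" if H: "subgroup H G" "H \<noteq> {\<one>}" for H
  proof -
    have HG: "H \<subseteq> carrier G" using H(1) by (rule subgroup.subset)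
    obtain i j where ij: "card (pw H) = 3 ^ i" "card H = 3 ^ j"
      using card_subgroup[OF H(1)] card_subgroup[OF pw_subgroup[OF HG]] p3 by metis
    have "card (pw H) < card H" using pw_psubset[OF H] finite_subgroup[OF H(1)] by (rule psubset_card_mono[rotated])
    then have "i < j" using ij by simp
    then have "(3::nat) ^ Suc i \<le> 3 ^ j" by (intro power_increasing) auto
    then show ?thesis using ij by simp
  qed
  have x27: "(g [^] p) [^] p = \<one>"
  proof -
    have ppP: "subgroup (pw ?P) G" using PG by simp
    have "?P \<noteq> {\<one>}" using g nat_pow_one[of p] by (metis singletonD)
    then have "card (pw ?P) \<le> 3" using small[OF Ps] cP by simp
    then have "card (pw (pw ?P)) \<le> 1" using small[OF ppP nt] by simp
    moreover have "subgroup (pw (pw ?P)) G" using subgroup.subset[OF ppP] by simp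
    ultimately have fix1: "card (pw (pw ?P)) \<le> Suc 0" "\<one> \<in> pw (pw ?P)" "finite (pw (pw ?P))"
      using subgroup.one_closed finite_subgroup by auto
    have "y = \<one>" if "y \<in> pw (pw ?P)" for y
      using fix1(1) that fix1(2) card_le_Suc0_iff_eq[OF fix1(3)] by blast
    then show ?thesis using pow_in_pw[OF pow_in_pw[OF g(1)]] by blast
  qed
  have "comm g h = \<one>" if h: "h \<in> carrier G" for h
  proof -
    let ?z = "comm x h"
    have "?z \<in> generate G {g}" using comm[OF x(1) h] gen by simp
    then obtain r :: nat where r: "?z = g [^] r" using generate_pow_on_finite_carrier[OF finite_carrier gG] by auto
    have xh: "inv h \<otimes> x \<otimes> h = x [^] (1 + 3 * r)"
      using conj_eq_mult_comm[OF x(1) h] r x(1) nat_pow_mult[OF x(1), of 1 "3 * r"]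
      by (simp add: x(2) p3 nat_pow_pow)
    have conj: "inv h \<otimes> x [^] m \<otimes> h = x [^] (m * (1 + 3 * r))" for m :: nat
      using conj_pow[OF x(1) h, of m] unfolding xh nat_pow_pow[OF x(1)] by (simp only: mult.commute)
    have h3: "h [^] p \<in> generate G {g}" using pow_in_pw[OF h] gen by simp
    then obtain s :: nat where s: "h [^] p = g [^] s" using generate_pow_on_finite_carrier[OF finite_carrier gG] by auto
    have c3: "inv (h [^] p) \<otimes> x \<otimes> h [^] p = x"
    proof -
      have "x \<otimes> h [^] p = h [^] p \<otimes> x" 
        unfolding s x(2) nat_pow_pow[OF x(1)] using nat_pow_comm[of x 1 "p * s"] x(1) by simp
      then show ?thesis using x(1) h by (simp add: m_assoc)
    qed
    let ?e = "1 + 3 * r"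
    have "inv (h [^] p) \<otimes> x \<otimes> h [^] p = inv h \<otimes> (inv h \<otimes> (inv h \<otimes> x \<otimes> h) \<otimes> h) \<otimes> h"
      using x(1) h by (simp add: p3 numeral_3_eq_3 m_assoc inv_mult_group)
    also have "\<dots> = x [^] (?e * ?e * ?e)" unfolding xh conj by simp
    finally have "x [^] (?e * ?e * ?e) = x [^] (1::nat)" using c3 x(1) by simp
    moreover have "?e * ?e * ?e = Suc (9 * r + 27 * (r * r + r * r * r))" by (simp add: algebra_simps)
    ultimately have "x [^] Suc (9 * r + 27 * (r * r + r * r * r)) = x" using x(1) by simp
    then have "x \<otimes> x [^] (9 * r + 27 * (r * r + r * r * r)) = x \<otimes> \<one>"
      unfolding nat_pow_Suc2[OF x(1)] r_one[OF x(1)] .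
    then have "x [^] (9 * r + 27 * (r * r + r * r * r)) = \<one>"
      by (rule l_cancel) (use x(1) in simp_all)
    moreover have "x [^] (27 * (r * r + r * r * r)) = \<one>"
    proof -
      have "x [^] (27::nat) = \<one>" using x27 x(1) by (simp add: x(2) p3 nat_pow_pow)
      then show ?thesis using nat_pow_pow[OF x(1), of 27 "r * r + r * r * r"] by simp
    qed
    ultimately have x9: "x [^] (9 * r) = \<one>"
      using nat_pow_mult[OF x(1), of "9 * r" "27 * (r * r + r * r * r)"] x(1) by simp
    have "g \<otimes> comm g h = x [^] (3 * ?e)"
      using conj[of 3] conj_eq_mult_comm[OF gG h] by (simp add: x(2) p3)
    also have "3 * ?e = 3 + 9 * r" by simp
    also have "x [^] (3 + 9 * r) = g \<otimes> \<one>" using x9 x(1) by (simp add: x(2) p3 flip: nat_pow_mult)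
    finally show ?thesis using gG h by simp
  qed
  then have "comm u h0 \<in> {\<one>}"
    using comm_generate_left[OF normal_in_one[OF subgroup_self], of "{g}" h0 u] u gen gG by auto
  then show False using u(3) by simp
qed

end

context nonpowerful_M1_group
begin

theorem nonpowerful_dichotomy:
  shows "multiplicative_mod_Phi \<or> p = 3 \<and> (\<exists>a b. J_generators a b)"
  using multiplicative_if_not_3 multiplicative_if_Phi_central exceptional_structure by blast

lemma multiplicative_regular: "multiplicative_mod_Phi \<Longrightarrow> regular_power_structure p G"
  using regular_power_structureI uniform_carrier powerful_pwG om_carrier_subgroup by blast

text \<open>The order of \<open>Phi\<close> is at most nine and that of \<open>pw G\<close> at most three, so \<open>pw G\<close> is central
  and its cubes are trivial. Then the commutator of two generators has trivial cube too,
  since \<open>(a [a,b])^3\<close> is the cube of a conjugate of \<open>a\<close>. Hence \<open>pw Phi\<close> is trivial, \<open>Phi\<close> is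
  central, and the class is at most two.\<close>

lemma Phi_central_81_class:
  assumes p3: "p = 3" and o: "order G = 81"
    and central: "\<And>f g. f \<in> Phi \<Longrightarrow> g \<in> carrier G \<Longrightarrow> comm f g \<in> pw Phi"
  shows "\<not> has_nilpotency_class G 3"
proof -
  let ?P = "pw (carrier G)"
  obtain b a where ab: "b \<in> carrier G" "a \<in> carrier G" "comm b a \<notin> ?P" using noncommuting_pair .
  note PP = Phi_generators[OF ab]
  have "comm b a \<noteq> \<one>" using ab(3) subgroup.one_closed[OF pwG_subgroup] by auto
  then obtain K where K: "subgroup K G" "card K * p ^ 2 \<le> order G" "?P \<subseteq> K"
    "\<And>x y. x \<in> carrier G \<Longrightarrow> y \<in> carrier G \<Longrightarrow> comm x y \<in> K"
    using card_maximal_intersection[OF ab(1,2)] by metis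
  have "{comm x y | x y. x \<in> carrier G \<and> y \<in> carrier G} \<subseteq> K" using K(4) by safe
  then have "Phi \<subseteq> K" unfolding Phi_def using K(3) by - (rule generate_subgroup_incl[OF _ K(1)], rule Un_least)
  then have "card Phi \<le> card K" by (rule card_mono[OF finite_subgroup[OF K(1)]])
  moreover have "card K * 9 \<le> 81" using K(2) unfolding o p3 by simp
  ultimately have cPhi: "card Phi \<le> 9" by linarith
  have pow3: "\<exists>i. card H = 3 ^ i" if "subgroup H G" for H using card_subgroup[OF that] p3 by metis
  have "?P \<subset> Phi" using pwG_in_Phi ab comm_in_Phi by blast
  then have "card ?P < card Phi" by (rule psubset_card_mono[OF finite_subgroup[OF Phi_subgroup]])
  then have "card ?P < 9" using cPhi by linarith
  moreover obtain i where i: "card ?P = 3 ^ i" using pow3[OF pwG_subgroup] by blast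
  ultimately have "(3::nat) ^ i < 3 ^ 2" by simp
  then have "i < 2" by (rule power_less_imp_less_exp[rotated]) simp
  then have cP: "card ?P \<le> 3" using i by (cases i) (auto simp: numeral_2_eq_2)
  note n1 = normal_in_one[OF subgroup_self]
  have cen: "comm u z = \<one>" if u: "u \<in> ?P" "z \<in> carrier G" for u z
  proof (cases "?P = {\<one>}")
    case True
    then show ?thesis using u by (simp add: comm_def)
  next
    case False
    then have "{\<one>} \<subset> ?P" using subgroup.one_closed[OF pwG_subgroup] by blast
    then obtain w where w: "w \<in> ?P" "w \<notin> {\<one>}" "\<And>h. h \<in> carrier G \<Longrightarrow> comm w h \<in> {\<one>}"
      using normal_in_central_element[OF n1 normal_pwG] by blast
    have wG: "w \<in> carrier G" using w pwG_carrier by blast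
    have ws: "subgroup (generate G {w}) G" using wG by (intro generate_is_subgroup) auto
    have wP: "generate G {w} \<subseteq> ?P" using w(1) by (intro generate_subgroup_incl[OF _ pwG_subgroup]) auto
    obtain k where k: "card (generate G {w}) = 3 ^ k" using pow3[OF ws] by blast
    have "k \<noteq> 0"
    proof
      assume "k = 0"
      then have "ord w = 1" using generate_pow_card[OF wG] k by simp
      then show False using ord_eq_1[OF wG] w(2) by simp
    qed
    then have "(3::nat) ^ 1 \<le> 3 ^ k" by (intro power_increasing) auto
    then have "card ?P \<le> card (generate G {w})" using cP k by simp
    then have "generate G {w} = ?P" using card_seteq[OF finite_subgroup[OF pwG_subgroup] wP] by simp
    then show ?thesis using comm_generate_left[OF n1, of "{w}" z u] w(3) wG u by auto
  qed
  let ?y = "comm a b" let ?z = "comm ?y a"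
  have z: "?z \<in> ?P" using comm_Phi_in_pwG comm_in_Phi ab by blast
  have "pw ?P = {\<one>}"
  proof (rule ccontr)
    assume ne: "pw ?P \<noteq> {\<one>}"
    have s: "subgroup (pw ?P) G" using pwG_carrier by simp
    obtain k where k: "card (pw ?P) = 3 ^ k" using pow3[OF s] by blast
    have "?P \<noteq> {\<one>}"
    proof
      assume "?P = {\<one>}"
      then have "pw ?P \<subseteq> {\<one>}" using pw_subset[OF pwG_subgroup] by simp
      then show False using ne subgroup.one_closed[OF s] by blast
    qed
    then have "pw ?P \<subset> ?P" by (rule pw_psubset[OF pwG_subgroup])
    then have "card (pw ?P) < card ?P" by (rule psubset_card_mono[OF finite_subgroup[OF pwG_subgroup]])
    then have "card (pw ?P) < 3" using cP by linarith
    then have "k = 0" using k by (cases k) auto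
    then obtain e where "pw ?P = {e}" using k by (metis card_1_singletonE power_0)
    then show False using ne subgroup.one_closed[OF s] by auto
  qed
  then have z1: "?z [^] p = \<one>" using pow_in_pw[OF z] by simp
  have "(a \<otimes> ?y) [^] p = a [^] p" using pow_mult_comm[of a b p] cen[OF pow_in_pw[OF ab(2)] ab(1)] ab by simp
  moreover have "(a \<otimes> ?y) [^] p = a [^] p \<otimes> ?y [^] p \<otimes> ?z [^] p"
    unfolding p3 using cen[OF z] ab by (intro cube_mult_class_2) simp_all
  ultimately have "?y [^] p = \<one>" using z1 ab by (simp add: m_assoc)
  then have c1: "comm b a [^] p = \<one>" using ab by (simp add: nat_pow_inv flip: inv_commutator[of a b])
  have "pw Phi = generate G {s [^] p | s. s \<in> insert (comm b a) {g [^] p | g. g \<in> carrier G}}"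
    by (rule powerful_pw_generate[OF powerful_Phi PP])
  also have "\<dots> \<subseteq> {\<one>}"
  proof (rule generate_subgroup_incl[OF _ triv_subgroup], safe)
    show "comm b a [^] p = \<one>" by (rule c1)
    show "(g [^] p) [^] p = \<one>" if "g \<in> carrier G" for g
      using pow_in_pw[OF pow_in_pw[OF that]] \<open>pw ?P = {\<one>}\<close> by simp
  qed
  finally have "pw Phi \<subseteq> {\<one>}" .
  then have "comm f g = \<one>" if "f \<in> Phi" "g \<in> carrier G" for f g using central[OF that] by blast
  then show ?thesis using central_commutators_class_2[OF Phi_subgroup comm_in_Phi] by blast
qed

end

lemma prime_power_81:
  assumes "Factorial_Ring.prime (q::nat)" "(81::nat) = q ^ n"
  shows "q = 3"
proof -
  have "n \<noteq> 0" using assms(2) by (metis numeral_eq_one_iff power_0 semiring_norm(86))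
  then have "q dvd 3 ^ 4" using assms(2) dvd_power[of n q] by simp
  then have "q dvd 3" by (rule prime_dvd_power[OF assms(1)])
  then show ?thesis using primes_dvd_imp_eq[OF assms(1)] by simp
qed

text \<open>The prime in the definition is three because the order is \<open>81\<close>. The two preceding criteria
  exclude all cases but the exceptional one.\<close>

lemma M1_81_maximal_class_iso:
  fixes H :: "('c, 'd) monoid_scheme"
  assumes "M1_81_maximal_class H"
  shows "H \<cong> exceptional_J"
proof -
  obtain q where q: "M1_group q H" and o: "order H = 81" and cl: "has_nilpotency_class H 3"
    using assms by (auto simp: M1_81_maximal_class_def)
  then have pr: "Factorial_Ring.prime q" and gr: "group H" and ex: "\<exists>n. order H = q ^ n"
    by (auto simp: M1_group_def finite_p_group_def)
  obtain n where n: "(81::nat) = q ^ n" using ex o by auto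
  have q3: "q = 3" by (rule prime_power_81[OF pr n])
  interpret group H by fact
  interpret odd_p_group H 3
    using pr ex q3 by unfold_locales auto
  have M1: "powerful_set M" if "maximal_subgroup M H" for M using q that q3 M1_group_iff by simp
  have "\<not> powerful_set (carrier H)" using powerful_81_class[OF _ HOL.refl o] cl by blast
  then interpret nonpowerful_M1_group H 3 using M1 by unfold_locales auto
  have "\<exists>f g. f \<in> Phi \<and> g \<in> carrier H \<and> comm f g \<notin> pw Phi"
    using Phi_central_81_class[OF HOL.refl o] cl by blast
  then obtain a b where "J_generators a b" using exceptional_structure[OF HOL.refl] by blast
  then interpret J: J_group H a b by unfold_locales
  show ?thesis by (rule J.iso_exceptional_J)
qed

theorem theoremC:
  fixes p :: nat and G :: "('a, 'b) monoid_scheme"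
  assumes "Factorial_Ring.prime p" and "odd p" and "M1_group p G"
  shows "(\<not> G \<cong> exceptional_J \<longrightarrow> regular_power_structure p G) \<and>
    (G \<cong> exceptional_J \<longrightarrow> \<not> (\<forall>i\<ge>1. mho_index_eq_card_Omega p i G)) \<and>
    M1_81_maximal_class exceptional_J \<and>
    (\<forall>H :: ('c, 'd) monoid_scheme. M1_81_maximal_class H \<longrightarrow> H \<cong> exceptional_J)"
proof (intro conjI impI allI)
  have gr: "group G" and ex: "\<exists>n. order G = p ^ n"
    using assms(3) by (auto simp: M1_group_def finite_p_group_def)
  interpret odd_p_group G p
    using gr ex assms(1,2) by (intro odd_p_group.intro p_group.intro p_group_axioms.intro odd_p_group_axioms.intro)
  have M1: "powerful_set M" if "maximal_subgroup M G" for M using assms(3) that M1_group_iff by simp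
  show "regular_power_structure p G" if niso: "\<not> G \<cong> exceptional_J"
  proof (cases "powerful_set (carrier G)")
    case False
    then interpret nonpowerful_M1_group G p using M1 by unfold_locales auto
    have "\<not> J_generators a b" for a b
    proof
      assume "J_generators a b"
      then interpret J: J_group G a b by unfold_locales
      show False using J.iso_exceptional_J niso by blast
    qed
    then show ?thesis using nonpowerful_dichotomy multiplicative_regular by blast
  qed (rule powerful_regular)
  show "\<not> (\<forall>i\<ge>1. mho_index_eq_card_Omega p i G)" if iso: "G \<cong> exceptional_J"
  proof -
    obtain a b where "J_group G a b" using J_group_of_iso[OF gr iso] by blast
    then interpret J: J_group G a b .
    obtain n where n: "(81::nat) = p ^ n" using ex J.order_81 by auto
    have "p = 3" by (rule prime_power_81[OF assms(1) n])
    then show ?thesis using J.not_mho_index_eq_card_Omega by blast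
  qed
  interpret EJ: J_group exceptional_J "word_class J_relations [(A1, True)]" "word_class J_relations [(A2, True)]"
    by (rule J_group_exceptional_J)
  show "M1_81_maximal_class exceptional_J" by (rule EJ.M1_81_maximal_class)
  show "H \<cong> exceptional_J" if "M1_81_maximal_class H" for H :: "('c, 'd) monoid_scheme"
    using M1_81_maximal_class_iso[OF that] .
qed

end
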